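(* Let $v$ be a positive integer such that every maximal prime-power factor of $v$ (i.e. every $p^{a}$ with $p$ prime, $p^a\mid v$, $p^{a+1}\nmid v$, $a\ge1$) is a prime power congruent to $1 \pmod 6$ and different from $13$. Then there exists a regular Fano Kaleidoscope FK$(v)$.
   Context: A Fano Kaleidoscope of order $v$, FK$(v)$, is a set $\mathcal F$ of Fano planes (2-$(7,3,1)$ designs) whose points lie in a $v$-set $\mathcal V$, the seven lines of each plane colored with seven distinct colors $c_0,\dots,c_6$, such that for any two distinct points $x,y\in\mathcal V$ and any color $c_i$ there is exactly one plane of $\mathcal F$ whose $c_i$-colored line contains $x$ and $y$. It is regular if there is a group $G$ of order $v$ acting sharply transitively on $\mathcal V$ (so $\mathcal V$ is identified with $G$) such that the collection of colored planes is invariant under translations by $G$. *)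

theory Defs
  imports "HOL-Algebra.Group_Action" "HOL-Library.Numeral_Type" "HOL-Number_Theory.Cong"
    "HOL-Computational_Algebra.Primes"
begin

definition two_design :: "nat \<Rightarrow> nat \<Rightarrow> nat \<Rightarrow> 'a set \<Rightarrow> 'a set set \<Rightarrow> bool" where
  "two_design n k l P B \<longleftrightarrow>
     finite P \<and> card P = n \<and>
     (\<forall>b\<in>B. b \<subseteq> P \<and> card b = k) \<and>
     (\<forall>x\<in>P. \<forall>y\<in>P. x \<noteq> y \<longrightarrow> card {b \<in> B. x \<in> b \<and> y \<in> b} = l)"

text \<open>
  The colors \<open>c\<^sub>0, \<dots>, c\<^sub>6\<close> are the elements of the seven-element type \<open>7\<close>;
  \<open>cline A c\<close> is the line of \<open>A\<close> whose color is \<open>c\<close>. Thus two colorings of the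
  same plane are different colored planes.
\<close>

record 'a colored_plane =
  points :: "'a set"
  cline :: "7 \<Rightarrow> 'a set"

definition colored_fano_plane :: "'a colored_plane \<Rightarrow> bool" where
  "colored_fano_plane A \<longleftrightarrow>
     two_design 7 3 1 (points A) (range (cline A)) \<and> inj (cline A)"

definition fano_kaleidoscope :: "nat \<Rightarrow> 'a set \<Rightarrow> 'a colored_plane set \<Rightarrow> bool" where
  "fano_kaleidoscope v V F \<longleftrightarrow>
     finite V \<and> card V = v \<and>
     (\<forall>A\<in>F. colored_fano_plane A \<and> points A \<subseteq> V) \<and>
     (\<forall>x\<in>V. \<forall>y\<in>V. x \<noteq> y \<longrightarrow> (\<forall>c. \<exists>!A. A \<in> F \<and> x \<in> cline A c \<and> y \<in> cline A c))"

definition map_plane :: "('a \<Rightarrow> 'b) \<Rightarrow> 'a colored_plane \<Rightarrow> 'b colored_plane" where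
  "map_plane f A = \<lparr>points = f ` points A, cline = (\<lambda>c. f ` cline A c)\<rparr>"

definition sharply_transitive_action ::
    "('g, 'm) monoid_scheme \<Rightarrow> 'a set \<Rightarrow> ('g \<Rightarrow> 'a \<Rightarrow> 'a) \<Rightarrow> bool" where
  "sharply_transitive_action G V \<phi> \<longleftrightarrow>
     group_action G V \<phi> \<and> (\<forall>x\<in>V. \<forall>y\<in>V. \<exists>!g. g \<in> carrier G \<and> \<phi> g x = y)"

text \<open>
  A group acting sharply transitively on \<open>V\<close> has as many elements as \<open>V\<close>, so taking
  its elements from the type of the points is no restriction.
\<close>

definition regular_fano_kaleidoscope :: "nat \<Rightarrow> 'a set \<Rightarrow> 'a colored_plane set \<Rightarrow> bool" where
  "regular_fano_kaleidoscope v V F \<longleftrightarrow>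
     fano_kaleidoscope v V F \<and>
     (\<exists>(G :: 'a monoid) \<phi>.
        group G \<and> order G = v \<and> sharply_transitive_action G V \<phi> \<and>
        (\<forall>g\<in>carrier G. map_plane (\<phi> g) ` F = F))"

end

theory Submission
  imports Defs "HOL-Analysis.Convex" "HOL-Number_Theory.Residues"
begin

text \<open>
  Let \<open>R\<close> be a finite field with \<open>q \<equiv> 1 (mod 6)\<close> elements. Suppose that seven points of \<open>R\<close>, labelled by the
  points of a Fano plane, are such that on every line the three differences lie in three different
  cosets of the group of cubes. Since \<open>-1\<close> is a cube, multiplying the plane by representatives of the
  cubes modulo \<open>\<plusminus>1\<close> yields base planes in which, for every colour, every nonzero element of \<open>R\<close> occurs
  exactly once as a difference; their translates form a regular Fano Kaleidoscope on \<open>(R, +)\<close>.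
  Such difference families over a group \<open>G\<close> and over \<open>R\<close> combine to one over \<open>G \<times> R\<close>: spread the base
  planes of \<open>G\<close> out by seven distinct multipliers from \<open>R\<close>. Hence it is enough to treat the fields with
  \<open>p\<close> elements (\<open>p \<equiv> 1 (mod 6)\<close>, \<open>p \<noteq> 13\<close>), with \<open>p\<^sup>2\<close> elements (\<open>p \<equiv> 5 (mod 6)\<close>), and with \<open>13\<^sup>2\<close> and \<open>13\<^sup>3\<close>
  elements.

  For \<open>q \<ge> 74\<^sup>2\<close> the seven points exist because colouring pairs of field elements by the cubic class of
  their difference is quasirandom: a cubic character has constant autocorrelation, which bounds its
  bilinear sums by \<open>\<surd>q\<close>, and the affine group acts two-transitively, which gives the exact second moment
  of the number of points completing two given pairs to rainbow triples. For smaller \<open>q\<close> explicit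
  points are checked.
\<close>

section \<open>Rainbow Fano planes in quasirandom colourings\<close>

text \<open>A line yields six ordered differences, so each colour needs (q - 1)/6 base planes:
  exactly the number of cubes modulo \<plusminus>1. This is why one suitable plane is enough.

  The obstacle is to meet seven conditions on seven points already for q so small that the remaining
  fields can be checked. A Fano plane is therefore cut into a quadrangle and its three diagonal
  points. The six sides of the quadrangle form three opposite pairs, each pair meeting in a diagonal
  point, and second moments take care of these six lines; only the seventh line, joining the
  diagonal points, needs a bilinear estimate. Character sums of polynomials of higher degree do not
  occur.

  A random triple is rainbow with probability 2/9, so a diagonal point has about (2/9)^2 q
  candidates, while three sets of size 3 \<surd>q + 1 already contain a rainbow triple. The two
  sizes cross near \<surd>q = 61; at 74 the gap is wide enough to absorb the variance.

  Products of groups supply all powers of a prime from the first one or two that can be realized.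
  For 13 the exponents 2 and 3 are needed, since 13 itself is excluded.\<close>

lemma complex_cube_roots_of_unity:
  fixes z :: complex
  assumes "z ^ 3 = 1"
  shows "z = 1 \<or> z = Complex (-1/2) (sqrt 3 / 2) \<or> z = Complex (-1/2) (- sqrt 3 / 2)"
proof -
  have "(z - 1) * ((z - Complex (-1/2) (sqrt 3 / 2)) * (z - Complex (-1/2) (- sqrt 3 / 2))) = z ^ 3 - 1"
    by (simp add: complex_eq_iff power3_eq_cube algebra_simps)
  then show ?thesis using assms by auto
qed

text \<open>This is the Fourier expansion on the third power of the group of order three. Six of the
  27 triples are permutations, hence the mean 2/9. A common rotation preserves the condition, so
  only characters with exponent sum divisible by three survive: the product, equal to 1 on every
  permutation, and the quotients, with mean -1/2.\<close>

lemma distinct_cube_roots_expansion: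
  fixes \<alpha> \<beta> \<gamma> :: complex
  assumes "\<alpha> \<in> {1, Complex (-1/2) (sqrt 3 / 2), Complex (-1/2) (- sqrt 3 / 2)}"
    and "\<beta> \<in> {1, Complex (-1/2) (sqrt 3 / 2), Complex (-1/2) (- sqrt 3 / 2)}"
    and "\<gamma> \<in> {1, Complex (-1/2) (sqrt 3 / 2), Complex (-1/2) (- sqrt 3 / 2)}"
  shows "of_bool (\<alpha> \<noteq> \<beta> \<and> \<beta> \<noteq> \<gamma> \<and> \<alpha> \<noteq> \<gamma>) = 2 / 9 * (1 + 2 * Re (\<alpha> * \<beta> * \<gamma>)
     - Re (\<alpha> * cnj \<beta>) - Re (\<beta> * cnj \<gamma>) - Re (\<gamma> * cnj \<alpha>))"
  using assms
  apply (simp only: insert_iff empty_iff)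
  apply (elim disjE FalseE)
  apply (hypsubst, simp add: complex_eq_iff)+
  done

lemma norm_sum_mult_le:
  fixes f g :: "'a \<Rightarrow> complex"
  shows "(cmod (\<Sum>x\<in>A. f x * g x))\<^sup>2 \<le> (\<Sum>x\<in>A. (cmod (f x))\<^sup>2) * (\<Sum>x\<in>A. (cmod (g x))\<^sup>2)"
proof -
  have "cmod (\<Sum>x\<in>A. f x * g x) \<le> (\<Sum>x\<in>A. cmod (f x) * cmod (g x))"
    by (rule order_trans[OF norm_sum]) (simp add: norm_mult)
  then have "(cmod (\<Sum>x\<in>A. f x * g x))\<^sup>2 \<le> (\<Sum>x\<in>A. cmod (f x) * cmod (g x))\<^sup>2"
    by (rule power_mono) simp
  also have "\<dots> \<le> (\<Sum>x\<in>A. (cmod (f x))\<^sup>2) * (\<Sum>x\<in>A. (cmod (g x))\<^sup>2)"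
    by (rule Cauchy_Schwarz_ineq_sum)
  finally show ?thesis .
qed

text \<open>Prepares Chebyshev's inequality for three counts at once. Here \<open>D\<close> is the
  number of completions of a pair to a rainbow triple, \<open>\<mu>\<close> the mean of
  \<open>quad_count\<close>, the bracket after the factor 3 its total squared deviation over all q^4
  quadruples, and 3 s + 1 the set size that guarantees a rainbow triple.\<close>

lemma large_parameter_inequality:
  fixes s D q \<mu> :: real
  assumes s: "74 \<le> s" "q = s * s"
    and D: "2 / 9 * (s - 1)\<^sup>2 \<le> D" "D \<le> 2 / 9 * (s + 1)\<^sup>2"
    and \<mu>: "\<mu> = ((q - 1) * D)\<^sup>2 / q ^ 3"
  shows "3 * (q * ((q - 1) * D)\<^sup>2 + q * (q - 1) * (D * (D - 1))\<^sup>2 - \<mu>\<^sup>2 * q ^ 4) < q ^ 4 * (\<mu> - (3 * s + 1))\<^sup>2"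
    and "3 * s + 1 \<le> \<mu>"
proof -
  have q: "q \<ge> 5476" unfolding s(2) using mult_mono[of 74 s 74 s] s(1) by simp
  have D0: "D \<ge> 0" using D(1) by (rule order_trans[rotated]) simp
  \<comment> \<open>\<open>D\<close> is about 2q/9; the round bound q/4 gives
    \<open>4 * (D * D) \<le> q * D\<close>, which pays for replacing (1 - 1/q)^4 by 1 - 4/q
    below.\<close>
  have Dq: "D \<le> q / 4"
  proof -
    have "74 * s \<le> s * s" using s by simp
    then have "8 + s * 16 \<le> s * s" using s(1) by linarith
    then have "2 / 9 * (s + 1)\<^sup>2 \<le> q / 4" using s by (simp add: power2_eq_square field_simps)
    then show ?thesis using D by linarith
  qed
  \<comment> \<open>The leading constant of \<mu> / q is (2/9)^2, about 0.0494; the correction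
    factors taken at s = 74 reduce it to 0.0467.\<close>
  have m1: "467 / 10000 * (s * s) \<le> \<mu>"
  proof -
    have "73 / 74 * s \<le> s - 1" using s by simp
    then have "(73 / 74 * s)\<^sup>2 \<le> (s - 1)\<^sup>2" using s by (intro power_mono) auto
    then have "2 / 9 * (73 / 74)\<^sup>2 * q \<le> D" using D(1) s(2) by (simp add: power_mult_distrib power2_eq_square)
    moreover have "5475 / 5476 * q \<le> q - 1" using q by simp
    ultimately have "(5475 / 5476 * q) * (2 / 9 * (73 / 74)\<^sup>2 * q) \<le> (q - 1) * D"
      using q by (intro mult_mono) auto
    then have "((5475 / 5476 * q) * (2 / 9 * (73 / 74)\<^sup>2 * q))\<^sup>2 \<le> ((q - 1) * D)\<^sup>2"
      using q by (intro power_mono) auto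
    then have "((5475 / 5476 * q) * (2 / 9 * (73 / 74)\<^sup>2 * q))\<^sup>2 / q ^ 3 \<le> \<mu>"
      unfolding \<mu> using q by (intro divide_right_mono) auto
    moreover have "((5475 / 5476 * q) * (2 / 9 * (73 / 74)\<^sup>2 * q))\<^sup>2 / q ^ 3
        = (5475 / 5476 * (2 / 9 * (73 / 74)\<^sup>2))\<^sup>2 * q"
      using q by (simp add: power2_eq_square power3_eq_cube)
    moreover have "(467 / 10000::real) \<le> (5475 / 5476 * (2 / 9 * (73 / 74)\<^sup>2))\<^sup>2" by (simp add: power2_eq_square)
    then have "467 / 10000 * q \<le> (5475 / 5476 * (2 / 9 * (73 / 74)\<^sup>2))\<^sup>2 * q"
      using q by (intro mult_right_mono) auto
    ultimately have "467 / 10000 * q \<le> \<mu>" by (simp only: order_trans)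
    then show ?thesis by (simp only: s(2))
  qed
  define f where "f = \<mu> - (3 * s + 1)"
  \<comment> \<open>0.0467 * 74 - 3 = 0.4558, and the summand 1 is at most s / 74.\<close>
  have f: "11 / 25 * s \<le> f"
  proof -
    have "467 / 10000 * (74 * s) \<le> 467 / 10000 * (s * s)" using s by simp
    then show ?thesis using m1 s unfolding f_def by linarith
  qed
  then show "3 * s + 1 \<le> \<mu>" using s unfolding f_def by linarith
  \<comment> \<open>For s \<ge> 74 the bound on f exceeds 32.5, so f - 3 exceeds 59/2. Since \<mu> +
    1 = f + 3 s + 2, the target amounts to f (f - 3) > 9 s + 6.\<close>
  have "11 / 25 * s * (59 / 2) \<le> f * (f - 3)"
    using f s by (intro mult_mono) auto
  then have ff: "3 * (\<mu> + 1) < f * f" using s unfolding f_def by (simp add: algebra_simps)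
  have "q * ((q - 1) * D)\<^sup>2 = q ^ 4 * \<mu>" unfolding \<mu> using q by (simp add: field_simps power3_eq_cube power4_eq_xxxx)
  \<comment> \<open>Pairs of distinct points exceed the square of the mean by at most one per
    quadruple. With the diagonal part this bounds the variance by \<mu> + 1, as for a nearly Poisson
    count.\<close>
  moreover have "q * (q - 1) * (D * (D - 1))\<^sup>2 - \<mu>\<^sup>2 * q ^ 4 \<le> q ^ 4"
  proof -
    have e: "\<mu>\<^sup>2 * q ^ 4 = ((q - 1) * D) ^ 4 / q\<^sup>2"
      unfolding \<mu> using q by (simp add: field_simps power2_eq_square power3_eq_cube power4_eq_xxxx)
    have "1 + of_nat 4 * (- 1 / q) \<le> (1 + (- 1 / q)) ^ 4"
      using q by (intro Bernoulli_inequality) (simp add: field_simps)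
    then have "(1 - 4 / q) * q ^ 4 \<le> ((1 - 1 / q) ^ 4) * q ^ 4" using q by (intro mult_right_mono) auto
    also have "\<dots> = (q - 1) ^ 4" unfolding power_mult_distrib[symmetric] using q by (simp add: left_diff_distrib)
    finally have b: "(q - 4) * q ^ 3 \<le> (q - 1) ^ 4" using q by (simp add: field_simps power4_eq_xxxx power3_eq_cube)
    have "(q - 4) * q * D ^ 4 = (q - 4) * q ^ 3 * D ^ 4 / q\<^sup>2"
      using q by (simp add: field_simps power2_eq_square power3_eq_cube)
    also have "\<dots> \<le> (q - 1) ^ 4 * D ^ 4 / q\<^sup>2" using b q by (intro divide_right_mono mult_right_mono) auto
    finally have 1: "(q - 4) * q * D ^ 4 \<le> \<mu>\<^sup>2 * q ^ 4" unfolding e power_mult_distrib .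
    have "D * D \<le> q / 4 * D" using Dq D0 by (intro mult_right_mono) auto
    then have "4 * (D * D) \<le> q * D" by simp
    then have 3: "q * (D - 1)\<^sup>2 - (q - 4) * (D * D) \<le> q"
    proof -
      assume a: "4 * (D * D) \<le> q * D"
      have "q * D \<ge> 0" using q D0 by simp
      then show ?thesis using a by (simp add: power2_eq_square algebra_simps)
    qed
    have "q * (q - 1) * (D * (D - 1))\<^sup>2 - \<mu>\<^sup>2 * q ^ 4 \<le> q * q * (D * (D - 1))\<^sup>2 - (q - 4) * q * D ^ 4"
      using 1 q by (intro diff_mono mult_right_mono mult_left_mono) auto
    also have "\<dots> = q * (D * D) * (q * (D - 1)\<^sup>2 - (q - 4) * (D * D))"
      by (simp add: power2_eq_square power4_eq_xxxx algebra_simps)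
    also have "\<dots> \<le> q * (D * D) * q" using 3 q D0 by (intro mult_left_mono) auto
    also have "\<dots> \<le> q * (q * q) * q" using q D0 Dq by (intro mult_right_mono mult_left_mono mult_mono) auto
    finally show ?thesis by (simp add: power4_eq_xxxx)
  qed
  ultimately have "3 * (q * ((q - 1) * D)\<^sup>2 + q * (q - 1) * (D * (D - 1))\<^sup>2 - \<mu>\<^sup>2 * q ^ 4) \<le> q ^ 4 * (3 * (\<mu> + 1))"
    by (simp add: algebra_simps)
  also have "\<dots> < q ^ 4 * (f * f)" using ff q by simp
  finally show "3 * (q * ((q - 1) * D)\<^sup>2 + q * (q - 1) * (D * (D - 1))\<^sup>2 - \<mu>\<^sup>2 * q ^ 4) < q ^ 4 * (\<mu> - (3 * s + 1))\<^sup>2"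
    by (simp only: f_def power2_eq_square)
qed

text \<open>
  Modelled on \<open>\<chi> x y = \<psi> (x - y)\<close> for a cubic character \<open>\<psi>\<close> of a finite field; the maps in
  \<open>two_transitive\<close> are the affine ones.
\<close>

locale cubic_colouring =
  fixes K :: "'a set" and \<chi> :: "'a \<Rightarrow> 'a \<Rightarrow> complex"
  assumes finite_K: "finite K"
    and diag: "x \<in> K \<Longrightarrow> \<chi> x x = 0"
    and cube: "x \<in> K \<Longrightarrow> y \<in> K \<Longrightarrow> x \<noteq> y \<Longrightarrow> \<chi> x y ^ 3 = 1"
    and sym: "x \<in> K \<Longrightarrow> y \<in> K \<Longrightarrow> \<chi> x y = \<chi> y x"
    and sum_zero: "a \<in> K \<Longrightarrow> (\<Sum>x\<in>K. \<chi> x a) = 0"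
    and correlation: "a \<in> K \<Longrightarrow> b \<in> K \<Longrightarrow> a \<noteq> b \<Longrightarrow> (\<Sum>x\<in>K. \<chi> x a * cnj (\<chi> x b)) = -1"
    and two_transitive: "\<lbrakk>x \<in> K; y \<in> K; x \<noteq> y; x' \<in> K; y' \<in> K; x' \<noteq> y'\<rbrakk> \<Longrightarrow>
      \<exists>\<phi> u. bij_betw \<phi> K K \<and> \<phi> x = x' \<and> \<phi> y = y' \<and> u \<noteq> 0 \<and>
        (\<forall>a\<in>K. \<forall>b\<in>K. \<chi> (\<phi> a) (\<phi> b) = u * \<chi> a b)"
begin

definition rainbow :: "'a \<Rightarrow> 'a \<Rightarrow> 'a \<Rightarrow> bool" where
  "rainbow x y z \<longleftrightarrow> x \<noteq> y \<and> y \<noteq> z \<and> x \<noteq> z \<and>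
     \<chi> x y \<noteq> \<chi> y z \<and> \<chi> y z \<noteq> \<chi> x z \<and> \<chi> x y \<noteq> \<chi> x z"

definition rho :: "'a \<Rightarrow> 'a \<Rightarrow> 'a \<Rightarrow> real" where
  "rho x y z = of_bool (rainbow x y z)"

text \<open>The identity survives the collapse of two points: one colour becomes 0, the other two
  agree by symmetry, and their quotient contributes 1, which cancels the constant term. When all
  three points coincide the constant alone remains, hence the exclusion.\<close>

lemma rho_expansion:
  assumes "x \<in> K" "y \<in> K" "z \<in> K" "\<not> (x = y \<and> y = z)"
  shows "rho x y z = 2 / 9 * (1 + 2 * Re (\<chi> x y * \<chi> y z * \<chi> x z)
     - Re (\<chi> x y * cnj (\<chi> y z)) - Re (\<chi> y z * cnj (\<chi> x z)) - Re (\<chi> x z * cnj (\<chi> x y)))"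
proof -
  have c: "\<chi> a b = 1 \<or> \<chi> a b = Complex (-1/2) (sqrt 3 / 2) \<or> \<chi> a b = Complex (-1/2) (- sqrt 3 / 2)"
    if "a \<in> K" "b \<in> K" "a \<noteq> b" for a b
    using complex_cube_roots_of_unity[OF cube[OF that]] .
  have n: "Re (w * cnj w) = 1" if "w = 1 \<or> w = Complex (-1/2) (sqrt 3 / 2) \<or> w = Complex (-1/2) (- sqrt 3 / 2)" for w
    using that by (elim disjE) (simp_all)
  consider "x = y" "y \<noteq> z" | "y = z" "x \<noteq> z" | "x = z" "x \<noteq> y" | "x \<noteq> y" "y \<noteq> z" "x \<noteq> z"
    using assms by auto
  then show ?thesis
  proof cases
    case 1
    then show ?thesis using n[OF c[OF assms(2,3)]] diag[OF assms(2)] by (simp add: rho_def rainbow_def del: times_complex.sel complex_mult_cnj)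
  next
    case 2
    then show ?thesis using n[OF c[OF assms(1,3)]] diag[OF assms(2)] by (simp add: rho_def rainbow_def del: times_complex.sel complex_mult_cnj)
  next
    case 3
    then show ?thesis using n[OF c[OF assms(1,2)]] diag[OF assms(1)] sym[OF assms(1,2)] by (simp add: rho_def rainbow_def del: times_complex.sel complex_mult_cnj)
  next
    case 4
    have r: "rho x y z = of_bool (\<chi> x y \<noteq> \<chi> y z \<and> \<chi> y z \<noteq> \<chi> x z \<and> \<chi> x y \<noteq> \<chi> x z)"
      using 4 by (simp add: rho_def rainbow_def)
    show ?thesis unfolding r
      by (rule distinct_cube_roots_expansion) (use c[OF assms(1,2) 4(1)] c[OF assms(2,3) 4(2)] c[OF assms(1,3) 4(3)] in auto)
  qed
qed

section \<open>Bilinear, triangle and path sums of the colouring\<close>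

lemma norm_chi: "x \<in> K \<Longrightarrow> y \<in> K \<Longrightarrow> cmod (\<chi> x y) = of_bool (x \<noteq> y)"
proof -
  assume a: "x \<in> K" "y \<in> K"
  show ?thesis
  proof (cases "x = y")
    case True then show ?thesis using a diag by simp
  next
    case False
    then have "cmod (\<chi> x y) ^ 3 = 1"
      using cube[OF a] by (metis norm_one norm_power)
    then have "cmod (\<chi> x y) = 1"
      using power_eq_1_iff[of "cmod (\<chi> x y)" 3] by simp
    then show ?thesis using False by simp
  qed
qed

text \<open>In matrix terms the columns of \<chi> have Gram matrix q I - J: each column has q - 1
  entries of modulus one and a zero on the diagonal.\<close>

lemma correlation_eq:
  assumes "a \<in> K" "b \<in> K"
  shows "(\<Sum>x\<in>K. \<chi> x a * cnj (\<chi> x b)) = of_bool (a = b) * of_nat (card K) - 1"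
proof (cases "a = b")
  case True
  have "(\<Sum>x\<in>K. \<chi> x a * cnj (\<chi> x b)) = (\<Sum>x\<in>K. if x = a then 0 else 1)"
    using True assms norm_chi by (intro sum.cong) (auto simp: complex_norm_square[symmetric] diag)
  also have "\<dots> = of_nat (card (K - {a}))"
    using finite_K by (simp add: sum.If_cases set_diff_eq Int_def)
  finally show ?thesis using True assms finite_K card_gt_0_iff[of K]
    by (simp add: card_Diff_singleton of_nat_diff) (metis Suc_pred card_gt_0_iff empty_iff of_nat_Suc add_diff_cancel_left')
next
  case False then show ?thesis using correlation assms by simp
qed

text \<open>Expanding the square gives the quadratic form of q I - J on g; its J part is minus a
  square and is dropped. Thus the matrix \<chi> has operator norm at most \<surd>q.\<close>

lemma sum_norm_square:
  fixes g :: "'a \<Rightarrow> complex"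
  assumes "A \<subseteq> K"
  shows "(\<Sum>x\<in>K. (cmod (\<Sum>y\<in>A. \<chi> x y * g y))\<^sup>2) \<le> card K * (\<Sum>y\<in>A. (cmod (g y))\<^sup>2)"
proof -
  have fA: "finite A" using assms finite_K finite_subset by blast
  have "of_real (\<Sum>x\<in>K. (cmod (\<Sum>y\<in>A. \<chi> x y * g y))\<^sup>2)
      = (\<Sum>x\<in>K. (\<Sum>y\<in>A. \<chi> x y * g y) * cnj (\<Sum>y\<in>A. \<chi> x y * g y))"
    by (simp add: complex_norm_square[symmetric] of_real_sum del: cnj_sum)
  also have "\<dots> = (\<Sum>x\<in>K. \<Sum>y\<in>A. \<Sum>y'\<in>A. (\<chi> x y * cnj (\<chi> x y')) * (g y * cnj (g y')))"
    by (simp add: cnj_sum sum_product mult_ac)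
  also have "\<dots> = (\<Sum>y\<in>A. \<Sum>y'\<in>A. \<Sum>x\<in>K. (\<chi> x y * cnj (\<chi> x y')) * (g y * cnj (g y')))"
    by (subst sum.swap) (intro sum.cong refl sum.swap)
  also have "\<dots> = (\<Sum>y\<in>A. \<Sum>y'\<in>A. (of_bool (y = y') * of_nat (card K) - 1) * (g y * cnj (g y')))"
    using assms by (intro sum.cong refl) (simp add: sum_distrib_right[symmetric] correlation_eq subset_iff)
  also have "\<dots> = (\<Sum>y\<in>A. of_nat (card K) * (g y * cnj (g y))) - (\<Sum>y\<in>A. g y) * cnj (\<Sum>y\<in>A. g y)"
    using fA by (simp add: algebra_simps sum_subtractf sum_product cnj_sum if_distrib[of "\<lambda>u. _ * u"] of_bool_def cong: if_cong)
  also have "\<dots> = of_real (card K * (\<Sum>y\<in>A. (cmod (g y))\<^sup>2) - (cmod (\<Sum>y\<in>A. g y))\<^sup>2)"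
    by (simp add: complex_norm_square[symmetric] sum_distrib_left of_real_sum del: cnj_sum)
  finally have "(\<Sum>x\<in>K. (cmod (\<Sum>y\<in>A. \<chi> x y * g y))\<^sup>2) = card K * (\<Sum>y\<in>A. (cmod (g y))\<^sup>2) - (cmod (\<Sum>y\<in>A. g y))\<^sup>2"
    by (simp only: of_real_eq_iff)
  then show ?thesis by simp
qed

text \<open>Cauchy-Schwarz in x isolates the inner sums as squares, so that the outer range can be
  enlarged from A to K before the operator norm is applied.\<close>

lemma bilinear_bound:
  fixes f g :: "'a \<Rightarrow> complex"
  assumes "A \<subseteq> K" "B \<subseteq> K"
  shows "cmod (\<Sum>x\<in>A. \<Sum>y\<in>B. f x * (\<chi> x y * g y))
    \<le> sqrt (card K) * sqrt (\<Sum>x\<in>A. (cmod (f x))\<^sup>2) * sqrt (\<Sum>y\<in>B. (cmod (g y))\<^sup>2)"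
proof -
  have "(cmod (\<Sum>x\<in>A. f x * (\<Sum>y\<in>B. \<chi> x y * g y)))\<^sup>2
      \<le> (\<Sum>x\<in>A. (cmod (f x))\<^sup>2) * (\<Sum>x\<in>A. (cmod (\<Sum>y\<in>B. \<chi> x y * g y))\<^sup>2)"
    by (rule norm_sum_mult_le)
  also have "\<dots> \<le> (\<Sum>x\<in>A. (cmod (f x))\<^sup>2) * (\<Sum>x\<in>K. (cmod (\<Sum>y\<in>B. \<chi> x y * g y))\<^sup>2)"
    using assms finite_K by (intro mult_left_mono sum_mono2 sum_nonneg) auto
  also have "\<dots> \<le> (\<Sum>x\<in>A. (cmod (f x))\<^sup>2) * (card K * (\<Sum>y\<in>B. (cmod (g y))\<^sup>2))"
    using assms by (intro mult_left_mono sum_norm_square sum_nonneg) auto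
  finally have "cmod (\<Sum>x\<in>A. f x * (\<Sum>y\<in>B. \<chi> x y * g y)) 
      \<le> sqrt ((\<Sum>x\<in>A. (cmod (f x))\<^sup>2) * (card K * (\<Sum>y\<in>B. (cmod (g y))\<^sup>2)))"
    by (rule real_le_rsqrt)
  also have "\<dots> = sqrt (card K) * sqrt (\<Sum>x\<in>A. (cmod (f x))\<^sup>2) * sqrt (\<Sum>y\<in>B. (cmod (g y))\<^sup>2)"
    by (simp add: real_sqrt_mult)
  finally show ?thesis by (simp add: sum_distrib_left)
qed

text \<open>For fixed w the two edges at w act as weights in a bilinear sum along the edge uv. They
  vanish at w, hence the removed point; this small saving makes the bounds for the degree factor
  exactly later on.\<close>

lemma triangle_bound:
  assumes "U \<subseteq> K" "V \<subseteq> K" "w \<in> K"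
  shows "cmod (\<Sum>u\<in>U. \<Sum>v\<in>V. \<chi> u v * \<chi> v w * \<chi> u w)
    \<le> sqrt (card K) * sqrt (card (U - {w})) * sqrt (card (V - {w}))"
proof -
  have *: "(\<Sum>x\<in>A. (cmod (\<chi> x w))\<^sup>2) = card (A - {w})" if "A \<subseteq> K" for A
  proof -
    have "(\<Sum>x\<in>A. (cmod (\<chi> x w))\<^sup>2) = (\<Sum>x\<in>A. if x = w then 0 else 1)"
      using that assms by (intro sum.cong) (auto simp: norm_chi subset_iff)
    also have "\<dots> = card (A - {w})"
      using finite_K that finite_subset[of A K] by (simp add: sum.If_cases set_diff_eq Int_def)
    finally show ?thesis .
  qed
  have "(\<Sum>u\<in>U. \<Sum>v\<in>V. \<chi> u v * \<chi> v w * \<chi> u w) = (\<Sum>u\<in>U. \<Sum>v\<in>V. \<chi> u w * (\<chi> u v * \<chi> v w))"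
    by (simp add: mult_ac)
  then show ?thesis
    using bilinear_bound[OF assms(1,2), of "\<lambda>x. \<chi> x w" "\<lambda>x. \<chi> x w"] *[OF assms(1)] *[OF assms(2)] by simp
qed

text \<open>Both edges meet in v, so for each v the sum is a product, and Cauchy-Schwarz over v
  separates U from W. The size of V does not enter.\<close>

lemma path_bound:
  assumes "U \<subseteq> K" "V \<subseteq> K" "W \<subseteq> K"
  shows "cmod (\<Sum>v\<in>V. \<Sum>u\<in>U. \<Sum>w\<in>W. \<chi> v u * cnj (\<chi> v w)) \<le> card K * sqrt (card U) * sqrt (card W)"
proof -
  have *: "(\<Sum>v\<in>V. (cmod (\<Sum>u\<in>A. \<chi> v u))\<^sup>2) \<le> real (card K) * real (card A)" if "A \<subseteq> K" for A
  proof -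
    have "(\<Sum>v\<in>V. (cmod (\<Sum>u\<in>A. \<chi> v u))\<^sup>2) \<le> (\<Sum>v\<in>K. (cmod (\<Sum>u\<in>A. \<chi> v u))\<^sup>2)"
      using assms finite_K by (intro sum_mono2) auto
    also have "\<dots> \<le> real (card K) * real (card A)" using sum_norm_square[OF that, of "\<lambda>_. 1"] by simp
    finally show ?thesis .
  qed
  have "(cmod (\<Sum>v\<in>V. (\<Sum>u\<in>U. \<chi> v u) * cnj (\<Sum>w\<in>W. \<chi> v w)))\<^sup>2
      \<le> (\<Sum>v\<in>V. (cmod (\<Sum>u\<in>U. \<chi> v u))\<^sup>2) * (\<Sum>v\<in>V. (cmod (cnj (\<Sum>w\<in>W. \<chi> v w)))\<^sup>2)"
    by (rule norm_sum_mult_le)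
  also have "\<dots> \<le> (real (card K) * real (card U)) * (real (card K) * real (card W))"
    using *[OF assms(1)] *[OF assms(3)] by (intro mult_mono) (auto intro!: sum_nonneg simp del: cnj_sum)
  finally have "cmod (\<Sum>v\<in>V. (\<Sum>u\<in>U. \<chi> v u) * cnj (\<Sum>w\<in>W. \<chi> v w)) \<le> sqrt ((real (card K) * real (card U)) * (real (card K) * real (card W)))"
    by (rule real_le_rsqrt)
  also have "\<dots> = card K * sqrt (card U) * sqrt (card W)"
    by (simp add: real_sqrt_mult)
  finally show ?thesis by (simp add: sum_product cnj_sum)
qed

text \<open>The right-hand side of \<open>rho_expansion\<close>, extended to all triples so that
  sums over a full box split term by term; the fully diagonal triples are corrected
  afterwards.\<close>

definition rho_ser :: "'a \<Rightarrow> 'a \<Rightarrow> 'a \<Rightarrow> real" where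
  "rho_ser x y z = 2 / 9 * (1 + 2 * Re (\<chi> x y * \<chi> y z * \<chi> x z)
     - Re (\<chi> x y * cnj (\<chi> y z)) - Re (\<chi> y z * cnj (\<chi> x z)) - Re (\<chi> x z * cnj (\<chi> x y)))"

lemma rho_ser_eq: "x \<in> K \<Longrightarrow> y \<in> K \<Longrightarrow> z \<in> K \<Longrightarrow> rho_ser x y z = rho x y z + 2 / 9 * of_bool (x = y \<and> y = z)"
  using rho_expansion[of x y z] diag by (auto simp: rho_ser_def rho_def rainbow_def)

text \<open>
  The constant term of the expansion gives \<open>2/9 n\<^sup>3\<close> rainbow triples; the triangle term is at most of
  order \<open>n\<^sup>2 \<surd>q\<close> and the three path terms are at most \<open>q n\<close> each.
\<close>

lemma rainbow_triple_exists:
  assumes "U \<subseteq> K" "V \<subseteq> K" "W \<subseteq> K"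
    and card: "card U = n" "card V = n" "card W = n"
    and n: "3 * sqrt (card K) + 1 \<le> real n"
  shows "\<exists>u\<in>U. \<exists>v\<in>V. \<exists>w\<in>W. rainbow u v w"
proof (rule ccontr)
  assume no: "\<not> ?thesis"
  note fin = finite_subset[OF assms(1) finite_K] finite_subset[OF assms(2) finite_K] finite_subset[OF assms(3) finite_K]
  define s where "s = sqrt (card K)"
  have s: "s \<ge> 0" "s * s = card K" by (simp_all add: s_def)
  have nn: "sqrt n * sqrt n = real n" by simp
  define T where "T = (\<Sum>w\<in>W. \<Sum>u\<in>U. \<Sum>v\<in>V. \<chi> u v * \<chi> v w * \<chi> u w)"
  define P1 where "P1 = (\<Sum>v\<in>V. \<Sum>u\<in>U. \<Sum>w\<in>W. \<chi> v u * cnj (\<chi> v w))"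
  define P2 where "P2 = (\<Sum>w\<in>W. \<Sum>v\<in>V. \<Sum>u\<in>U. \<chi> w v * cnj (\<chi> w u))"
  define P3 where "P3 = (\<Sum>u\<in>U. \<Sum>w\<in>W. \<Sum>v\<in>V. \<chi> u w * cnj (\<chi> u v))"
  have "cmod T \<le> (\<Sum>w\<in>W. s * sqrt n * sqrt n)"
    unfolding T_def
  proof (rule order_trans[OF norm_sum], rule sum_mono)
    fix w assume "w \<in> W"
    then have "cmod (\<Sum>u\<in>U. \<Sum>v\<in>V. \<chi> u v * \<chi> v w * \<chi> u w)
        \<le> sqrt (card K) * sqrt (card (U - {w})) * sqrt (card (V - {w}))"
      using triangle_bound assms by auto
    also have "\<dots> \<le> s * sqrt n * sqrt n"
      using card card_mono[OF fin(1), of "U - {w}"] card_mono[OF fin(2), of "V - {w}"]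
      unfolding s_def by (intro mult_mono) auto
    finally show "cmod (\<Sum>u\<in>U. \<Sum>v\<in>V. \<chi> u v * \<chi> v w * \<chi> u w) \<le> s * sqrt n * sqrt n" .
  qed
  then have T: "cmod T \<le> s * (real n * real n)" using card nn by (simp add: mult_ac)
  have P: "cmod P1 \<le> s * s * n" "cmod P2 \<le> s * s * n" "cmod P3 \<le> s * s * n"
    using path_bound[OF assms(1,2,3)] path_bound[OF assms(2,3,1)] path_bound[OF assms(3,1,2)]
    unfolding P1_def P2_def P3_def s card nn mult.assoc by auto
  have "(\<Sum>u\<in>U. \<Sum>v\<in>V. \<Sum>w\<in>W. rho_ser u v w) = 2 / 9 * (real n ^ 3 + 2 * Re T - Re P1 - Re P2 - Re P3)"
  proof -
    have e1: "(\<Sum>u\<in>U. \<Sum>v\<in>V. \<Sum>w\<in>W. \<chi> u v * \<chi> v w * \<chi> u w) = T"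
    proof -
      have "(\<Sum>u\<in>U. \<Sum>v\<in>V. \<Sum>w\<in>W. \<chi> u v * \<chi> v w * \<chi> u w) = (\<Sum>u\<in>U. \<Sum>w\<in>W. \<Sum>v\<in>V. \<chi> u v * \<chi> v w * \<chi> u w)"
        by (intro sum.cong refl sum.swap)
      also have "\<dots> = T" unfolding T_def by (rule sum.swap)
      finally show ?thesis .
    qed
    have e2: "(\<Sum>u\<in>U. \<Sum>v\<in>V. \<Sum>w\<in>W. \<chi> u v * cnj (\<chi> v w)) = P1"
    proof -
      have "(\<Sum>u\<in>U. \<Sum>v\<in>V. \<Sum>w\<in>W. \<chi> u v * cnj (\<chi> v w)) = (\<Sum>v\<in>V. \<Sum>u\<in>U. \<Sum>w\<in>W. \<chi> u v * cnj (\<chi> v w))"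
        by (rule sum.swap)
      also have "\<dots> = P1" unfolding P1_def
        by (intro sum.cong refl arg_cong2[where f="(*)"] sym subsetD[OF assms(1)] subsetD[OF assms(2)])
      finally show ?thesis .
    qed
    have e3: "(\<Sum>u\<in>U. \<Sum>v\<in>V. \<Sum>w\<in>W. \<chi> v w * cnj (\<chi> u w)) = P2"
    proof -
      have "(\<Sum>u\<in>U. \<Sum>v\<in>V. \<Sum>w\<in>W. \<chi> v w * cnj (\<chi> u w)) = (\<Sum>u\<in>U. \<Sum>w\<in>W. \<Sum>v\<in>V. \<chi> v w * cnj (\<chi> u w))"
        by (intro sum.cong refl sum.swap)
      also have "\<dots> = (\<Sum>u\<in>U. \<Sum>w\<in>W. \<Sum>v\<in>V. \<chi> w v * cnj (\<chi> w u))"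
        by (intro sum.cong refl arg_cong2[where f="(*)"] arg_cong[where f=cnj] sym
            subsetD[OF assms(1)] subsetD[OF assms(2)] subsetD[OF assms(3)])
      also have "\<dots> = (\<Sum>w\<in>W. \<Sum>u\<in>U. \<Sum>v\<in>V. \<chi> w v * cnj (\<chi> w u))" by (rule sum.swap)
      also have "\<dots> = P2" unfolding P2_def by (intro sum.cong refl sum.swap)
      finally show ?thesis .
    qed
    have e4: "(\<Sum>u\<in>U. \<Sum>v\<in>V. \<Sum>w\<in>W. \<chi> u w * cnj (\<chi> u v)) = P3"
      unfolding P3_def by (intro sum.cong refl sum.swap)
    have "(\<Sum>u\<in>U. \<Sum>v\<in>V. \<Sum>w\<in>W. rho_ser u v w) = 2 / 9 * ((\<Sum>u\<in>U. \<Sum>v\<in>V. \<Sum>w\<in>W. 1)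
        + 2 * Re (\<Sum>u\<in>U. \<Sum>v\<in>V. \<Sum>w\<in>W. \<chi> u v * \<chi> v w * \<chi> u w)
        - Re (\<Sum>u\<in>U. \<Sum>v\<in>V. \<Sum>w\<in>W. \<chi> u v * cnj (\<chi> v w))
        - Re (\<Sum>u\<in>U. \<Sum>v\<in>V. \<Sum>w\<in>W. \<chi> v w * cnj (\<chi> u w))
        - Re (\<Sum>u\<in>U. \<Sum>v\<in>V. \<Sum>w\<in>W. \<chi> u w * cnj (\<chi> u v)))"
      unfolding rho_ser_def
      by (simp only: Re_sum sum_distrib_left sum.distrib sum_subtractf right_diff_distrib distrib_left mult_1_right)
    also have "(\<Sum>u\<in>U. \<Sum>v\<in>V. \<Sum>w\<in>W. 1) = real n ^ 3" by (simp add: card power3_eq_cube)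
    finally show ?thesis unfolding e1 e2 e3 e4 .
  qed
  \<comment> \<open>Without rainbow triples only the correction on u = v = w is left, and at most n
    triples are of this form.\<close>
  moreover have "(\<Sum>u\<in>U. \<Sum>v\<in>V. \<Sum>w\<in>W. rho_ser u v w) \<le> 2 / 9 * real n"
  proof -
    have "(\<Sum>u\<in>U. \<Sum>v\<in>V. \<Sum>w\<in>W. rho_ser u v w) = (\<Sum>u\<in>U. \<Sum>v\<in>V. \<Sum>w\<in>W. 2 / 9 * of_bool (u = v \<and> v = w))"
    proof (intro sum.cong refl)
      fix u v w assume "u \<in> U" "v \<in> V" "w \<in> W"
      then show "rho_ser u v w = 2 / 9 * of_bool (u = v \<and> v = w)"
        using rho_ser_eq[of u v w] no assms by (auto simp: rho_def subset_iff)
    qed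
    also have "\<dots> \<le> (\<Sum>u\<in>U. \<Sum>v\<in>V. 2 / 9 * of_bool (u = v))"
    proof (intro sum_mono)
      fix u v
      have "(\<Sum>w\<in>W. 2 / 9 * of_bool (u = v \<and> v = w)) = (\<Sum>w\<in>W. if v = w then 2 / 9 * of_bool (u = v) else (0::real))"
        by (intro sum.cong) auto
      also have "\<dots> \<le> 2 / 9 * of_bool (u = v)" using fin by simp
      finally show "(\<Sum>w\<in>W. 2 / 9 * of_bool (u = v \<and> v = w)) \<le> 2 / 9 * (of_bool (u = v) :: real)" .
    qed
    also have "\<dots> \<le> (\<Sum>u\<in>U. 2 / 9)"
    proof (intro sum_mono)
      fix u
      have "(\<Sum>v\<in>V. 2 / 9 * of_bool (u = v)) = (\<Sum>v\<in>V. if u = v then 2 / 9 else (0::real))"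
        by (intro sum.cong) auto
      also have "\<dots> \<le> 2 / 9" using fin by simp
      finally show "(\<Sum>v\<in>V. 2 / 9 * of_bool (u = v)) \<le> (2 / 9 :: real)" .
    qed
    finally show ?thesis by (simp add: card)
  qed
  ultimately have "2 / 9 * (real n ^ 3 + 2 * Re T - Re P1 - Re P2 - Re P3) \<le> 2 / 9 * real n"
    by (simp only:)
  then have "real n ^ 3 + 2 * Re T - Re P1 - Re P2 - Re P3 \<le> real n"
    by (simp only: mult_le_cancel_left_pos[of "2 / 9 :: real"])
  moreover have "\<bar>Re T\<bar> \<le> s * (real n * real n)" "\<bar>Re P1\<bar> \<le> s * s * n" "\<bar>Re P2\<bar> \<le> s * s * n" "\<bar>Re P3\<bar> \<le> s * s * n"
    using T P abs_Re_le_cmod order_trans by blast+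
  ultimately have "real n ^ 3 - 2 * (s * (real n * real n)) - 3 * (s * s * n) \<le> real n" by linarith
  \<comment> \<open>n^2 - 2 s n - 3 s^2 factors as (n - 3 s)(n + s). This is the origin of the
    threshold 3 s + 1, which makes the first factor at least 1.\<close>
  then have "real n * ((real n - 3 * s) * (real n + s)) \<le> real n * 1"
    by (simp add: algebra_simps power3_eq_cube)
  moreover have "real n \<ge> 1" using n s(1) unfolding s_def by linarith
  ultimately have "(real n - 3 * s) * (real n + s) \<le> 1" by (simp only: mult_le_cancel_left_pos[of "real n"])
  moreover have "1 * (real n + s) \<le> (real n - 3 * s) * (real n + s)"
    using n s by (intro mult_right_mono) (auto simp: s_def)
  ultimately have "real n + s \<le> 1" by simp
  then have "s = 0" "real n = 1" using \<open>real n \<ge> 1\<close> s by linarith+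
  then have "card K = 0" using s by simp
  then have "U = {}" using assms finite_K by auto
  then show False using card \<open>real n = 1\<close> by simp
qed

section \<open>Exact moments from two-transitivity\<close>

lemma two_transitive_rainbow:
  assumes "x \<in> K" "y \<in> K" "x \<noteq> y" "x' \<in> K" "y' \<in> K" "x' \<noteq> y'"
  obtains \<phi> where "bij_betw \<phi> K K" "\<phi> x = x'" "\<phi> y = y'"
    "\<And>a b c. a \<in> K \<Longrightarrow> b \<in> K \<Longrightarrow> c \<in> K \<Longrightarrow> rho (\<phi> a) (\<phi> b) (\<phi> c) = rho a b c"
proof -
  obtain \<phi> u where *: "bij_betw \<phi> K K" "\<phi> x = x'" "\<phi> y = y'" "u \<noteq> 0"
    "\<And>a b. a\<in>K \<Longrightarrow> b\<in>K \<Longrightarrow> \<chi> (\<phi> a) (\<phi> b) = u * \<chi> a b"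
    using two_transitive[OF assms] by blast
  have "rho (\<phi> a) (\<phi> b) (\<phi> c) = rho a b c" if "a \<in> K" "b \<in> K" "c \<in> K" for a b c
    using that * bij_betw_imp_inj_on[OF *(1)] by (simp add: rho_def rainbow_def inj_on_eq_iff)
  then show thesis using that * by blast
qed

text \<open>A map that multiplies all colours by the same nonzero u preserves rainbow triples, so
  any two pairs have equally many completions. If K does not contain two points, 0 serves as a
  placeholder for D.\<close>

lemma degree_exists:
  obtains D :: real where "\<And>y z. y \<in> K \<Longrightarrow> z \<in> K \<Longrightarrow> (\<Sum>x\<in>K. rho x y z) = of_bool (y \<noteq> z) * D"
proof -
  have const: "(\<Sum>x\<in>K. rho x y z) = (\<Sum>x\<in>K. rho x y' z')"
    if yz: "y \<in> K" "z \<in> K" "y \<noteq> z" "y' \<in> K" "z' \<in> K" "y' \<noteq> z'" for y z y' z'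
  proof -
    obtain \<phi> where \<phi>: "bij_betw \<phi> K K" "\<phi> y = y'" "\<phi> z = z'"
      "\<And>a b c. a \<in> K \<Longrightarrow> b \<in> K \<Longrightarrow> c \<in> K \<Longrightarrow> rho (\<phi> a) (\<phi> b) (\<phi> c) = rho a b c"
      using two_transitive_rainbow[OF yz] by blast
    have "(\<Sum>x\<in>K. rho x y' z') = (\<Sum>x\<in>K. rho (\<phi> x) y' z')"
      using sum.reindex_bij_betw[OF \<phi>(1), of "\<lambda>x. rho x y' z'"] by simp
    also have "\<dots> = (\<Sum>x\<in>K. rho (\<phi> x) (\<phi> y) (\<phi> z))" using \<phi> by simp
    also have "\<dots> = (\<Sum>x\<in>K. rho x y z)" using yz by (intro sum.cong refl \<phi>(4))
    finally show ?thesis by simp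
  qed
  show thesis
  proof (cases "\<exists>y\<in>K. \<exists>z\<in>K. y \<noteq> z")
    case True
    then obtain y z where "y \<in> K" "z \<in> K" "y \<noteq> z" by blast
    then have c: "(\<Sum>x\<in>K. rho x y' z') = (\<Sum>x\<in>K. rho x y z)" if "y' \<in> K" "z' \<in> K" "y' \<noteq> z'" for y' z'
      using const that by blast
    have z: "(\<Sum>x\<in>K. rho x y' y') = 0" for y' by (simp add: rho_def rainbow_def)
    show thesis
    proof (rule that[of "\<Sum>x\<in>K. rho x y z"])
      fix y' z' assume "y' \<in> K" "z' \<in> K"
      then show "(\<Sum>x\<in>K. rho x y' z') = of_bool (y' \<noteq> z') * (\<Sum>x\<in>K. rho x y z)"
        using c[of y' z'] z[of y'] by (cases "y' = z'") auto
    qed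
  next
    case False
    then show thesis using that[of 0] by (auto simp: rho_def rainbow_def)
  qed
qed

text \<open>For fixed w and full sums over u and v, the row sums of \<chi> vanish and kill the three
  path terms, leaving a triangle term of size at most s (q - 1). The factor q - 1 then cancels
  because q^2 - 1 \<plusminus> 2 s (q - 1) = (q - 1)(s \<plusminus> 1)^2.\<close>

lemma degree_bounds:
  assumes D: "\<And>y z. y \<in> K \<Longrightarrow> z \<in> K \<Longrightarrow> (\<Sum>x\<in>K. rho x y z) = of_bool (y \<noteq> z) * D"
    and "card K \<ge> 2"
  shows "2 / 9 * (sqrt (card K) - 1)\<^sup>2 \<le> D" "D \<le> 2 / 9 * (sqrt (card K) + 1)\<^sup>2"
proof -
  define q where "q = real (card K)"
  define s where "s = sqrt (card K)"
  have s: "s \<ge> 0" "s * s = q" by (simp_all add: s_def q_def)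
  obtain w where w: "w \<in> K" using assms(2) by fastforce
  have cw: "real (card (K - {w})) = q - 1"
    using w finite_K assms(2) by (simp add: q_def card_Diff_singleton of_nat_diff)
  define T where "T = (\<Sum>u\<in>K. \<Sum>v\<in>K. \<chi> u v * \<chi> v w * \<chi> u w)"
  have "cmod T \<le> s * (sqrt (q - 1) * sqrt (q - 1))"
    using triangle_bound[OF subset_refl subset_refl w] unfolding T_def s_def cw mult.assoc .
  then have T: "\<bar>Re T\<bar> \<le> s * (q - 1)"
    using abs_Re_le_cmod[of T] assms(2) by (simp add: q_def)
  have sum_zero': "(\<Sum>x\<in>K. \<chi> a x) = 0" if "a \<in> K" for a
    using sum_zero[OF that] sym that by (metis (no_types, lifting) sum.cong)
  have z1: "(\<Sum>u\<in>K. \<Sum>v\<in>K. \<chi> u v * cnj (\<chi> v w)) = 0"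
    by (subst sum.swap) (simp add: sum_distrib_right[symmetric] sum_zero)
  have z2: "(\<Sum>u\<in>K. \<Sum>v\<in>K. \<chi> v w * cnj (\<chi> u w)) = 0"
    by (simp add: sum_distrib_right[symmetric] sum_zero w)
  have z3: "(\<Sum>u\<in>K. \<Sum>v\<in>K. \<chi> u w * cnj (\<chi> u v)) = 0"
    by (simp add: sum_distrib_left[symmetric] cnj_sum[symmetric] sum_zero' del: cnj_sum)
  have "(\<Sum>u\<in>K. \<Sum>v\<in>K. rho_ser u v w) = 2 / 9 * ((\<Sum>u\<in>K. \<Sum>v\<in>K. 1)
        + 2 * Re (\<Sum>u\<in>K. \<Sum>v\<in>K. \<chi> u v * \<chi> v w * \<chi> u w)
        - Re (\<Sum>u\<in>K. \<Sum>v\<in>K. \<chi> u v * cnj (\<chi> v w))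
        - Re (\<Sum>u\<in>K. \<Sum>v\<in>K. \<chi> v w * cnj (\<chi> u w))
        - Re (\<Sum>u\<in>K. \<Sum>v\<in>K. \<chi> u w * cnj (\<chi> u v)))"
      unfolding rho_ser_def
      by (simp only: Re_sum sum_distrib_left sum.distrib sum_subtractf right_diff_distrib distrib_left mult_1_right)
  then have 1: "(\<Sum>u\<in>K. \<Sum>v\<in>K. rho_ser u v w) = 2 / 9 * (q * q + 2 * Re T)"
    unfolding z1 z2 z3 T_def by (simp add: q_def)
  have "(\<Sum>u\<in>K. \<Sum>v\<in>K. rho_ser u v w) = (\<Sum>u\<in>K. \<Sum>v\<in>K. rho u v w + 2 / 9 * of_bool (u = v \<and> v = w))"
    using rho_ser_eq w by (intro sum.cong) auto
  also have "\<dots> = (\<Sum>v\<in>K. \<Sum>u\<in>K. rho u v w + 2 / 9 * of_bool (u = v \<and> v = w))"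
    by (rule sum.swap)
  also have "\<dots> = (\<Sum>v\<in>K. of_bool (v \<noteq> w) * D + 2 / 9 * of_bool (v = w))"
  proof (intro sum.cong refl)
    fix v assume v: "v \<in> K"
    have "(\<Sum>u\<in>K. 2 / 9 * of_bool (u = v \<and> v = w)) = (\<Sum>u\<in>K. if u = v then 2 / 9 * of_bool (v = w) else (0::real))"
      by (intro sum.cong) auto
    also have "\<dots> = 2 / 9 * of_bool (v = w)" using finite_K v by simp
    finally show "(\<Sum>u\<in>K. rho u v w + 2 / 9 * of_bool (u = v \<and> v = w)) = of_bool (v \<noteq> w) * D + 2 / 9 * of_bool (v = w)"
      using D[OF v w] by (simp add: sum.distrib)
  qed
  also have "\<dots> = (\<Sum>v\<in>K. D + (if v = w then 2 / 9 - D else 0))"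
    by (intro sum.cong) auto
  also have "\<dots> = (q - 1) * D + 2 / 9"
    using finite_K w by (simp add: sum.distrib q_def algebra_simps)
  finally have eq: "(q - 1) * D = 2 / 9 * (q * q - 1 + 2 * Re T)" using 1 by simp
  have q1: "q - 1 > 0" using assms(2) by (simp add: q_def)
  have "(q - 1) * (2 / 9 * (s - 1)\<^sup>2) = 2 / 9 * (q * q - 1 - 2 * (s * (q - 1)))"
    unfolding s(2)[symmetric] by (simp add: field_simps power2_eq_square)
  also have "\<dots> \<le> (q - 1) * D" unfolding eq using T by simp
  finally show "2 / 9 * (sqrt (card K) - 1)\<^sup>2 \<le> D"
    using q1 by (simp only: mult_le_cancel_left_pos s_def)
  have "(q - 1) * D \<le> 2 / 9 * (q * q - 1 + 2 * (s * (q - 1)))" unfolding eq using T by simp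
  also have "\<dots> = (q - 1) * (2 / 9 * (s + 1)\<^sup>2)"
    unfolding s(2)[symmetric] by (simp add: field_simps power2_eq_square)
  finally show "D \<le> 2 / 9 * (sqrt (card K) + 1)\<^sup>2"
    using q1 by (simp only: mult_le_cancel_left_pos s_def)
qed

text \<open>Counts the candidates for the diagonal point in which the opposite sides ab and a'b' of
  a quadrangle meet.\<close>

definition quad_count :: "'a \<Rightarrow> 'a \<Rightarrow> 'a \<Rightarrow> 'a \<Rightarrow> real" where
  "quad_count a b a' b' = (\<Sum>u\<in>K. rho u a b * rho u a' b')"

lemma rho_idem: "rho x y z * rho x y z = rho x y z"
  by (simp add: rho_def)

lemma rho_rotate: "x \<in> K \<Longrightarrow> y \<in> K \<Longrightarrow> z \<in> K \<Longrightarrow> rho x y z = rho y z x"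
  using sym[of x y] sym[of x z] by (auto simp: rho_def rainbow_def)

lemma quadrangle_first_moment:
  assumes D: "\<And>y z. y \<in> K \<Longrightarrow> z \<in> K \<Longrightarrow> (\<Sum>x\<in>K. rho x y z) = of_bool (y \<noteq> z) * D"
    and u: "u \<in> K"
  shows "(\<Sum>a\<in>K. \<Sum>b\<in>K. rho u a b) = (real (card K) - 1) * D"
proof -
  have "(\<Sum>b\<in>K. rho u a b) = of_bool (u \<noteq> a) * D" if "a \<in> K" for a
  proof -
    have "(\<Sum>b\<in>K. rho u a b) = (\<Sum>b\<in>K. rho b u a)"
      using that u rho_rotate by (intro sum.cong) metis+
    then show ?thesis using D u that by simp
  qed
  then have "(\<Sum>a\<in>K. \<Sum>b\<in>K. rho u a b) = (\<Sum>a\<in>K. D - (if a = u then D else 0))"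
    by (intro sum.cong) auto
  also have "\<dots> = (real (card K) - 1) * D"
    using finite_K u by (simp add: sum_subtractf algebra_simps)
  finally show ?thesis .
qed

text \<open>
  By two-transitivity the sum does not depend on the pair \<open>(u, v)\<close>, so it is found by summing over all pairs.
\<close>

lemma pair_degree:
  assumes D: "\<And>y z. y \<in> K \<Longrightarrow> z \<in> K \<Longrightarrow> (\<Sum>x\<in>K. rho x y z) = of_bool (y \<noteq> z) * D"
    and u: "u \<in> K" "v \<in> K" "u \<noteq> v"
  shows "(\<Sum>a\<in>K. \<Sum>b\<in>K. rho u a b * rho v a b) = D * (D - 1)"
proof -
  define P where "P x y = (\<Sum>a\<in>K. \<Sum>b\<in>K. rho x a b * rho y a b)" for x y
  define q where "q = real (card K)"
  have const: "P x y = P u v" if xy: "x \<in> K" "y \<in> K" "x \<noteq> y" for x y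
  proof -
    obtain \<phi> where \<phi>: "bij_betw \<phi> K K" "\<phi> u = x" "\<phi> v = y"
      "\<And>a b c. a \<in> K \<Longrightarrow> b \<in> K \<Longrightarrow> c \<in> K \<Longrightarrow> rho (\<phi> a) (\<phi> b) (\<phi> c) = rho a b c"
      using two_transitive_rainbow[OF u xy] by blast
    have "P x y = (\<Sum>a\<in>K. \<Sum>b\<in>K. rho x (\<phi> a) b * rho y (\<phi> a) b)"
      unfolding P_def using sum.reindex_bij_betw[OF \<phi>(1), of "\<lambda>a. \<Sum>b\<in>K. rho x a b * rho y a b"] by simp
    also have "\<dots> = (\<Sum>a\<in>K. \<Sum>b\<in>K. rho x (\<phi> a) (\<phi> b) * rho y (\<phi> a) (\<phi> b))"
      by (intro sum.cong refl sum.reindex_bij_betw[OF \<phi>(1), symmetric])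
    also have "\<dots> = P u v"
      unfolding P_def \<phi>(2,3)[symmetric] using u by (intro sum.cong refl arg_cong2[where f="(*)"] \<phi>(4))
    finally show ?thesis .
  qed
  have P_diag: "P x x = (q - 1) * D" if "x \<in> K" for x
    using quadrangle_first_moment[OF D that] by (simp only: P_def q_def rho_idem)
  have "(\<Sum>x\<in>K. \<Sum>y\<in>K. P x y) = (\<Sum>x\<in>K. \<Sum>y\<in>K. P u v + (if y = x then (q - 1) * D - P u v else 0))"
    using const P_diag by (intro sum.cong refl) auto
  also have "\<dots> = q * (q * P u v + ((q - 1) * D - P u v))"
    using finite_K by (simp add: sum.distrib q_def)
  finally have 1: "(\<Sum>x\<in>K. \<Sum>y\<in>K. P x y) = q * (q * P u v + ((q - 1) * D - P u v))" .
  have "(\<Sum>x\<in>K. \<Sum>y\<in>K. P x y) = (\<Sum>a\<in>K. \<Sum>b\<in>K. \<Sum>x\<in>K. \<Sum>y\<in>K. rho x a b * rho y a b)"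
  proof -
    have "(\<Sum>x\<in>K. \<Sum>y\<in>K. P x y) = (\<Sum>x\<in>K. \<Sum>a\<in>K. \<Sum>b\<in>K. \<Sum>y\<in>K. rho x a b * rho y a b)"
      unfolding P_def by (rule sum.cong[OF refl], subst sum.swap, rule sum.cong[OF refl], rule sum.swap)
    also have "\<dots> = (\<Sum>a\<in>K. \<Sum>b\<in>K. \<Sum>x\<in>K. \<Sum>y\<in>K. rho x a b * rho y a b)"
      by (subst sum.swap, rule sum.cong[OF refl], rule sum.swap)
    finally show ?thesis .
  qed
  \<comment> \<open>The same configurations counted by their common edge ab: for a \<noteq> b the
    points x and y are chosen independently among D completions.\<close>
  also have "\<dots> = (\<Sum>a\<in>K. \<Sum>b\<in>K. D * D - (if b = a then D * D else 0))"
    by (intro sum.cong refl) (simp add: sum_product[symmetric] D)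
  also have "\<dots> = q * (q * (D * D) - D * D)"
    using finite_K by (simp add: sum_subtractf q_def)
  finally have "q * (q * P u v + ((q - 1) * D - P u v)) = q * (q * (D * D) - D * D)" using 1 by simp
  then have "q * (q - 1) * P u v = q * (q - 1) * (D * (D - 1))" by (simp add: algebra_simps)
  moreover have "card K \<ge> 2" using u finite_K
    by (metis card_2_iff card_mono empty_subsetI insert_subset)
  ultimately show ?thesis by (simp add: q_def P_def)
qed

text \<open>Moving the sum over u, or over u and v, to the outside turns the sum over quadruples
  into the square of a sum over pairs. These inner sums are known exactly from the degree and the
  pair degree, so no error term arises.\<close>

lemma quadrangle_second_moment:
  assumes D: "\<And>y z. y \<in> K \<Longrightarrow> z \<in> K \<Longrightarrow> (\<Sum>x\<in>K. rho x y z) = of_bool (y \<noteq> z) * D"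
    and q: "q = real (card K)"
  shows "(\<Sum>a\<in>K. \<Sum>b\<in>K. \<Sum>a'\<in>K. \<Sum>b'\<in>K. quad_count a b a' b') = q * ((q - 1) * D)\<^sup>2" (is ?first)
    and "(\<Sum>a\<in>K. \<Sum>b\<in>K. \<Sum>a'\<in>K. \<Sum>b'\<in>K. (quad_count a b a' b')\<^sup>2)
      = q * ((q - 1) * D)\<^sup>2 + q * (q - 1) * (D * (D - 1))\<^sup>2" (is ?second)
proof -
  have sw: "(\<Sum>a\<in>K. \<Sum>b\<in>K. \<Sum>a'\<in>K. \<Sum>b'\<in>K. \<Sum>u\<in>K. f u a b * f u a' b') = (\<Sum>u\<in>K. (\<Sum>a\<in>K. \<Sum>b\<in>K. f u a b)\<^sup>2)"
    for f :: "'a \<Rightarrow> 'a \<Rightarrow> 'a \<Rightarrow> real"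
  proof -
    have "(\<Sum>u\<in>K. (\<Sum>a\<in>K. \<Sum>b\<in>K. f u a b)\<^sup>2) = (\<Sum>u\<in>K. \<Sum>a\<in>K. \<Sum>b\<in>K. \<Sum>a'\<in>K. \<Sum>b'\<in>K. f u a b * f u a' b')"
      by (simp only: power2_eq_square sum_distrib_right) (simp only: sum_distrib_left)
    also have "\<dots> = (\<Sum>a\<in>K. \<Sum>b\<in>K. \<Sum>a'\<in>K. \<Sum>b'\<in>K. \<Sum>u\<in>K. f u a b * f u a' b')"
      by (subst sum.swap, rule sum.cong[OF refl], subst sum.swap, rule sum.cong[OF refl],
          subst sum.swap, rule sum.cong[OF refl], rule sum.swap)
    finally show ?thesis by simp
  qed
  show ?first
    unfolding quad_count_def sw q using quadrangle_first_moment[OF D] by simp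
  have "(\<Sum>a\<in>K. \<Sum>b\<in>K. \<Sum>a'\<in>K. \<Sum>b'\<in>K. (quad_count a b a' b')\<^sup>2)
      = (\<Sum>a\<in>K. \<Sum>b\<in>K. \<Sum>a'\<in>K. \<Sum>b'\<in>K. \<Sum>u\<in>K. \<Sum>v\<in>K. (rho u a b * rho v a b) * (rho u a' b' * rho v a' b'))"
    unfolding quad_count_def power2_eq_square sum_product by (simp add: mult_ac)
  also have "\<dots> = (\<Sum>u\<in>K. \<Sum>v\<in>K. (\<Sum>a\<in>K. \<Sum>b\<in>K. rho u a b * rho v a b)\<^sup>2)"
  proof -
    have "(\<Sum>u\<in>K. \<Sum>v\<in>K. (\<Sum>a\<in>K. \<Sum>b\<in>K. rho u a b * rho v a b)\<^sup>2)
      = (\<Sum>u\<in>K. \<Sum>a\<in>K. \<Sum>b\<in>K. \<Sum>a'\<in>K. \<Sum>b'\<in>K. \<Sum>v\<in>K. (rho u a b * rho v a b) * (rho u a' b' * rho v a' b'))"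
      by (intro sum.cong refl sw[symmetric])
    also have "\<dots> = (\<Sum>a\<in>K. \<Sum>b\<in>K. \<Sum>a'\<in>K. \<Sum>b'\<in>K. \<Sum>u\<in>K. \<Sum>v\<in>K. (rho u a b * rho v a b) * (rho u a' b' * rho v a' b'))"
      by (subst sum.swap, rule sum.cong[OF refl], subst sum.swap, rule sum.cong[OF refl],
          subst sum.swap, rule sum.cong[OF refl], rule sum.swap)
    finally show ?thesis by simp
  qed
  also have "\<dots> = (\<Sum>u\<in>K. \<Sum>v\<in>K. (D * (D - 1))\<^sup>2 + (if v = u then ((q - 1) * D)\<^sup>2 - (D * (D - 1))\<^sup>2 else 0))"
  proof (intro sum.cong refl)
    fix u v assume uv: "u \<in> K" "v \<in> K"
    show "(\<Sum>a\<in>K. \<Sum>b\<in>K. rho u a b * rho v a b)\<^sup>2 = (D * (D - 1))\<^sup>2 + (if v = u then ((q - 1) * D)\<^sup>2 - (D * (D - 1))\<^sup>2 else 0)"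
    proof (cases "v = u")
      case True
      have "(\<Sum>a\<in>K. \<Sum>b\<in>K. rho u a b * rho u a b) = (q - 1) * D"
        using quadrangle_first_moment[OF D uv(1)] by (simp only: rho_idem q)
      then show ?thesis using True by simp
    next
      case False
      then show ?thesis using pair_degree[OF D uv] by auto
    qed
  qed
  also have "\<dots> = q * ((q - 1) * D)\<^sup>2 + q * (q - 1) * (D * (D - 1))\<^sup>2"
    using finite_K by (simp add: sum.distrib q algebra_simps)
  finally show ?second .
qed

text \<open>
  The points \<open>a, b, a', b'\<close> form a quadrangle and \<open>u, v, w\<close> are its diagonal points. By Chebyshev's
  inequality some quadrangle has many candidates for each diagonal point.
\<close>

lemma rainbow_fano_exists:
  assumes "card K \<ge> 5476"
  obtains u v w a b a' b' where "{u, v, w, a, b, a', b'} \<subseteq> K"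
    "rainbow u v w" "rainbow u a b" "rainbow u a' b'" "rainbow v a b'" "rainbow v a' b"
    "rainbow w a a'" "rainbow w b b'"
proof -
  obtain D where D: "\<And>y z. y \<in> K \<Longrightarrow> z \<in> K \<Longrightarrow> (\<Sum>x\<in>K. rho x y z) = of_bool (y \<noteq> z) * D"
    using degree_exists by blast
  define q where "q = real (card K)"
  define s where "s = sqrt (card K)"
  have s: "74 \<le> s" "q = s * s" using assms by (auto simp: s_def q_def real_le_rsqrt)
  have db: "2 / 9 * (s - 1)\<^sup>2 \<le> D" "D \<le> 2 / 9 * (s + 1)\<^sup>2"
    using degree_bounds[OF D] assms unfolding s_def by auto
  \<comment> \<open>The mean of \<open>quad_count\<close>: its first moment q ((q - 1) D)^2 divided
    by the number q^4 of quadruples.\<close>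
  define \<mu> where "\<mu> = ((q - 1) * D)\<^sup>2 / q ^ 3"
  have q0: "q > 0" using assms by (simp add: q_def)
  have ineq: "3 * (q * ((q - 1) * D)\<^sup>2 + q * (q - 1) * (D * (D - 1))\<^sup>2 - \<mu>\<^sup>2 * q ^ 4) < q ^ 4 * (\<mu> - (3 * s + 1))\<^sup>2"
    and le: "3 * s + 1 \<le> \<mu>"
    using large_parameter_inequality[OF s db \<mu>_def] by auto
  let ?S = "\<lambda>f. \<Sum>a\<in>K. \<Sum>b\<in>K. \<Sum>a'\<in>K. \<Sum>b'\<in>K. (f a b a' b' :: real)"
  define M where "M = ?S (\<lambda>a b a' b'. (quad_count a b a' b' - \<mu>)\<^sup>2)"
  have "M = ?S (\<lambda>a b a' b'. (quad_count a b a' b')\<^sup>2) - 2 * \<mu> * ?S quad_count + \<mu>\<^sup>2 * q ^ 4"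
    unfolding M_def power2_diff
    by (simp add: sum.distrib sum_subtractf sum_distrib_left q_def power4_eq_xxxx mult_ac)
  moreover have "?S quad_count = \<mu> * q ^ 4"
  proof -
    have "q * ((q - 1) * D)\<^sup>2 = \<mu> * q ^ 4"
      unfolding \<mu>_def using q0 by (simp add: field_simps power3_eq_cube power4_eq_xxxx)
    then show ?thesis using quadrangle_second_moment(1)[OF D q_def] by simp
  qed
  ultimately have M: "M = q * ((q - 1) * D)\<^sup>2 + q * (q - 1) * (D * (D - 1))\<^sup>2 - \<mu>\<^sup>2 * q ^ 4"
    using quadrangle_second_moment(2)[OF D q_def] by (simp add: power2_eq_square[of \<mu>])
  \<comment> \<open>The three splittings of a quadrangle into opposite sides differ by a permutation
    of the summation variables, so their squared deviations have the same sum.\<close>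
  have M2: "M = ?S (\<lambda>a b a' b'. (quad_count a b' a' b - \<mu>)\<^sup>2)"
  proof -
    have "?S (\<lambda>a b a' b'. (quad_count a b' a' b - \<mu>)\<^sup>2) = (\<Sum>a\<in>K. \<Sum>a'\<in>K. \<Sum>b\<in>K. \<Sum>b'\<in>K. (quad_count a b' a' b - \<mu>)\<^sup>2)"
      by (intro sum.cong refl sum.swap)
    also have "\<dots> = (\<Sum>a\<in>K. \<Sum>a'\<in>K. \<Sum>b'\<in>K. \<Sum>b\<in>K. (quad_count a b' a' b - \<mu>)\<^sup>2)"
      by (rule sum.cong[OF refl], rule sum.cong[OF refl], rule sum.swap)
    also have "\<dots> = M" unfolding M_def by (rule sum.cong[OF refl], rule sum.swap)
    finally show ?thesis by simp
  qed
  have M3: "M = ?S (\<lambda>a b a' b'. (quad_count a a' b b' - \<mu>)\<^sup>2)"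
    unfolding M_def by (rule sum.cong[OF refl], rule sum.swap)
  \<comment> \<open>The average runs over all quadruples, repeated points included; distinctness on
    every line is part of \<open>rainbow\<close>.\<close>
  have "\<exists>a\<in>K. \<exists>b\<in>K. \<exists>a'\<in>K. \<exists>b'\<in>K. 3 * s + 1 \<le> quad_count a b a' b' \<and> 3 * s + 1 \<le> quad_count a b' a' b \<and> 3 * s + 1 \<le> quad_count a a' b b'"
  proof (rule ccontr)
    assume no: "\<not> ?thesis"
    have "q ^ 4 * (\<mu> - (3 * s + 1))\<^sup>2 = ?S (\<lambda>a b a' b'. (\<mu> - (3 * s + 1))\<^sup>2)"
      by (simp add: q_def power4_eq_xxxx)
    also have "\<dots> \<le> ?S (\<lambda>a b a' b'. (quad_count a b a' b' - \<mu>)\<^sup>2 + (quad_count a b' a' b - \<mu>)\<^sup>2 + (quad_count a a' b b' - \<mu>)\<^sup>2)"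
    proof (intro sum_mono)
      fix a b a' b' assume *: "a \<in> K" "b \<in> K" "a' \<in> K" "b' \<in> K"
      have sq: "(\<mu> - (3 * s + 1))\<^sup>2 \<le> (x - \<mu>)\<^sup>2" if "\<not> 3 * s + 1 \<le> x" for x
        unfolding power2_commute[of x] using that le by (intro power_mono) auto
      consider "\<not> 3 * s + 1 \<le> quad_count a b a' b'" | "\<not> 3 * s + 1 \<le> quad_count a b' a' b" | "\<not> 3 * s + 1 \<le> quad_count a a' b b'"
        using no * by blast
      then show "(\<mu> - (3 * s + 1))\<^sup>2 \<le> (quad_count a b a' b' - \<mu>)\<^sup>2 + (quad_count a b' a' b - \<mu>)\<^sup>2 + (quad_count a a' b b' - \<mu>)\<^sup>2"
        by cases (use sq in \<open>simp_all add: add_increasing add_increasing2\<close>)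
    qed
    also have "\<dots> = 3 * M"
      by (simp only: sum.distrib M_def[symmetric] M2[symmetric] M3[symmetric])
    finally show False using ineq unfolding M by (simp only: not_le[symmetric] not_True_eq_False)
  qed
  then obtain a b a' b' where q4: "a \<in> K" "b \<in> K" "a' \<in> K" "b' \<in> K"
    and quad_count: "3 * s + 1 \<le> quad_count a b a' b'" "3 * s + 1 \<le> quad_count a b' a' b" "3 * s + 1 \<le> quad_count a a' b b'"
    by blast
  \<comment> \<open>The three candidate sets are cut down to a common size, as
    \<open>rainbow_triple_exists\<close> requires.\<close>
  define n where "n = nat \<lceil>3 * s + 1\<rceil>"
  have sub: "\<exists>X. X \<subseteq> {u \<in> K. rainbow u x y \<and> rainbow u x' y'} \<and> card X = n" if "3 * s + 1 \<le> quad_count x y x' y'" for x y x' y'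
  proof -
    have "quad_count x y x' y' = (\<Sum>u\<in>K. if rainbow u x y \<and> rainbow u x' y' then 1 else 0)"
      unfolding quad_count_def rho_def by (intro sum.cong) auto
    also have "\<dots> = real (card {u \<in> K. rainbow u x y \<and> rainbow u x' y'})"
      using finite_K by (simp add: sum.If_cases Int_def)
    finally have "\<lceil>3 * s + 1\<rceil> \<le> int (card {u \<in> K. rainbow u x y \<and> rainbow u x' y'})"
      using that by (intro ceiling_le) simp
    then have "n \<le> card {u \<in> K. rainbow u x y \<and> rainbow u x' y'}"
      unfolding n_def by (simp only: nat_le_iff)
    then show ?thesis by (meson obtain_subset_with_card_n)
  qed
  obtain U where U: "U \<subseteq> {u \<in> K. rainbow u a b \<and> rainbow u a' b'}" "card U = n" using sub[OF quad_count(1)] by blast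
  obtain V where V: "V \<subseteq> {u \<in> K. rainbow u a b' \<and> rainbow u a' b}" "card V = n" using sub[OF quad_count(2)] by blast
  obtain W where W: "W \<subseteq> {u \<in> K. rainbow u a a' \<and> rainbow u b b'}" "card W = n" using sub[OF quad_count(3)] by blast
  have "3 * sqrt (card K) + 1 \<le> real n"
    unfolding n_def s_def[symmetric] using s by (simp add: of_nat_ceiling)
  then obtain u v w where "u \<in> U" "v \<in> V" "w \<in> W" "rainbow u v w"
    using rainbow_triple_exists[of U V W n] U V W by blast
  then show thesis using that[of u v w a b a' b'] U V W q4 by blast
qed

end

section \<open>Fano difference families\<close>

lemma forall_7: "(\<forall>c::7. P c) \<longleftrightarrow> P 0 \<and> P 1 \<and> P 2 \<and> P 3 \<and> P 4 \<and> P 5 \<and> P 6"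
proof
  assume *: "P 0 \<and> P 1 \<and> P 2 \<and> P 3 \<and> P 4 \<and> P 5 \<and> P 6"
  show "\<forall>c. P c"
  proof
    fix c :: 7
    show "P c"
    proof (cases c)
      case (of_int z)
      then have "z \<in> {0, 1, 2, 3, 4, 5, 6}" by auto
      then show ?thesis using of_int(1) * by auto
    qed
  qed
qed auto

text \<open>The translates of the perfect difference set {0, 1, 3} modulo 7. The translation that
  produces a line also serves as its colour.\<close>

definition fano_line :: "7 \<Rightarrow> 7 set" where
  "fano_line c = {c, c + 1, c + 3}"

lemma card_fano_line: "card (fano_line c) = 3"
proof -
  have "\<forall>c. card (fano_line c) = 3"
    unfolding forall_7 fano_line_def by simp
  then show ?thesis by blast
qed

lemma fano_line_through: "i \<noteq> j \<Longrightarrow> \<exists>!c. i \<in> fano_line c \<and> j \<in> fano_line c"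
proof -
  have "\<forall>i j. i \<noteq> j \<longrightarrow> (\<exists>c. i \<in> fano_line c \<and> j \<in> fano_line c \<and> (\<forall>c'. i \<in> fano_line c' \<and> j \<in> fano_line c' \<longrightarrow> c' = c))"
    unfolding forall_7 fano_line_def not_all[symmetric] by (simp add: not_all[symmetric])
  then show "i \<noteq> j \<Longrightarrow> ?thesis" by blast
qed

lemma inj_fano_line: "inj fano_line"
proof (rule injI)
  fix c c' assume eq: "fano_line c = fano_line c'"
  have "c \<noteq> c + 1" by simp
  moreover have "c \<in> fano_line c" "c + 1 \<in> fano_line c" by (auto simp: fano_line_def)
  ultimately show "c = c'" using eq fano_line_through[of c "c + 1"] by auto
qed

lemma colored_fano_plane_image:
  fixes f :: "7 \<Rightarrow> 'a"
  assumes f: "inj f"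
  shows "colored_fano_plane \<lparr>points = range f, cline = \<lambda>c. f ` fano_line c\<rparr>"
proof -
  have "card {b \<in> range (\<lambda>c. f ` fano_line c). f i \<in> b \<and> f j \<in> b} = 1" if ij: "i \<noteq> j" for i j
  proof -
    have "\<exists>c. i \<in> fano_line c \<and> j \<in> fano_line c \<and> (\<forall>c'. i \<in> fano_line c' \<and> j \<in> fano_line c' \<longrightarrow> c' = c)"
      using fano_line_through[OF ij] unfolding Ex1_def by (simp only: conj_assoc)
    then obtain c where c: "i \<in> fano_line c" "j \<in> fano_line c" "\<forall>c'. i \<in> fano_line c' \<and> j \<in> fano_line c' \<longrightarrow> c' = c"
      by (elim exE conjE)
    have mem: "f k \<in> f ` fano_line c' \<longleftrightarrow> k \<in> fano_line c'" for k c'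
      using f by (rule inj_image_mem_iff)
    have "{b \<in> range (\<lambda>c. f ` fano_line c). f i \<in> b \<and> f j \<in> b} = {f ` fano_line c}"
    proof (intro equalityI subsetI)
      fix b assume "b \<in> {b \<in> range (\<lambda>c. f ` fano_line c). f i \<in> b \<and> f j \<in> b}"
      then obtain c' where "b = f ` fano_line c'" "i \<in> fano_line c'" "j \<in> fano_line c'" using mem by auto
      then show "b \<in> {f ` fano_line c}" using c(3) by simp
    next
      fix b assume "b \<in> {f ` fano_line c}"
      then show "b \<in> {b \<in> range (\<lambda>c. f ` fano_line c). f i \<in> b \<and> f j \<in> b}" using c(1,2) mem by simp
    qed
    then show ?thesis by simp
  qed
  then have "\<forall>x\<in>range f. \<forall>y\<in>range f. x \<noteq> y \<longrightarrow> card {b \<in> range (\<lambda>c. f ` fano_line c). x \<in> b \<and> y \<in> b} = 1"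
    unfolding ball_simps by metis
  moreover have "card (range f) = 7" using card_image[OF f] by simp
  moreover have "card (f ` fano_line c) = 3" for c
    using card_image[OF inj_on_subset[OF f subset_UNIV]] card_fano_line by metis
  ultimately have "two_design 7 3 1 (range f) (range (\<lambda>c. f ` fano_line c))"
    unfolding two_design_def by (intro conjI) auto
  moreover have "inj (\<lambda>c. f ` fano_line c)"
    using inj_fano_line f by (auto simp: inj_def inj_image_eq_iff)
  ultimately show ?thesis by (simp add: colored_fano_plane_def)
qed

text \<open>Base planes are labellings P by the cyclic model, which builds the colouring in: colour
  c sits on \<open>fano_line c\<close>. The last condition says, without inverses, that d is the
  quotient of \<open>P i\<close> by \<open>P j\<close>.\<close>

definition difference_reps :: "('a, 'm) monoid_scheme \<Rightarrow> (7 \<Rightarrow> 'a) set \<Rightarrow> 7 \<Rightarrow> 'a \<Rightarrow> ((7 \<Rightarrow> 'a) \<times> 7 \<times> 7) set" where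
  "difference_reps G B c d =
     {(P, i, j). P \<in> B \<and> i \<in> fano_line c \<and> j \<in> fano_line c \<and> P i = d \<otimes>\<^bsub>G\<^esub> P j}"

definition fano_difference_family :: "('a, 'm) monoid_scheme \<Rightarrow> (7 \<Rightarrow> 'a) set \<Rightarrow> bool" where
  "fano_difference_family G B \<longleftrightarrow>
     (\<forall>P\<in>B. inj P \<and> range P \<subseteq> carrier G) \<and>
     (\<forall>c. \<forall>d\<in>carrier G - {\<one>\<^bsub>G\<^esub>}. \<exists>!t. t \<in> difference_reps G B c d)"

lemma fano_difference_familyD:
  assumes "fano_difference_family G B" "P \<in> B"
  shows "inj P" "P i \<in> carrier G"
  using assms by (auto simp: fano_difference_family_def)

section \<open>Translates of a difference family\<close>

context comm_group
begin

definition plane :: "'a \<Rightarrow> (7 \<Rightarrow> 'a) \<Rightarrow> 'a colored_plane" where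
  "plane g P = \<lparr>points = range (\<lambda>i. g \<otimes> P i), cline = \<lambda>c. (\<lambda>i. g \<otimes> P i) ` fano_line c\<rparr>"

text \<open>The translate of Q by g has x and y at the places i and j exactly if (Q, i, j)
  represents x / y and g = y / Q j, because g cancels in the quotient. Unique representation thus
  gives a unique plane.\<close>

lemma fano_difference_family_kaleidoscope:
  assumes fin: "finite (carrier G)" and df: "fano_difference_family G B"
  defines "F \<equiv> {plane g P | g P. g \<in> carrier G \<and> P \<in> B}"
  shows "fano_kaleidoscope (order G) (carrier G) F"
  unfolding fano_kaleidoscope_def
proof (intro conjI ballI allI impI)
  note P = fano_difference_familyD[OF df]
  fix A assume "A \<in> F"
  then obtain g Q where A: "A = plane g Q" "g \<in> carrier G" "Q \<in> B" by (auto simp: F_def)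
  then have "inj (\<lambda>i. g \<otimes> Q i)" using P by (auto simp: inj_def)
  then show "colored_fano_plane A" unfolding A(1) plane_def by (rule colored_fano_plane_image)
  show "points A \<subseteq> carrier G" using A P by (auto simp: plane_def)
next
  note P = fano_difference_familyD[OF df]
  fix x y c assume xy: "x \<in> carrier G" "y \<in> carrier G" "x \<noteq> y"
  define d where "d = x \<otimes> inv y"
  have d: "d \<in> carrier G" "x = d \<otimes> y" using xy by (auto simp: d_def m_assoc)
  then have "d \<in> carrier G - {\<one>}" using xy by auto
  then obtain Q i j where t: "(Q, i, j) \<in> difference_reps G B c d"
    and u: "\<And>t. t \<in> difference_reps G B c d \<Longrightarrow> t = (Q, i, j)"
    using df unfolding fano_difference_family_def by (metis prod_cases3)
  then have Q: "Q \<in> B" "i \<in> fano_line c" "j \<in> fano_line c" "Q i = d \<otimes> Q j" by (auto simp: difference_reps_def)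
  define g where "g = y \<otimes> inv (Q j)"
  have g: "g \<in> carrier G" "y = g \<otimes> Q j" using xy P[OF Q(1)] by (auto simp: g_def m_assoc)
  then have "x = g \<otimes> Q i" using d Q P[OF Q(1)] by (simp add: m_lcomm)
  show "\<exists>!A. A \<in> F \<and> x \<in> cline A c \<and> y \<in> cline A c"
  proof (rule ex1I[of _ "plane g Q"])
    show "plane g Q \<in> F \<and> x \<in> cline (plane g Q) c \<and> y \<in> cline (plane g Q) c"
      using g(1) Q(1) image_eqI[of x "\<lambda>i. g \<otimes> Q i", OF \<open>x = g \<otimes> Q i\<close> Q(2)]
        image_eqI[of y "\<lambda>i. g \<otimes> Q i", OF g(2) Q(3)]
      by (auto simp: F_def plane_def)
  next
    fix A assume "A \<in> F \<and> x \<in> cline A c \<and> y \<in> cline A c"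
    then obtain g' Q' i' j' where A: "A = plane g' Q'" "g' \<in> carrier G" "Q' \<in> B" "i' \<in> fano_line c" "j' \<in> fano_line c"
      "x = g' \<otimes> Q' i'" "y = g' \<otimes> Q' j'" by (auto simp: F_def plane_def)
    have "g' \<otimes> Q' i' = g' \<otimes> (d \<otimes> Q' j')" using A d P[OF A(3)] by (metis m_lcomm)
    then have "Q' i' = d \<otimes> Q' j'" using A d P[OF A(3)] by simp
    then have "(Q', i', j') = (Q, i, j)" using u A by (auto simp: difference_reps_def)
    then have "g' = g" using A g P[OF Q(1)] by auto
    then show "A = plane g Q" using A \<open>(Q', i', j') = (Q, i, j)\<close> by simp
  qed
qed (use fin in \<open>auto simp: order_def\<close>)

text \<open>The translations are restricted to the carrier because \<open>Bij\<close> contains only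
  extensional functions.\<close>

lemma translation_action: "sharply_transitive_action G (carrier G) (\<lambda>g. \<lambda>x\<in>carrier G. g \<otimes> x)"
  unfolding sharply_transitive_action_def
proof
  have bij: "(\<lambda>x\<in>carrier G. g \<otimes> x) \<in> Bij (carrier G)" if "g \<in> carrier G" for g
  proof -
    have "bij_betw (\<lambda>x\<in>carrier G. g \<otimes> x) (carrier G) (carrier G)"
      by (rule bij_betw_byWitness[where f' = "\<lambda>x. inv g \<otimes> x"]) (use that in \<open>auto simp: m_assoc[symmetric]\<close>)
    then show ?thesis by (simp add: Bij_def)
  qed
  show "group_action G (carrier G) (\<lambda>g. \<lambda>x\<in>carrier G. g \<otimes> x)"
    unfolding group_action_def
    by (rule group_hom.intro[OF is_group group_BijGroup])
       (auto simp: group_hom_axioms_def hom_def BijGroup_def bij compose_def m_assoc intro!: restrict_ext)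
  show "\<forall>x\<in>carrier G. \<forall>y\<in>carrier G. \<exists>!g. g \<in> carrier G \<and> (\<lambda>x\<in>carrier G. g \<otimes> x) x = y"
  proof (intro ballI)
    fix x y assume "x \<in> carrier G" "y \<in> carrier G"
    then show "\<exists>!g. g \<in> carrier G \<and> (\<lambda>x\<in>carrier G. g \<otimes> x) x = y"
      by (intro ex1I[of _ "y \<otimes> inv x"]) (auto simp: m_assoc)
  qed
qed

end

theorem fano_difference_family_regular:
  fixes G :: "'a monoid"
  assumes G: "comm_group G" and fin: "finite (carrier G)" and df: "fano_difference_family G B"
  shows "\<exists>F. regular_fano_kaleidoscope (order G) (carrier G) F"
proof -
  interpret comm_group G by fact
  define F where "F = {plane g P | g P. g \<in> carrier G \<and> P \<in> B}"
  define \<phi> where "\<phi> = (\<lambda>g. \<lambda>x\<in>carrier G. g \<otimes>\<^bsub>G\<^esub> x)"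
  have P: "P i \<in> carrier G" if "P \<in> B" for P i using fano_difference_familyD[OF df that] by auto
  have m: "map_plane (\<phi> h) (plane g P) = plane (h \<otimes>\<^bsub>G\<^esub> g) P" if "h \<in> carrier G" "g \<in> carrier G" "P \<in> B" for h g P
  proof -
    have "\<phi> h (g \<otimes>\<^bsub>G\<^esub> P i) = h \<otimes>\<^bsub>G\<^esub> g \<otimes>\<^bsub>G\<^esub> P i" for i
      using that P[OF that(3)] by (simp add: \<phi>_def m_assoc)
    then show ?thesis by (simp only: map_plane_def plane_def image_image colored_plane.simps)
  qed
  have FI: "plane g P \<in> F" if "g \<in> carrier G" "P \<in> B" for g P
    unfolding F_def using that by (intro CollectI exI[of _ g] exI[of _ P]) simp
  have "map_plane (\<phi> h) ` F = F" if h: "h \<in> carrier G" for h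
  proof
    show "map_plane (\<phi> h) ` F \<subseteq> F"
    proof (rule image_subsetI)
      fix A assume "A \<in> F"
      then obtain g Q where "A = plane g Q" "g \<in> carrier G" "Q \<in> B" by (auto simp: F_def)
      then show "map_plane (\<phi> h) A \<in> F" using h by (simp add: m FI)
    qed
    show "F \<subseteq> map_plane (\<phi> h) ` F"
    proof
      fix A assume "A \<in> F"
      then obtain g Q where A: "A = plane g Q" "g \<in> carrier G" "Q \<in> B" by (auto simp: F_def)
      then have "A = map_plane (\<phi> h) (plane (inv\<^bsub>G\<^esub> h \<otimes>\<^bsub>G\<^esub> g) Q)"
        using h by (simp add: m m_assoc[symmetric])
      moreover have "plane (inv\<^bsub>G\<^esub> h \<otimes>\<^bsub>G\<^esub> g) Q \<in> F" using A h by (simp add: FI)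
      ultimately show "A \<in> map_plane (\<phi> h) ` F" by (rule image_eqI)
    qed
  qed
  then have "regular_fano_kaleidoscope (order G) (carrier G) F"
    unfolding regular_fano_kaleidoscope_def
    using fano_difference_family_kaleidoscope[OF fin df, folded F_def] translation_action[folded \<phi>_def] is_group
    by blast
  then show ?thesis by blast
qed

text \<open>Carriers inside \<open>nat\<close> give groups of all orders one type. Otherwise each
  direct product would change the type and an induction over the factors of v could not be
  stated.\<close>

definition ex_fano_difference_family :: "nat \<Rightarrow> bool" where
  "ex_fano_difference_family v \<longleftrightarrow>
     (\<exists>(G :: nat monoid) B. comm_group G \<and> finite (carrier G) \<and> order G = v \<and> fano_difference_family G B)"

text \<open>Transport of structure along an injection of the finite carrier into
  \<open>nat\<close>.\<close>

lemma ex_fano_difference_familyI: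
  fixes G :: "('a, 'm) monoid_scheme" (structure)
  assumes "comm_group G" and fin: "finite (carrier G)" and df: "fano_difference_family G B"
  shows "ex_fano_difference_family (order G)"
proof -
  interpret comm_group G by fact
  obtain h :: "'a \<Rightarrow> nat" where h: "inj_on h (carrier G)"
    using finite_imp_inj_to_nat_seg[OF fin] by blast
  define k where "k = inv_into (carrier G) h"
  have k: "k (h x) = x" if "x \<in> carrier G" for x using h that by (simp add: k_def)
  define H :: "nat monoid" where
    "H = \<lparr>carrier = h ` carrier G, monoid.mult = (\<lambda>x y. h (k x \<otimes> k y)), one = h \<one>\<rparr>"
  have H: "carrier H = h ` carrier G" "\<one>\<^bsub>H\<^esub> = h \<one>" "x \<otimes>\<^bsub>H\<^esub> y = h (k x \<otimes> k y)" for x y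
    by (simp_all add: H_def)
  have "comm_group H"
    by (rule comm_groupI)
      (auto simp: H k m_ac, metis inv_closed r_inv)
  moreover have "order H = order G" using h by (simp add: order_def H card_image)
  moreover have "fano_difference_family H ((\<circ>) h ` B)"
    unfolding fano_difference_family_def
  proof (intro conjI ballI allI)
    fix P assume "P \<in> (\<circ>) h ` B"
    then obtain Q where Q: "P = h \<circ> Q" "Q \<in> B" by blast
    show "inj P" "range P \<subseteq> carrier H"
      using fano_difference_familyD[OF df Q(2)] h Q(1) by (auto simp: inj_def inj_on_eq_iff H)
  next
    fix c d assume "d \<in> carrier H - {\<one>\<^bsub>H\<^esub>}"
    then obtain e where e: "d = h e" "e \<in> carrier G - {\<one>}" by (auto simp: H)
    then obtain Q i j where t: "(Q, i, j) \<in> difference_reps G B c e"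
      and u: "\<And>t. t \<in> difference_reps G B c e \<Longrightarrow> t = (Q, i, j)"
      using df unfolding fano_difference_family_def by (metis prod_cases3)
    show "\<exists>!t. t \<in> difference_reps H ((\<circ>) h ` B) c d"
    proof (rule ex1I[of _ "(h \<circ> Q, i, j)"])
      show "(h \<circ> Q, i, j) \<in> difference_reps H ((\<circ>) h ` B) c d"
        using t e fano_difference_familyD[OF df] by (auto simp: difference_reps_def H k)
    next
      fix t assume "t \<in> difference_reps H ((\<circ>) h ` B) c d"
      then obtain Q' i' j' where t': "t = (h \<circ> Q', i', j')" "Q' \<in> B" "i' \<in> fano_line c" "j' \<in> fano_line c"
        "h (Q' i') = h (e \<otimes> Q' j')"
        using e fano_difference_familyD[OF df] by (auto simp: difference_reps_def H k)
      then have "Q' i' = e \<otimes> Q' j'"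
        using h e fano_difference_familyD[OF df t'(2)] by (auto simp: inj_on_eq_iff)
      then have "(Q', i', j') = (Q, i, j)" using u t' by (auto simp: difference_reps_def)
      then show "t = (h \<circ> Q, i, j)" using t' by simp
    qed
  qed
  ultimately show ?thesis
    unfolding ex_fano_difference_family_def using fin by (metis H(1) finite_imageI)
qed

text \<open>A difference (x, y) with x nontrivial determines P, i and j through x; then h solves
  (\<mu> i - \<mu> j) h = y, uniquely because R is a field and \<mu> i \<noteq> \<mu> j. If x is
  trivial, a representation in some \<open>L P h\<close> would force i = j and y = 0, so these
  differences are left to the copies \<open>M Q\<close> of the family over R.\<close>

lemma ex_fano_difference_family_mult:
  fixes R :: "('b, 'm) ring_scheme" (structure)
  assumes G: "ex_fano_difference_family v" and R: "field R" "finite (carrier R)" "7 \<le> order R"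
    and dfR: "fano_difference_family (add_monoid R) C"
  shows "ex_fano_difference_family (v * order R)"
proof -
  obtain G :: "nat monoid" and B where "comm_group G" and finG: "finite (carrier G)" and v: "order G = v"
    and df: "fano_difference_family G B"
    using G unfolding ex_fano_difference_family_def by blast
  interpret G: comm_group G by fact
  interpret R: field R by fact
  obtain \<mu> :: "7 \<Rightarrow> 'b" where \<mu>: "inj \<mu>" "range \<mu> \<subseteq> carrier R"
    using card_le_inj[of "UNIV :: 7 set" "carrier R"] R by (auto simp: order_def)
  then have \<mu>c: "\<mu> i \<in> carrier R" for i by auto
  let ?H = "G \<times>\<times> add_monoid R"
  define L where "L P h = (\<lambda>i. (P i, \<mu> i \<otimes> h))" for P :: "7 \<Rightarrow> nat" and h
  define M where "M Q = (\<lambda>i::7. (\<one>\<^bsub>G\<^esub>, Q i))" for Q :: "7 \<Rightarrow> 'b"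
  define D where "D = {L P h | P h. P \<in> B \<and> h \<in> carrier R} \<union> {M Q | Q. Q \<in> C}"
  have "comm_group ?H"
  proof -
    interpret A: comm_group "add_monoid R" by (rule R.a_comm_group)
    interpret H: group ?H by (rule DirProd_group) unfold_locales
    show ?thesis by (rule H.group_comm_groupI) (auto simp: G.m_comm R.a_comm)
  qed
  moreover have "finite (carrier ?H)" using finG R by simp
  moreover have "order ?H = v * order R" using v by (simp add: order_def card_cartesian_product)
  moreover have "fano_difference_family ?H D"
    unfolding fano_difference_family_def
  proof (intro conjI ballI allI)
    fix P assume "P \<in> D"
    then show "inj P" "range P \<subseteq> carrier ?H"
      using fano_difference_familyD[OF df] fano_difference_familyD[OF dfR] \<mu>c
      by (auto simp: D_def L_def M_def inj_def)
  next
    fix c d assume d: "d \<in> carrier ?H - {\<one>\<^bsub>?H\<^esub>}"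
    obtain x y where xy: "d = (x, y)" "x \<in> carrier G" "y \<in> carrier R" using d by auto
    show "\<exists>!t. t \<in> difference_reps ?H D c d"
    proof (cases "x = \<one>\<^bsub>G\<^esub>")
      case True
      then have "y \<in> carrier (add_monoid R) - {\<one>\<^bsub>add_monoid R\<^esub>}" using d xy by auto
      then obtain Q i j where t: "(Q, i, j) \<in> difference_reps (add_monoid R) C c y"
        and u: "\<And>t. t \<in> difference_reps (add_monoid R) C c y \<Longrightarrow> t = (Q, i, j)"
        using dfR unfolding fano_difference_family_def by (metis prod_cases3)
      show ?thesis
      proof (rule ex1I[of _ "(M Q, i, j)"])
        show "(M Q, i, j) \<in> difference_reps ?H D c d"
          using t True xy by (auto simp: difference_reps_def D_def M_def)
      next
        fix t assume t': "t \<in> difference_reps ?H D c d"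
        obtain P' i' j' where P': "t = (P', i', j')" "P' \<in> D" "i' \<in> fano_line c" "j' \<in> fano_line c"
          "P' i' = d \<otimes>\<^bsub>?H\<^esub> P' j'" using t' by (auto simp: difference_reps_def)
        show "t = (M Q, i, j)"
        proof (cases "\<exists>Q'\<in>C. P' = M Q'")
          case True
          then obtain Q' where "Q' \<in> C" "P' = M Q'" by blast
          then show ?thesis using P' u[of "(Q', i', j')"] xy by (auto simp: difference_reps_def M_def)
        next
          case False
          then obtain P h where L: "P' = L P h" "P \<in> B" "h \<in> carrier R" using P' by (auto simp: D_def)
          then have "P i' = P j'" using P' xy True fano_difference_familyD[OF df L(2)] by (auto simp: L_def)
          then have "i' = j'" using fano_difference_familyD[OF df L(2)] by (auto simp: inj_def)
          then have "\<mu> j' \<otimes> h = y \<oplus> \<mu> j' \<otimes> h" using P' L xy by (auto simp: L_def)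
          then have "y = \<zero>" using L xy \<mu>c by (metis R.add.r_cancel_one' R.m_closed)
          then show ?thesis using d xy True by simp
        qed
      qed
    next
      case False
      then have "x \<in> carrier G - {\<one>\<^bsub>G\<^esub>}" using xy by auto
      then obtain P i j where t: "(P, i, j) \<in> difference_reps G B c x"
        and u: "\<And>t. t \<in> difference_reps G B c x \<Longrightarrow> t = (P, i, j)"
        using df unfolding fano_difference_family_def by (metis prod_cases3)
      then have P: "P \<in> B" "i \<in> fano_line c" "j \<in> fano_line c" "P i = x \<otimes>\<^bsub>G\<^esub> P j" by (auto simp: difference_reps_def)
      have "i \<noteq> j"
      proof
        assume "i = j"
        then have "x = \<one>\<^bsub>G\<^esub>" using P(4) fano_difference_familyD[OF df P(1)] xy by simp
        then show False using False by simp
      qed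
      then have "\<mu> i \<noteq> \<mu> j" using \<mu> by (auto simp: inj_def)
      then have m: "\<mu> i \<ominus> \<mu> j \<in> Units R" using \<mu>c by (simp add: R.field_Units)
      define h where "h = inv (\<mu> i \<ominus> \<mu> j) \<otimes> y"
      have h: "h \<in> carrier R" using m xy by (simp add: h_def)
      have eq: "\<mu> i \<otimes> h' = y \<oplus> \<mu> j \<otimes> h' \<longleftrightarrow> h' = h" if h': "h' \<in> carrier R" for h'
      proof -
        have "\<mu> i \<otimes> h' = y \<oplus> \<mu> j \<otimes> h' \<longleftrightarrow> (\<mu> i \<ominus> \<mu> j) \<otimes> h' = y"
        proof -
          have "(\<mu> i \<ominus> \<mu> j) \<otimes> h' = \<mu> i \<otimes> h' \<oplus> \<ominus> (\<mu> j \<otimes> h')"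
            using \<mu>c h' by (simp add: R.minus_eq R.l_distr R.l_minus)
          then show ?thesis
            using R.add.inv_solve_right[of y "\<mu> i \<otimes> h'" "\<mu> j \<otimes> h'"] \<mu>c h' xy by auto
        qed
        also have "\<dots> \<longleftrightarrow> h' = h"
          using m h' xy by (auto simp: h_def R.m_assoc[symmetric] R.Units_closed)
        finally show ?thesis .
      qed
      show ?thesis
      proof (rule ex1I[of _ "(L P h, i, j)"])
        show "(L P h, i, j) \<in> difference_reps ?H D c d"
          using P xy h eq[OF h] by (auto simp: difference_reps_def D_def L_def)
      next
        fix t assume t': "t \<in> difference_reps ?H D c d"
        obtain P' i' j' where P': "t = (P', i', j')" "P' \<in> D" "i' \<in> fano_line c" "j' \<in> fano_line c"
          "P' i' = d \<otimes>\<^bsub>?H\<^esub> P' j'" using t' by (auto simp: difference_reps_def)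
        show "t = (L P h, i, j)"
        proof (cases "\<exists>Q'\<in>C. P' = M Q'")
          case True
          then show ?thesis using P' xy False by (auto simp: M_def)
        next
          case False
          then obtain P'' h' where L: "P' = L P'' h'" "P'' \<in> B" "h' \<in> carrier R" using P' by (auto simp: D_def)
          then have "(P'', i', j') = (P, i, j)" using P' u xy by (auto simp: difference_reps_def L_def)
          then show ?thesis using P' L xy eq[OF L(3)] by (auto simp: L_def)
        qed
      qed
    qed
  qed
  ultimately show ?thesis using ex_fano_difference_familyI by metis
qed

section \<open>Finite fields with cubic residue symbol\<close>

text \<open>The cubic residue character with values in the field itself. It distinguishes the cosets
  of the cubes, and it can be evaluated by exponentiation.\<close>

definition cubic_symbol :: "('a, 'm) ring_scheme \<Rightarrow> 'a \<Rightarrow> 'a" where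
  "cubic_symbol R x = x [^]\<^bsub>R\<^esub> ((order R - 1) div 3)"

definition rainbow_triple :: "('a, 'm) ring_scheme \<Rightarrow> 'a \<Rightarrow> 'a \<Rightarrow> 'a \<Rightarrow> bool" where
  "rainbow_triple R x y z \<longleftrightarrow> x \<noteq> y \<and> y \<noteq> z \<and> x \<noteq> z \<and>
     cubic_symbol R (x \<ominus>\<^bsub>R\<^esub> y) \<noteq> cubic_symbol R (y \<ominus>\<^bsub>R\<^esub> z) \<and>
     cubic_symbol R (y \<ominus>\<^bsub>R\<^esub> z) \<noteq> cubic_symbol R (x \<ominus>\<^bsub>R\<^esub> z) \<and>
     cubic_symbol R (x \<ominus>\<^bsub>R\<^esub> y) \<noteq> cubic_symbol R (x \<ominus>\<^bsub>R\<^esub> z)"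

definition rainbow_fano :: "('a, 'm) ring_scheme \<Rightarrow> (7 \<Rightarrow> 'a) \<Rightarrow> bool" where
  "rainbow_fano R P \<longleftrightarrow>
     range P \<subseteq> carrier R \<and> (\<forall>c. rainbow_triple R (P c) (P (c + 1)) (P (c + 3)))"

definition seven_points :: "'a \<Rightarrow> 'a \<Rightarrow> 'a \<Rightarrow> 'a \<Rightarrow> 'a \<Rightarrow> 'a \<Rightarrow> 'a \<Rightarrow> 7 \<Rightarrow> 'a" where
  "seven_points a0 a1 a2 a3 a4 a5 a6 i = (if i = 0 then a0 else if i = 1 then a1 else if i = 2 then a2
     else if i = 3 then a3 else if i = 4 then a4 else if i = 5 then a5 else a6)"

lemma rainbow_fano_seven_points:
  assumes "{a0, a1, a2, a3, a4, a5, a6} \<subseteq> carrier R"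
    and "rainbow_triple R a0 a1 a3" "rainbow_triple R a1 a2 a4" "rainbow_triple R a2 a3 a5"
    "rainbow_triple R a3 a4 a6" "rainbow_triple R a4 a5 a0" "rainbow_triple R a5 a6 a1" "rainbow_triple R a6 a0 a2"
  shows "rainbow_fano R (seven_points a0 a1 a2 a3 a4 a5 a6)"
proof -
  let ?P = "seven_points a0 a1 a2 a3 a4 a5 a6"
  have v: "?P 0 = a0" "?P 1 = a1" "?P 2 = a2" "?P 3 = a3" "?P 4 = a4" "?P 5 = a5" "?P 6 = a6"
    by (simp_all add: seven_points_def)
  have seven: "(7::7) = 0" "(8::7) = 1" "(9::7) = 2" by simp_all
  have "\<forall>c. rainbow_triple R (?P c) (?P (c + 1)) (?P (c + 3))"
    unfolding forall_7 using assms(2-) by (simp add: v seven)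
  moreover have "?P i \<in> carrier R" for i
    unfolding seven_points_def using assms(1) by (simp split: if_split)
  then have "range ?P \<subseteq> carrier R" by blast
  ultimately show ?thesis unfolding rainbow_fano_def by (rule conjI[rotated])
qed

lemma inj_on_three: "f a \<noteq> f b \<Longrightarrow> f b \<noteq> f e \<Longrightarrow> f a \<noteq> f e \<Longrightarrow> inj_on f {a, b, e}"
  by (auto simp: inj_on_def)

text \<open>A value identifies its unordered pair. Stated for an abstract f to keep the case
  distinction free of ring terms.\<close>

lemma pairs_of_three_distinct_values:
  assumes "f a b \<noteq> f b e" "f b e \<noteq> f a e" "f a b \<noteq> f a e"
    and "f b a = f a b" "f e a = f a e" "f e b = f b e"
    and "i \<in> {a, b, e}" "j \<in> {a, b, e}" "i \<noteq> j" "i' \<in> {a, b, e}" "j' \<in> {a, b, e}" "i' \<noteq> j'"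
    and "f i j = f i' j'"
  shows "i' = i \<and> j' = j \<or> i' = j \<and> j' = i"
  using assms by (simp only: insert_iff empty_iff simp_thms) (elim disjE; simp)

text \<open>Since 3 divides q - 1 there are three classes modulo cubes. Since q is odd, h and -h
  differ for nonzero h, and (q - 1)/3 is even, which makes -1 a cube.\<close>

locale cubic_field = field R for R :: "('a, 'm) ring_scheme" (structure) +
  assumes finite_carrier: "finite (carrier R)"
    and order_mod_6: "order R mod 6 = 1"
begin

abbreviation \<tau> :: "'a \<Rightarrow> 'a" where "\<tau> \<equiv> cubic_symbol R"

lemma order_eq: "order R - 1 = (order R - 1) div 3 * 3" "even ((order R - 1) div 3)" "odd (order R)"
  using order_mod_6 by presburger+

lemma tau_closed [simp]: "x \<in> carrier R \<Longrightarrow> \<tau> x \<in> carrier R"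
  by (simp add: cubic_symbol_def)

lemma tau_mult: "x \<in> carrier R \<Longrightarrow> y \<in> carrier R \<Longrightarrow> \<tau> (x \<otimes> y) = \<tau> x \<otimes> \<tau> y"
  by (simp add: cubic_symbol_def nat_pow_distrib)

lemma tau_minus: "x \<in> carrier R \<Longrightarrow> \<tau> (\<ominus> x) = \<tau> x"
proof -
  assume x: "x \<in> carrier R"
  obtain k where k: "(order R - 1) div 3 = 2 * k" using order_eq(2) by blast
  have "(\<ominus> x) [^] (2::nat) = x [^] (2::nat)"
    using x by (simp add: numeral_2_eq_2 l_minus r_minus)
  then show ?thesis using x unfolding cubic_symbol_def k
    by (metis nat_pow_pow a_inv_closed)
qed

lemma tau_diff_commute: "x \<in> carrier R \<Longrightarrow> y \<in> carrier R \<Longrightarrow> \<tau> (x \<ominus> y) = \<tau> (y \<ominus> x)"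
  using tau_minus[of "y \<ominus> x"] by (simp add: minus_eq minus_add a_comm)

text \<open>Otherwise x would have order two in the additive group, whose order is odd.\<close>

lemma minus_neq_self:
  assumes "x \<in> carrier R" "x \<noteq> \<zero>"
  shows "\<ominus> x \<noteq> x"
proof
  assume a: "\<ominus> x = x"
  have A: "group (add_monoid R)" using a_comm_group by (rule comm_group.axioms(2))
  have x: "x \<in> carrier (add_monoid R)" using assms by simp
  have x2: "x \<oplus> x = \<zero>" using assms a r_neg[of x] by simp
  obtain k where k: "order R = 2 * k + 1" using order_eq(3) oddE by blast
  have "x [^]\<^bsub>add_monoid R\<^esub> (2 * k + 1) = \<zero>"
    using group.pow_order_eq_1[OF A x] k by (simp add: order_def)
  moreover have "x [^]\<^bsub>add_monoid R\<^esub> (2 * j + 1) = x" for j :: nat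
    by (induction j) (use assms x2 in \<open>simp_all add: numeral_2_eq_2 a_assoc\<close>)
  ultimately show False using assms by simp
qed

text \<open>The multiplicative group is cyclic of order 3 m with generator g, and
  \<open>\<tau> g\<close> is the m-th power of g: an element of order exactly three, whose powers
  are the values of \<open>\<tau>\<close> on nonzero elements.\<close>

lemma generator:
  obtains g where "g \<in> carrier R" "g \<noteq> \<zero>" "\<tau> g \<noteq> \<one>" "\<tau> g \<otimes> \<tau> g \<noteq> \<one>" "\<tau> g \<otimes> \<tau> g \<noteq> \<tau> g" "\<tau> g \<otimes> (\<tau> g \<otimes> \<tau> g) = \<one>"
    "\<And>x. x \<in> carrier R \<Longrightarrow> x \<noteq> \<zero> \<Longrightarrow> \<tau> x = \<one> \<or> \<tau> x = \<tau> g \<or> \<tau> x = \<tau> g \<otimes> \<tau> g"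
proof -
  define m where "m = (order R - 1) div 3"
  interpret M: group "mult_of R" rewrites "([^]\<^bsub>mult_of R\<^esub>) = (([^]) :: _ \<Rightarrow> nat \<Rightarrow> _)" and "\<one>\<^bsub>mult_of R\<^esub> = \<one>"
    by (auto simp: field_mult_group nat_pow_mult_of)
  obtain g where g: "g \<in> carrier (mult_of R)" and gen: "carrier (mult_of R) = {g [^] i | i::nat. i \<in> UNIV}"
    using finite_field_mult_group_has_gen[OF finite_carrier] by blast
  have o: "order (mult_of R) = m * 3"
    using order_mult_of[OF finite_carrier] order_eq(1) by (simp add: m_def)
  have fin: "finite (carrier (mult_of R))" by (rule finite_mult_of[OF finite_carrier])
  have "m > 0" using o M.order_gt_0_iff_finite fin by (metis mult_zero_left neq0_conv)
  have "M.ord g = m * 3"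
  proof -
    have "carrier (mult_of R) = generate (mult_of R) {g}"
      using M.generate_pow_nat[OF g] gen M.ord_ge_1[OF fin g] by simp
    then show ?thesis using M.generate_pow_card[OF g] o by (simp add: order_def)
  qed
  then have pow1: "g [^] k = \<one> \<longleftrightarrow> m * 3 dvd k" for k :: nat
    using M.pow_eq_id[OF g] by simp
  have gc: "g \<in> carrier R" "g \<noteq> \<zero>" using g by auto
  have t: "\<tau> g = g [^] m" by (simp add: cubic_symbol_def m_def)
  have t2: "\<tau> g \<otimes> \<tau> g = g [^] (m * 2)" using gc t by (simp add: nat_pow_mult mult_2_right)
  have t3: "\<tau> g \<otimes> (\<tau> g \<otimes> \<tau> g) = \<one>" unfolding t2 t using gc pow1[of "m * 3"]
    by (simp add: nat_pow_mult) (metis mult_2_right add.assoc mult.commute mult_Suc_right numeral_3_eq_3 numeral_2_eq_2 mult_Suc mult_1 nat_mult_1_right)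
  have n1: "\<tau> g \<noteq> \<one>" unfolding t pow1 using \<open>m > 0\<close> by simp
  have n2: "\<tau> g \<otimes> \<tau> g \<noteq> \<one>" unfolding t2 pow1 using \<open>m > 0\<close> by simp
  have n3: "\<tau> g \<otimes> \<tau> g \<noteq> \<tau> g"
  proof
    assume "\<tau> g \<otimes> \<tau> g = \<tau> g"
    then have "\<tau> g \<otimes> (\<tau> g \<otimes> \<tau> g) = \<tau> g" by simp
    then show False using t3 n1 by simp
  qed
  have "\<tau> x = \<one> \<or> \<tau> x = \<tau> g \<or> \<tau> x = \<tau> g \<otimes> \<tau> g" if "x \<in> carrier R" "x \<noteq> \<zero>" for x
  proof -
    have "x \<in> {g [^] i | i::nat. i \<in> UNIV}" using gen that by (simp only: gen[symmetric]) simp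
    then obtain i :: nat where i: "x = g [^] i" by blast
    have "\<tau> x = \<tau> g [^] i" unfolding i cubic_symbol_def using gc by (simp add: nat_pow_pow mult.commute)
    also have "\<dots> = \<tau> g [^] (3 * (i div 3) + i mod 3)" by simp
    also have "\<dots> = \<tau> g [^] (i mod 3)"
    proof -
      have "\<tau> g [^] (3::nat) = \<one>" using t3 gc by (simp add: numeral_3_eq_3 m_assoc)
      then have "\<tau> g [^] (3 * (i div 3)) = \<one>" using gc nat_pow_pow[of "\<tau> g" 3 "i div 3"] by simp
      then show ?thesis using gc nat_pow_mult[of "\<tau> g" "3 * (i div 3)" "i mod 3"] by simp
    qed
    finally have "\<tau> x = \<tau> g [^] (i mod 3)" .
    moreover have "i mod 3 = 0 \<or> i mod 3 = 1 \<or> i mod 3 = 2" by presburger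
    ultimately show ?thesis using gc by (auto simp: numeral_2_eq_2)
  qed
  then show thesis using that gc n1 n2 n3 t3 by blast
qed

lemma tau_one [simp]: "\<tau> \<one> = \<one>"
  by (simp add: cubic_symbol_def)

lemma tau_nonzero: "x \<in> carrier R \<Longrightarrow> x \<noteq> \<zero> \<Longrightarrow> \<tau> x \<noteq> \<zero>"
  by (metis generator integral tau_closed zero_not_one l_null)

lemma add_diff_cancel': "x \<in> carrier R \<Longrightarrow> y \<in> carrier R \<Longrightarrow> x \<oplus> (y \<ominus> x) = y"
  by algebra

lemma add_diff_cancel_left': "x \<in> carrier R \<Longrightarrow> y \<in> carrier R \<Longrightarrow> (x \<oplus> y) \<ominus> x = y"
  by algebra

lemma add_diff_add_cancel: "x \<in> carrier R \<Longrightarrow> y \<in> carrier R \<Longrightarrow> z \<in> carrier R \<Longrightarrow> (x \<oplus> y) \<ominus> (x \<oplus> z) = y \<ominus> z"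
  by algebra

lemma diff_diff_cancel: "x \<in> carrier R \<Longrightarrow> y \<in> carrier R \<Longrightarrow> z \<in> carrier R \<Longrightarrow> (y \<ominus> x) \<ominus> (z \<ominus> x) = y \<ominus> z"
  by algebra

lemma mult_inv_div_cancel:
  assumes "a \<in> Units R" "b \<in> Units R"
  shows "a \<otimes> inv (a \<otimes> inv b) = b"
proof -
  note c = Units_closed[OF assms(1)] Units_closed[OF assms(2)] Units_inv_closed[OF assms(1)] Units_inv_closed[OF assms(2)]
  have "(a \<otimes> inv b) \<otimes> (b \<otimes> inv a) = a \<otimes> ((inv b \<otimes> b) \<otimes> inv a)"
    using c by (simp add: m_assoc)
  then have "inv (a \<otimes> inv b) = b \<otimes> inv a"
    using c assms by (intro comm_inv_char) auto
  then show ?thesis using c assms m_lcomm[of a b "inv a"] by simp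
qed

text \<open>The choice is made from the set {h, -h}, which is the same set for h and -h, so
  \<open>sel\<close> returns one representative for both.\<close>

lemma half_system:
  obtains S where "S \<subseteq> {h \<in> carrier R. h \<noteq> \<zero> \<and> \<tau> h = \<one>}"
    "\<And>h. h \<in> carrier R \<Longrightarrow> h \<noteq> \<zero> \<Longrightarrow> \<tau> h = \<one> \<Longrightarrow> h \<in> S \<longleftrightarrow> \<ominus> h \<notin> S"
proof -
  define H where "H = {h \<in> carrier R. h \<noteq> \<zero> \<and> \<tau> h = \<one>}"
  define sel where "sel h = (SOME x. x \<in> {h, \<ominus> h})" for h
  have sel: "sel h \<in> {h, \<ominus> h}" for h unfolding sel_def by (rule someI[of _ h]) simp
  have sel_minus: "sel (\<ominus> h) = sel h" if "h \<in> H" for h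
    using that by (simp add: sel_def H_def insert_commute)
  have Hm: "\<ominus> h \<in> H" if "h \<in> H" for h
    using that tau_minus by (auto simp: H_def)
  show thesis
  proof (rule that[of "sel ` H"])
    show "sel ` H \<subseteq> {h \<in> carrier R. h \<noteq> \<zero> \<and> \<tau> h = \<one>}"
      unfolding H_def[symmetric] by (rule image_subsetI) (metis sel Hm insertE singletonD)
    fix h assume "h \<in> carrier R" "h \<noteq> \<zero>" "\<tau> h = \<one>"
    then have h: "h \<in> H" by (simp add: H_def)
    have fix1: "k = sel k" if k: "k \<in> sel ` H" for k
    proof -
      obtain l where l: "l \<in> H" "k = sel l" using k by blast
      then show ?thesis using sel[of l] sel_minus[of l] by auto
    qed
    have "h \<noteq> \<ominus> h" using h minus_neq_self[of h] by (auto simp: H_def)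
    then show "h \<in> sel ` H \<longleftrightarrow> \<ominus> h \<notin> sel ` H"
      using fix1[of h] fix1[of "\<ominus> h"] sel_minus[OF h] sel[of h] h Hm[OF h] by (metis imageI insertE singletonD)
  qed
qed

lemma rainbow_fano_pairs:
  assumes P: "rainbow_fano R P"
    and ij: "i \<in> fano_line c" "j \<in> fano_line c" "i \<noteq> j"
    and ij': "i' \<in> fano_line c" "j' \<in> fano_line c" "i' \<noteq> j'"
    and eq: "\<tau> (P i \<ominus> P j) = \<tau> (P i' \<ominus> P j')"
  shows "i' = i \<and> j' = j \<or> i' = j \<and> j' = i"
proof -
  have c: "P k \<in> carrier R" for k using P by (auto simp: rainbow_fano_def)
  have r: "rainbow_triple R (P c) (P (c + 1)) (P (c + 3))" using P by (auto simp: rainbow_fano_def)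
  note t = tau_diff_commute[OF c c]
  show ?thesis
    by (rule pairs_of_three_distinct_values[of "\<lambda>i j. \<tau> (P i \<ominus> P j)" c "c + 1" "c + 3"])
      (use r ij ij' eq in \<open>simp_all only: rainbow_triple_def fano_line_def t[of "c + 1" c] t[of "c + 3" c] t[of "c + 3" "c + 1"] not_False_eq_True simp_thms\<close>)
qed

text \<open>A nonzero element has one of only three symbols, and the three differences of a line
  exhaust them.\<close>

lemma rainbow_fano_covers:
  assumes P: "rainbow_fano R P" and d: "d \<in> carrier R" "d \<noteq> \<zero>"
  obtains i j where "i \<in> fano_line c" "j \<in> fano_line c" "\<tau> (P i \<ominus> P j) = \<tau> d"
proof -
  have c: "P k \<in> carrier R" for k using P by (auto simp: rainbow_fano_def)
  have r: "rainbow_triple R (P c) (P (c + 1)) (P (c + 3))" using P by (auto simp: rainbow_fano_def)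
  have nz: "P i \<ominus> P j \<noteq> \<zero>" if "P i \<noteq> P j" for i j using that c by simp
  obtain g where g: "\<And>x. x \<in> carrier R \<Longrightarrow> x \<noteq> \<zero> \<Longrightarrow> \<tau> x = \<one> \<or> \<tau> x = \<tau> g \<or> \<tau> x = \<tau> g \<otimes> \<tau> g"
    using generator by metis
  have "\<tau> (P c \<ominus> P (c + 1)) = \<tau> d \<or> \<tau> (P (c + 1) \<ominus> P (c + 3)) = \<tau> d \<or> \<tau> (P c \<ominus> P (c + 3)) = \<tau> d"
    using g[of d] d g[of "P c \<ominus> P (c + 1)"] g[of "P (c + 1) \<ominus> P (c + 3)"] g[of "P c \<ominus> P (c + 3)"] r c nz
    unfolding rainbow_triple_def by (metis minus_closed)
  then show thesis using that unfolding fano_line_def by blast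
qed

text \<open>
  The base planes are \<open>s P\<close>, where \<open>s\<close> runs through representatives of the cubes modulo \<open>\<plusminus>1\<close>.
\<close>

theorem rainbow_fano_difference_family:
  assumes P: "rainbow_fano R P"
  shows "\<exists>B. fano_difference_family (add_monoid R) B"
proof -
  have c: "P k \<in> carrier R" for k using P by (auto simp: rainbow_fano_def)
  have injP: "inj P"
  proof (rule injI, rule ccontr)
    fix i j assume ij: "P i = P j" "i \<noteq> j"
    obtain c where c: "i \<in> fano_line c" "j \<in> fano_line c"
      using fano_line_through[OF ij(2)] by (elim ex1E conjE)
    have "P c \<noteq> P (c + 1)" "P (c + 1) \<noteq> P (c + 3)" "P c \<noteq> P (c + 3)"
      using P unfolding rainbow_fano_def rainbow_triple_def by simp_all
    then have "inj_on P (fano_line c)" unfolding fano_line_def by (rule inj_on_three)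
    then show False using c ij by (simp only: inj_on_eq_iff)
  qed
  obtain S where S: "S \<subseteq> {h \<in> carrier R. h \<noteq> \<zero> \<and> \<tau> h = \<one>}"
    "\<And>h. h \<in> carrier R \<Longrightarrow> h \<noteq> \<zero> \<Longrightarrow> \<tau> h = \<one> \<Longrightarrow> h \<in> S \<longleftrightarrow> \<ominus> h \<notin> S"
    by (rule half_system, rule that, assumption, assumption)
  have Sc: "s \<in> carrier R" "s \<noteq> \<zero>" "\<tau> s = \<one>" if "s \<in> S" for s using S(1) that by auto
  define Q where "Q s = (\<lambda>i. s \<otimes> P i)" for s
  have Qc: "Q s i \<in> carrier R" if "s \<in> S" for s i using Sc[OF that] c by (simp add: Q_def)
  have diff: "Q s i = d \<oplus> Q s j \<longleftrightarrow> s \<otimes> (P i \<ominus> P j) = d" if "s \<in> S" "d \<in> carrier R" for s i j d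
  proof -
    have "s \<otimes> (P i \<ominus> P j) = Q s i \<oplus> \<ominus> Q s j"
      using Sc(1)[OF that(1)] c by (simp add: Q_def minus_eq r_distr r_minus)
    then show ?thesis
      using add.inv_solve_right[of d "Q s i" "Q s j"] Qc[OF that(1)] that(2) by auto
  qed
  have "fano_difference_family (add_monoid R) (Q ` S)"
    unfolding fano_difference_family_def
  proof (intro conjI ballI allI)
    fix T assume "T \<in> Q ` S"
    then obtain s where s: "s \<in> S" "T = Q s" by blast
    show "inj T"
    proof (rule injI)
      fix i j assume "T i = T j"
      then have "P i = P j" using s Sc[OF s(1)] c by (simp add: Q_def m_lcancel)
      then show "i = j" using injP by (simp add: inj_eq)
    qed
    show "range T \<subseteq> carrier (add_monoid R)" using s Qc by auto
  next
    fix c d assume "d \<in> carrier (add_monoid R) - {\<one>\<^bsub>add_monoid R\<^esub>}"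
    then have d: "d \<in> carrier R" "d \<noteq> \<zero>" by auto
    obtain i j where ij: "i \<in> fano_line c" "j \<in> fano_line c" "\<tau> (P i \<ominus> P j) = \<tau> d"
      by (rule rainbow_fano_covers[OF P d, of c])
    define e where "e = P i \<ominus> P j"
    have ec: "e \<in> carrier R" using c by (simp add: e_def)
    have "\<tau> e \<noteq> \<zero>" using ij tau_nonzero d by (simp add: e_def)
    moreover have "\<tau> \<zero> = \<zero>"
    proof -
      \<comment> \<open>Ensures a positive exponent: with exponent zero, \<open>\<tau>\<close> would
        send zero to one.\<close>
      have "order R \<ge> 2" using c[of 0] one_not_zero zero_closed one_closed finite_carrier unfolding order_def
        by (metis card_2_iff card_mono empty_subsetI insert_subset)
      then have "(order R - 1) div 3 \<noteq> 0" using order_eq(1) by linarith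
      then show ?thesis by (simp add: cubic_symbol_def nat_pow_zero)
    qed
    ultimately have e0: "e \<noteq> \<zero>" by metis
    then have eU: "e \<in> Units R" using ec by (simp add: field_Units)
    have nij: "i \<noteq> j" using e0 c by (auto simp: e_def)
    \<comment> \<open>The multiplier carrying the difference e to d. It is a cube because d and e
      lie in the same class.\<close>
    define h where "h = d \<otimes> inv e"
    have h: "h \<in> carrier R" "h \<otimes> e = d" using eU ec d by (auto simp: h_def m_assoc)
    have h0: "h \<noteq> \<zero>" using h d ec by auto
    have "\<tau> h \<otimes> \<tau> e = \<one> \<otimes> \<tau> e" using tau_mult[OF h(1) ec] h ij d by (simp add: e_def)
    then have h1: "\<tau> h = \<one>" using m_rcancel[OF \<open>\<tau> e \<noteq> \<zero>\<close> tau_closed[OF ec] tau_closed[OF h(1)] one_closed] by simp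
    \<comment> \<open>Swapping i and j reverses the sign of the difference, so only h with (i, j)
      and -h with (j, i) produce d. The half system S contains exactly one of h and -h.\<close>
    have sol: "s = h \<and> i' = i \<and> j' = j \<or> s = \<ominus> h \<and> i' = j \<and> j' = i"
      if t: "s \<in> S" "i' \<in> fano_line c" "j' \<in> fano_line c" "s \<otimes> (P i' \<ominus> P j') = d" for s i' j'
    proof -
      have s: "s \<in> carrier R" "\<tau> s = \<one>" using Sc[OF t(1)] by auto
      have "\<tau> (P i' \<ominus> P j') = \<tau> d" using tau_mult[OF s(1), of "P i' \<ominus> P j'"] s t c by simp
      moreover have "i' \<noteq> j'" using t(4) d s c by (auto simp: minus_eq r_neg)
      ultimately have "i' = i \<and> j' = j \<or> i' = j \<and> j' = i"
        using rainbow_fano_pairs[OF P ij(1,2) nij t(2,3)] ij(3) by simp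
      then show ?thesis
      proof
        assume a: "i' = i \<and> j' = j"
        then have "s \<otimes> e = h \<otimes> e" using t h by (simp add: e_def)
        then have "s = h" using m_rcancel[OF e0 ec s(1) h(1)] by simp
        then show ?thesis using a by simp
      next
        assume a: "i' = j \<and> j' = i"
        have "P j \<ominus> P i = \<ominus> e" using c by (simp add: e_def minus_eq minus_add a_comm)
        then have "s \<otimes> \<ominus> e = h \<otimes> e" using t h a by simp
        then have "\<ominus> s \<otimes> e = h \<otimes> e" using s ec by (simp add: l_minus r_minus)
        then have "\<ominus> s = h" using m_rcancel[OF e0 ec a_inv_closed[OF s(1)] h(1)] by simp
        then show ?thesis using a s by auto
      qed
    qed
    show "\<exists>!t. t \<in> difference_reps (add_monoid R) (Q ` S) c d"
    proof (cases "h \<in> S")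
      case True
      show ?thesis
      proof (rule ex1I[of _ "(Q h, i, j)"])
        show "(Q h, i, j) \<in> difference_reps (add_monoid R) (Q ` S) c d"
          using True ij diff[OF True d(1)] h by (simp add: difference_reps_def e_def)
      next
        fix t assume "t \<in> difference_reps (add_monoid R) (Q ` S) c d"
        then obtain s i' j' where t: "t = (Q s, i', j')" "s \<in> S" "i' \<in> fano_line c" "j' \<in> fano_line c" "Q s i' = d \<oplus> Q s j'"
          by (auto simp: difference_reps_def)
        moreover have "\<ominus> h \<notin> S" using True S(2)[OF h(1) h0 h1] by simp
        ultimately show "t = (Q h, i, j)" using sol[of s i' j'] diff[OF t(2) d(1)] by auto
      qed
    next
      case False
      then have mS: "\<ominus> h \<in> S" using S(2)[OF h(1) h0 h1] by simp
      have "P j \<ominus> P i = \<ominus> e" using c by (simp add: e_def minus_eq minus_add a_comm)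
      then have mh: "\<ominus> h \<otimes> (P j \<ominus> P i) = d" using h ec d by (simp add: l_minus r_minus)
      show ?thesis
      proof (rule ex1I[of _ "(Q (\<ominus> h), j, i)"])
        show "(Q (\<ominus> h), j, i) \<in> difference_reps (add_monoid R) (Q ` S) c d"
          using mS ij diff[OF mS d(1)] mh by (simp add: difference_reps_def)
      next
        fix t assume "t \<in> difference_reps (add_monoid R) (Q ` S) c d"
        then obtain s i' j' where t: "t = (Q s, i', j')" "s \<in> S" "i' \<in> fano_line c" "j' \<in> fano_line c" "Q s i' = d \<oplus> Q s j'"
          by (auto simp: difference_reps_def)
        then show "t = (Q (\<ominus> h), j, i)" using sol[of s i' j'] diff[OF t(2) d(1)] False by auto
      qed
    qed
  qed
  then show ?thesis by blast
qed

section \<open>The complex cubic character and large fields\<close>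

text \<open>Meant for a primitive cube root of unity w of the field, which is sent to a complex one;
  the last branch then serves the remaining class w^2.\<close>

definition cchar :: "'a \<Rightarrow> 'a \<Rightarrow> complex" where
  "cchar w x = (if x = \<zero> then 0 else if \<tau> x = \<one> then 1
     else if \<tau> x = w then Complex (-1/2) (sqrt 3 / 2) else Complex (-1/2) (- sqrt 3 / 2))"

lemma rainbow_fano_large:
  assumes q: "order R \<ge> 5476"
  shows "\<exists>P. rainbow_fano R P"
proof -
  obtain g where g: "g \<in> carrier R" "g \<noteq> \<zero>" "\<tau> g \<noteq> \<one>" "\<tau> g \<otimes> \<tau> g \<noteq> \<one>" "\<tau> g \<otimes> \<tau> g \<noteq> \<tau> g" "\<tau> g \<otimes> (\<tau> g \<otimes> \<tau> g) = \<one>"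
    and val: "\<And>x. x \<in> carrier R \<Longrightarrow> x \<noteq> \<zero> \<Longrightarrow> \<tau> x = \<one> \<or> \<tau> x = \<tau> g \<or> \<tau> x = \<tau> g \<otimes> \<tau> g"
    by (rule generator, rule that, assumption+)
  define w where "w = \<tau> g"
  have w: "w \<in> carrier R" "w \<noteq> \<one>" "w \<otimes> w \<noteq> \<one>" "w \<otimes> w \<noteq> w" "w \<otimes> (w \<otimes> w) = \<one>" "w \<otimes> w \<otimes> w = \<one>" "w \<otimes> w \<otimes> (w \<otimes> w) = w"
    using g by (simp_all add: w_def m_assoc)
  define X where "X = cchar w"
  define \<zeta> where "\<zeta> = Complex (-1/2) (sqrt 3 / 2)"
  define \<zeta>' where "\<zeta>' = Complex (-1/2) (- sqrt 3 / 2)"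
  have z: "\<zeta> \<noteq> 1" "\<zeta>' \<noteq> 1" "\<zeta> \<noteq> \<zeta>'" "\<zeta> * \<zeta> = \<zeta>'" "\<zeta>' * \<zeta>' = \<zeta>" "\<zeta> * \<zeta>' = 1" "\<zeta>' * \<zeta> = 1" "\<zeta> \<noteq> 0" "\<zeta>' \<noteq> 0" "\<zeta> ^ 3 = 1" "\<zeta>' ^ 3 = 1" "cnj \<zeta> = \<zeta>'" "cnj \<zeta>' = \<zeta>"
    by (simp_all add: \<zeta>_def \<zeta>'_def complex_eq_iff power3_eq_cube)
  have X0: "X \<zero> = 0" by (simp add: X_def cchar_def)
  have Xv: "\<tau> x = \<one> \<and> X x = 1 \<or> \<tau> x = w \<and> X x = \<zeta> \<or> \<tau> x = w \<otimes> w \<and> X x = \<zeta>'" if "x \<in> carrier R" "x \<noteq> \<zero>" for x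
    using val[OF that] that w by (auto simp: X_def cchar_def \<zeta>_def \<zeta>'_def w_def)
  have Xnz: "X x \<noteq> 0" if "x \<in> carrier R" "x \<noteq> \<zero>" for x using Xv[OF that] z by auto
  have Xmult: "X (x \<otimes> y) = X x * X y" if "x \<in> carrier R" "y \<in> carrier R" for x y
  proof (cases "x = \<zero> \<or> y = \<zero>")
    case True then show ?thesis using that X0 by auto
  next
    case False
    then have xy: "x \<otimes> y \<noteq> \<zero>" using that integral by blast
    have "x \<noteq> \<zero>" "y \<noteq> \<zero>" using False by auto
    then show ?thesis
      using Xv[OF that(1)] Xv[OF that(2)] Xv[OF m_closed[OF that] xy] tau_mult[OF that] w z
        tau_closed[OF that(1)] tau_closed[OF that(2)]
      by auto
  qed
  have Xcnj: "cnj (X x) = X (inv x)" if "x \<in> carrier R" "x \<noteq> \<zero>" for x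
  proof -
    have u: "x \<in> Units R" using that by (simp add: field_Units)
    have "X x * X (inv x) = X \<one>" using Xmult[of x "inv x"] u that by simp
    also have "\<dots> = 1" by (simp add: X_def cchar_def)
    also have "\<dots> = X x * cnj (X x)" using Xv[OF that] by (elim disjE conjE) (simp_all add: z)
    finally show ?thesis using Xnz[OF that] by simp
  qed
  have Xm: "X (\<ominus> x) = X x" if "x \<in> carrier R" for x
    using that tau_minus by (auto simp: X_def cchar_def)
  have Xeq: "X x = X y \<longleftrightarrow> \<tau> x = \<tau> y" if "x \<in> carrier R" "x \<noteq> \<zero>" "y \<in> carrier R" "y \<noteq> \<zero>" for x y
    using Xv[OF that(1,2)] Xv[OF that(3,4)] z(1-3) z(1-3)[symmetric] w w(2-4)[symmetric] by (elim disjE conjE) simp_all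
  \<comment> \<open>Multiplication by g permutes the field and multiplies the sum by \<zeta>
    \<noteq> 1.\<close>
  have sumX: "(\<Sum>x\<in>carrier R. X x) = 0"
  proof -
    have gU: "g \<in> Units R" using g by (simp add: field_Units)
    have b: "bij_betw (\<lambda>x. g \<otimes> x) (carrier R) (carrier R)"
      by (rule bij_betw_byWitness[where f' = "\<lambda>x. inv g \<otimes> x"]) (use g gU in \<open>auto simp: m_assoc[symmetric]\<close>)
    have Xg: "X g = \<zeta>" using Xv[OF g(1,2)] w by (auto simp: w_def)
    have "(\<Sum>x\<in>carrier R. X x) = (\<Sum>x\<in>carrier R. X (g \<otimes> x))"
      using sum.reindex_bij_betw[OF b, of X] by simp
    also have "\<dots> = \<zeta> * (\<Sum>x\<in>carrier R. X x)"
      using g Xmult Xg by (simp add: sum_distrib_left)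
    finally have "(\<zeta> - 1) * (\<Sum>x\<in>carrier R. X x) = 0" by (simp add: algebra_simps)
    then show ?thesis using z by simp
  qed
  have shift: "(\<Sum>x\<in>carrier R. f (x \<ominus> a)) = (\<Sum>x\<in>carrier R. f x)" if "a \<in> carrier R" for f :: "'a \<Rightarrow> complex" and a
  proof -
    have b: "bij_betw (\<lambda>x. x \<ominus> a) (carrier R) (carrier R)"
      by (rule bij_betw_byWitness[where f' = "\<lambda>x. x \<oplus> a"]) (use that in \<open>auto simp: minus_eq a_assoc l_neg r_neg\<close>)
    then show ?thesis by (rule sum.reindex_bij_betw)
  qed
  \<comment> \<open>With t = x - b \<noteq> 0 the summand is X ((t + e) / t) = X (1 + e / t), and 1
    + e / t runs through all elements except 1. As the full character sum is zero, -X 1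
    remains.\<close>
  have corr: "(\<Sum>x\<in>carrier R. X (x \<ominus> a) * cnj (X (x \<ominus> b))) = -1"
    if ab: "a \<in> carrier R" "b \<in> carrier R" "a \<noteq> b" for a b
  proof -
    define e where "e = b \<ominus> a"
    have e: "e \<in> carrier R" "e \<noteq> \<zero>" using ab by (auto simp: e_def)
    then have eU: "e \<in> Units R" by (simp add: field_Units)
    have xa: "x \<ominus> a = (x \<ominus> b) \<oplus> e" if "x \<in> carrier R" for x
    proof -
      have "(x \<ominus> b) \<oplus> (b \<ominus> a) = x \<oplus> (\<ominus> b \<oplus> b) \<oplus> \<ominus> a"
        using that ab by (simp add: minus_eq a_assoc)
      then show ?thesis using that ab by (simp add: e_def l_neg minus_eq)
    qed
    have "(\<Sum>x\<in>carrier R. X (x \<ominus> a) * cnj (X (x \<ominus> b))) = (\<Sum>x\<in>carrier R. X ((x \<ominus> b) \<oplus> e) * cnj (X (x \<ominus> b)))"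
      using xa by (intro sum.cong) auto
    also have "\<dots> = (\<Sum>t\<in>carrier R. X (t \<oplus> e) * cnj (X t))"
      using shift[OF ab(2), of "\<lambda>t. X (t \<oplus> e) * cnj (X t)"] .
    also have "\<dots> = (\<Sum>t\<in>carrier R - {\<zero>}. X (t \<oplus> e) * cnj (X t))"
      using finite_carrier X0 by (intro sum.mono_neutral_right) auto
    also have "\<dots> = (\<Sum>t\<in>carrier R - {\<zero>}. X (\<one> \<oplus> e \<otimes> inv t))"
    proof (intro sum.cong refl)
      fix t assume t: "t \<in> carrier R - {\<zero>}"
      then have tU: "t \<in> Units R" by (simp add: field_Units)
      have "X (t \<oplus> e) * cnj (X t) = X ((t \<oplus> e) \<otimes> inv t)"
        using Xcnj Xmult t tU e by auto
      also have "(t \<oplus> e) \<otimes> inv t = \<one> \<oplus> e \<otimes> inv t" using t tU e by (simp add: l_distr)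
      finally show "X (t \<oplus> e) * cnj (X t) = X (\<one> \<oplus> e \<otimes> inv t)" .
    qed
    also have "\<dots> = (\<Sum>x\<in>carrier R - {\<one>}. X x)"
    proof (rule sum.reindex_bij_witness[where i = "\<lambda>s. e \<otimes> inv (s \<ominus> \<one>)" and j = "\<lambda>t. \<one> \<oplus> e \<otimes> inv t"])
      fix t assume t: "t \<in> carrier R - {\<zero>}"
      then have tU: "t \<in> Units R" by (simp add: field_Units)
      have it: "inv t \<in> Units R" using tU by simp
      have *: "(\<one> \<oplus> e \<otimes> inv t) \<ominus> \<one> = e \<otimes> inv t"
        using e tU by (simp add: add_diff_cancel_left')
      show "e \<otimes> inv ((\<one> \<oplus> e \<otimes> inv t) \<ominus> \<one>) = t"
        unfolding * using eU tU by (rule mult_inv_div_cancel)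
      have "e \<otimes> inv t \<in> Units R" using eU it by simp
      then have "e \<otimes> inv t \<noteq> \<zero>" by (simp add: field_Units)
      then show "\<one> \<oplus> e \<otimes> inv t \<in> carrier R - {\<one>}" using e tU by auto
    next
      fix s assume s: "s \<in> carrier R - {\<one>}"
      then have sU: "s \<ominus> \<one> \<in> Units R" by (simp add: field_Units)
      have si: "inv (s \<ominus> \<one>) \<in> Units R" using sU by simp
      have "e \<otimes> inv (e \<otimes> inv (s \<ominus> \<one>)) = s \<ominus> \<one>" using eU sU by (rule mult_inv_div_cancel)
      then show "\<one> \<oplus> e \<otimes> inv (e \<otimes> inv (s \<ominus> \<one>)) = s" using s by (simp add: add_diff_cancel')
      have "e \<otimes> inv (s \<ominus> \<one>) \<in> Units R" using eU si by simp
      then show "e \<otimes> inv (s \<ominus> \<one>) \<in> carrier R - {\<zero>}" by (simp add: field_Units)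
    qed simp
    also have "\<dots> = - X \<one>"
      using sumX sum_diff1[OF finite_carrier, of X \<one>] by simp
    also have "\<dots> = -1" by (simp add: X_def cchar_def)
    finally show ?thesis .
  qed
  interpret C: cubic_colouring "carrier R" "\<lambda>x y. X (x \<ominus> y)"
  proof
    show "finite (carrier R)" by (rule finite_carrier)
    show "X (x \<ominus> x) = 0" if "x \<in> carrier R" for x using that X0 by (simp add: minus_eq r_neg)
    show "X (x \<ominus> y) ^ 3 = 1" if "x \<in> carrier R" "y \<in> carrier R" "x \<noteq> y" for x y
      using Xv[of "x \<ominus> y"] that z by auto
    show "X (x \<ominus> y) = X (y \<ominus> x)" if "x \<in> carrier R" "y \<in> carrier R" for x y
      using Xm[of "y \<ominus> x"] that by (simp add: minus_eq minus_add a_comm)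
    show "(\<Sum>x\<in>carrier R. X (x \<ominus> a)) = 0" if "a \<in> carrier R" for a
      using shift[OF that] sumX by simp
    show "(\<Sum>x\<in>carrier R. X (x \<ominus> a) * cnj (X (x \<ominus> b))) = -1" if "a \<in> carrier R" "b \<in> carrier R" "a \<noteq> b" for a b
      using corr[OF that] .
    \<comment> \<open>The affine map of slope (y' - x') / (y - x); u is the character value of the
      slope.\<close>
    show "\<exists>\<phi> u. bij_betw \<phi> (carrier R) (carrier R) \<and> \<phi> x = x' \<and> \<phi> y = y' \<and> u \<noteq> 0 \<and>
        (\<forall>a\<in>carrier R. \<forall>b\<in>carrier R. X (\<phi> a \<ominus> \<phi> b) = u * X (a \<ominus> b))"
      if xy: "x \<in> carrier R" "y \<in> carrier R" "x \<noteq> y" "x' \<in> carrier R" "y' \<in> carrier R" "x' \<noteq> y'" for x y x' y'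
    proof -
      have u: "y \<ominus> x \<in> Units R" "y' \<ominus> x' \<in> Units R" using xy by (auto simp: field_Units)
      define \<alpha> where "\<alpha> = (y' \<ominus> x') \<otimes> inv (y \<ominus> x)"
      have \<alpha>1: "\<alpha> \<in> Units R" using u by (simp add: \<alpha>_def)
      then have \<alpha>: "\<alpha> \<in> Units R" "\<alpha> \<in> carrier R" "\<alpha> \<noteq> \<zero>" by (auto simp: field_Units)
      have inv\<alpha>: "inv \<alpha> \<in> carrier R" using \<alpha>(1) by simp
      define \<phi> where "\<phi> z = x' \<oplus> \<alpha> \<otimes> (z \<ominus> x)" for z
      have "bij_betw \<phi> (carrier R) (carrier R)"
      proof (rule bij_betw_byWitness[where f' = "\<lambda>z. x \<oplus> inv \<alpha> \<otimes> (z \<ominus> x')"])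
        show "\<forall>z\<in>carrier R. x \<oplus> inv \<alpha> \<otimes> (\<phi> z \<ominus> x') = z"
        proof
          fix z assume zc: "z \<in> carrier R"
          have "\<phi> z \<ominus> x' = \<alpha> \<otimes> (z \<ominus> x)" using xy zc \<alpha> by (simp add: \<phi>_def add_diff_cancel_left')
          then have "inv \<alpha> \<otimes> (\<phi> z \<ominus> x') = z \<ominus> x" using xy zc \<alpha> inv\<alpha> by (simp add: m_assoc[symmetric])
          then show "x \<oplus> inv \<alpha> \<otimes> (\<phi> z \<ominus> x') = z" using xy zc by (simp add: add_diff_cancel')
        qed
        show "\<forall>z\<in>carrier R. \<phi> (x \<oplus> inv \<alpha> \<otimes> (z \<ominus> x')) = z"
        proof
          fix z assume zc: "z \<in> carrier R"
          have "(x \<oplus> inv \<alpha> \<otimes> (z \<ominus> x')) \<ominus> x = inv \<alpha> \<otimes> (z \<ominus> x')"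
            using xy zc inv\<alpha> by (simp add: add_diff_cancel_left')
          then have "\<alpha> \<otimes> ((x \<oplus> inv \<alpha> \<otimes> (z \<ominus> x')) \<ominus> x) = z \<ominus> x'" using xy zc \<alpha> inv\<alpha> by (simp add: m_assoc[symmetric])
          then show "\<phi> (x \<oplus> inv \<alpha> \<otimes> (z \<ominus> x')) = z" unfolding \<phi>_def using xy zc by (simp add: add_diff_cancel')
        qed
        show "\<phi> ` carrier R \<subseteq> carrier R" using xy \<alpha> by (auto simp: \<phi>_def)
        show "(\<lambda>z. x \<oplus> inv \<alpha> \<otimes> (z \<ominus> x')) ` carrier R \<subseteq> carrier R" using xy inv\<alpha> by auto
      qed
      moreover have "\<phi> x = x'" using xy \<alpha> by (simp add: \<phi>_def minus_eq r_neg)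
      moreover have "\<phi> y = y'"
      proof -
        have "\<alpha> \<otimes> (y \<ominus> x) = y' \<ominus> x'" unfolding \<alpha>_def using u xy by (simp add: m_assoc)
        then show ?thesis unfolding \<phi>_def using xy by (simp add: add_diff_cancel')
      qed
      moreover have "X (\<phi> a \<ominus> \<phi> b) = X \<alpha> * X (a \<ominus> b)" if "a \<in> carrier R" "b \<in> carrier R" for a b
      proof -
        have "\<phi> a \<ominus> \<phi> b = \<alpha> \<otimes> (a \<ominus> x) \<ominus> \<alpha> \<otimes> (b \<ominus> x)"
          using that xy \<alpha> by (simp add: \<phi>_def add_diff_add_cancel)
        also have "\<dots> = \<alpha> \<otimes> ((a \<ominus> x) \<ominus> (b \<ominus> x))" using that xy \<alpha> by (simp add: minus_eq r_distr r_minus)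
        also have "(a \<ominus> x) \<ominus> (b \<ominus> x) = a \<ominus> b" using that xy by (simp add: diff_diff_cancel)
        finally show ?thesis using Xmult \<alpha> that by simp
      qed
      ultimately show ?thesis using Xnz[OF \<alpha>(2,3)] by blast
    qed
  qed
  have r: "rainbow_triple R x y z" if "C.rainbow x y z" "x \<in> carrier R" "y \<in> carrier R" "z \<in> carrier R" for x y z
    using that Xeq unfolding C.rainbow_def rainbow_triple_def by auto
  obtain u v w' a b a' b' where *: "{u, v, w', a, b, a', b'} \<subseteq> carrier R"
    "C.rainbow u v w'" "C.rainbow u a b" "C.rainbow u a' b'" "C.rainbow v a b'" "C.rainbow v a' b"
    "C.rainbow w' a a'" "C.rainbow w' b b'"
    by (rule C.rainbow_fano_exists[OF q[unfolded order_def]], rule that, assumption+)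
  have mem: "u \<in> carrier R" "v \<in> carrier R" "w' \<in> carrier R" "a \<in> carrier R" "b \<in> carrier R" "a' \<in> carrier R" "b' \<in> carrier R"
    using *(1) by simp_all
  have rot: "rainbow_triple R y z x" and swap: "rainbow_triple R x z y"
    if "rainbow_triple R x y z" "x \<in> carrier R" "y \<in> carrier R" "z \<in> carrier R" for x y z
    using that tau_diff_commute[of x y] tau_diff_commute[of x z] tau_diff_commute[of y z]
    unfolding rainbow_triple_def by auto
  \<comment> \<open>Placing the labels 0, ..., 6 at u, v, b', w', a, b, a' turns the cyclic lines
    {c, c + 1, c + 3} into the lines of the quadrangle, up to the order of their points.\<close>
  have lines: "rainbow_triple R u v w'" "rainbow_triple R v b' a" "rainbow_triple R b' w' b"
    "rainbow_triple R w' a a'" "rainbow_triple R a b u" "rainbow_triple R b a' v" "rainbow_triple R a' u b'"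
  proof -
    show "rainbow_triple R u v w'" "rainbow_triple R w' a a'" using r * mem by auto
    show "rainbow_triple R v b' a" using swap[OF r[OF *(5)]] mem by simp
    show "rainbow_triple R b' w' b" using rot[OF rot[OF r[OF *(8)]]] mem by simp
    show "rainbow_triple R a b u" using rot[OF r[OF *(3)]] mem by simp
    show "rainbow_triple R b a' v" using rot[OF swap[OF r[OF *(6)]]] mem by simp
    show "rainbow_triple R a' u b'" using swap[OF rot[OF r[OF *(4)]]] mem by simp
  qed
  have "rainbow_fano R (seven_points u v b' w' a b a')"
    by (rule rainbow_fano_seven_points) (use *(1) lines in auto)
  then show ?thesis by (rule exI[of _ "seven_points u v b' w' a b a'"])
qed

end

section \<open>Quadratic and cubic extensions of prime fields\<close>

text \<open>
  A commutative ring modulo the congruence whose normal forms are computed by \<open>r\<close>.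
\<close>

definition reduction_ring :: "('a::ab_group_add \<Rightarrow> 'a) \<Rightarrow> ('a \<Rightarrow> 'a \<Rightarrow> 'a) \<Rightarrow> 'a \<Rightarrow> 'a ring" where
  "reduction_ring r m e = \<lparr>carrier = range r, monoid.mult = (\<lambda>x y. r (m x y)), one = r e,
     zero = r 0, add = (\<lambda>x y. r (x + y))\<rparr>"

text \<open>The laws hold for addition and \<open>m\<close> on the ambient type;
  \<open>r_add\<close> and \<open>r_mult\<close> remove inner reductions, so the laws pass to normal
  forms.\<close>

lemma reduction_ring_cring:
  fixes r :: "'a::ab_group_add \<Rightarrow> 'a"
  assumes comm: "\<And>x y. m x y = m y x"
    and assoc: "\<And>x y z. m (m x y) z = m x (m y z)"
    and distr: "\<And>x y z. m (x + y) z = m x z + m y z"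
    and unit: "\<And>x. m e x = x"
    and r_add: "\<And>x y. r (r x + y) = r (x + y)"
    and r_mult: "\<And>x y. r (m (r x) y) = r (m x y)"
  shows "cring (reduction_ring r m e)"
proof -
  let ?R = "reduction_ring r m e"
  have idem: "r (r x) = r x" for x using r_add[of x 0] by simp
  have r_add': "r (x + r y) = r (x + y)" for x y using r_add[of y x] by (simp add: add.commute)
  have r_mult': "r (m x (r y)) = r (m x y)" for x y using r_mult[of y x] comm by simp
  note [simp] = idem r_add r_add' r_mult r_mult'
  have simps: "carrier ?R = range r" "\<And>x y. x \<otimes>\<^bsub>?R\<^esub> y = r (m x y)" "\<And>x y. x \<oplus>\<^bsub>?R\<^esub> y = r (x + y)"
    "\<one>\<^bsub>?R\<^esub> = r e" "\<zero>\<^bsub>?R\<^esub> = r 0"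
    by (simp_all add: reduction_ring_def)
  show ?thesis
  proof (rule cringI)
    show "abelian_group ?R"
    proof (rule abelian_groupI)
      fix x assume "x \<in> carrier ?R"
      then show "\<exists>y\<in>carrier ?R. y \<oplus>\<^bsub>?R\<^esub> x = \<zero>\<^bsub>?R\<^esub>"
        by (intro bexI[of _ "r (- x)"]) (auto simp: simps)
    qed (auto simp: simps add.assoc, auto simp: add.commute)
    show "Group.comm_monoid ?R"
    proof (rule Group.comm_monoidI)
      show "x \<otimes>\<^bsub>?R\<^esub> y \<otimes>\<^bsub>?R\<^esub> z = x \<otimes>\<^bsub>?R\<^esub> (y \<otimes>\<^bsub>?R\<^esub> z)" for x y z
        by (simp add: simps assoc)
      show "x \<otimes>\<^bsub>?R\<^esub> y = y \<otimes>\<^bsub>?R\<^esub> x" for x y using comm[of x y] by (simp add: simps)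
    qed (auto simp: simps unit)
  qed (auto simp: simps distr)
qed

lemma reduction_ring_field:
  fixes r :: "'a::ab_group_add \<Rightarrow> 'a"
  assumes cr: "cring (reduction_ring r m e)" and "r 0 \<noteq> r e"
    and inv: "\<And>x. r x = x \<Longrightarrow> x \<noteq> r 0 \<Longrightarrow> \<exists>y. r (m x (r y)) = r e"
    and idem: "\<And>x. r (r x) = r x"
  shows "field (reduction_ring r m e)"
proof -
  interpret cring "reduction_ring r m e" by fact
  show ?thesis
    by (rule cring_fieldI2) (use assms(2) inv idem in \<open>auto simp: reduction_ring_def\<close>)
qed

lemma mod_linear2: "((a mod p) * c + (b mod p) * d) mod p = (a * c + b * d) mod (p :: int)"
  by (rule mod_add_cong) (simp_all add: mod_simps)

lemma mod_linear3: "((a mod p) * d + (b mod p) * e + (c mod p) * f) mod p = (a * d + b * e + c * f) mod (p :: int)"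
  by (rule mod_add_cong) (simp_all add: mod_linear2 mod_simps)

lemma prime_inverse_mod:
  fixes N :: int
  assumes "prime p" "\<not> p dvd N"
  shows "\<exists>n. (N * n) mod p = 1"
proof -
  have "coprime p N" using assms by (rule prime_imp_coprime)
  then obtain n where "[N * n = 1] (mod p)" using cong_solve_coprime_int coprime_commute by blast
  then show ?thesis using assms(1) prime_gt_1_int[of p] by (auto simp: cong_def)
qed

section \<open>Adjoining a square root\<close>

fun quad_red :: "int \<Rightarrow> int \<times> int \<Rightarrow> int \<times> int" where
  "quad_red p (a, b) = (a mod p, b mod p)"

text \<open>\<open>(a, b)\<close> stands for \<open>a + b t\<close> with \<open>t\<^sup>2 = w\<close>, and below \<open>(a, b, c)\<close> for \<open>a + b t + c t\<^sup>2\<close> with \<open>t\<^sup>3 = w\<close>.\<close>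

fun quad_mult :: "int \<Rightarrow> int \<times> int \<Rightarrow> int \<times> int \<Rightarrow> int \<times> int" where
  "quad_mult w (a, b) (c, d) = (a * c + b * (w * d), a * d + b * c)"

abbreviation quadratic_ring :: "int \<Rightarrow> int \<Rightarrow> (int \<times> int) ring" where
  "quadratic_ring p w \<equiv> reduction_ring (quad_red p) (quad_mult w) (1, 0)"

lemma quad_red_0: "quad_red p 0 = (0, 0)"
  by (simp add: zero_prod_def)

lemma quad_red_idem: "quad_red p (quad_red p x) = quad_red p x"
  by (cases x) simp

lemma quad_mult_commute: "quad_mult w x y = quad_mult w y x"
  by (cases x; cases y) (simp add: algebra_simps)

lemma quad_red_mult: "quad_red p (quad_mult w (quad_red p x) y) = quad_red p (quad_mult w x y)"
  by (cases x; cases y) (simp add: mod_linear2)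

lemma quad_red_add: "quad_red p (quad_red p x + y) = quad_red p (x + y)"
  by (cases x; cases y) (simp add: mod_simps)

lemma quadratic_ring_cring: "cring (quadratic_ring p w)"
proof (rule reduction_ring_cring)
  show "quad_mult w (quad_mult w x y) z = quad_mult w x (quad_mult w y z)" for x y z
    by (cases x; cases y; cases z) (simp add: algebra_simps)
  show "quad_mult w (x + y) z = quad_mult w x z + quad_mult w y z" for x y z
    by (cases x; cases y; cases z) (simp add: algebra_simps)
  show "quad_mult w (1, 0) x = x" for x
    by (cases x) simp
qed (rule quad_mult_commute quad_red_mult quad_red_add)+

lemma quadratic_ring_carrier: "p > 0 \<Longrightarrow> carrier (quadratic_ring p w) = {0..<p} \<times> {0..<p}"
proof (intro equalityI subsetI)
  fix x assume "p > 0" "x \<in> carrier (quadratic_ring p w)"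
  then obtain a b where "x = quad_red p (a, b)" by (auto simp: reduction_ring_def)
  then show "x \<in> {0..<p} \<times> {0..<p}" using \<open>p > 0\<close> by simp
next
  fix x assume "x \<in> {0..<p} \<times> {0..<p}"
  then have "x = quad_red p x" by (cases x) simp
  then show "x \<in> carrier (quadratic_ring p w)" by (simp add: reduction_ring_def)
qed

text \<open>The inverse of a + b t is its conjugate divided by the norm a^2 - w b^2, which
  \<open>irr\<close> keeps invertible modulo p.\<close>

lemma quadratic_ring_field:
  assumes p: "prime p" and irr: "\<And>a b. p dvd a * a - w * (b * b) \<Longrightarrow> p dvd a \<and> p dvd b"
  shows "field (quadratic_ring p w)"
proof (rule reduction_ring_field[OF quadratic_ring_cring])
  have p1: "p > 1" using p prime_gt_1_int by blast
  show "quad_red p 0 \<noteq> quad_red p (1, 0)" using p1 by (simp add: quad_red_0)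
  show "quad_red p (quad_red p x) = quad_red p x" for x by (rule quad_red_idem)
  fix x assume x: "quad_red p x = x" "x \<noteq> quad_red p 0"
  obtain a b where ab: "x = (a, b)" by (cases x)
  have "\<not> p dvd a * a - w * (b * b)"
  proof
    assume "p dvd a * a - w * (b * b)"
    then have "p dvd a \<and> p dvd b" by (rule irr)
    then have "a mod p = 0" "b mod p = 0" by (simp_all only: dvd_imp_mod_0)
    then show False using x ab by (simp add: quad_red_0)
  qed
  then obtain n where n: "((a * a - w * (b * b)) * n) mod p = 1" using prime_inverse_mod[OF p] by blast
  have "quad_red p (quad_mult w x (quad_red p (a * n, - b * n))) = quad_red p (quad_mult w (a * n, - b * n) x)"
    unfolding quad_mult_commute[of w x] by (rule quad_red_mult)
  also have "\<dots> = quad_red p ((a * a - w * (b * b)) * n, 0)"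
    by (simp add: ab algebra_simps)
  also have "\<dots> = quad_red p (1, 0)" using n p1 by simp
  finally show "\<exists>y. quad_red p (quad_mult w x (quad_red p y)) = quad_red p (1, 0)" by blast
qed

section \<open>Adjoining a cube root\<close>

fun cub_red :: "int \<Rightarrow> int \<times> int \<times> int \<Rightarrow> int \<times> int \<times> int" where
  "cub_red p (a, b, c) = (a mod p, b mod p, c mod p)"

fun cub_mult :: "int \<Rightarrow> int \<times> int \<times> int \<Rightarrow> int \<times> int \<times> int \<Rightarrow> int \<times> int \<times> int" where
  "cub_mult w (a, b, c) (d, e, f) =
     (a * d + b * (w * f) + c * (w * e), a * e + b * d + c * (w * f), a * f + b * e + c * d)"

abbreviation cubic_ring :: "int \<Rightarrow> int \<Rightarrow> (int \<times> int \<times> int) ring" where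
  "cubic_ring p w \<equiv> reduction_ring (cub_red p) (cub_mult w) (1, 0, 0)"

lemma cub_red_0: "cub_red p 0 = (0, 0, 0)"
  by (simp add: zero_prod_def)

lemma cub_red_idem: "cub_red p (cub_red p x) = cub_red p x"
  by (cases x) simp

lemma cub_mult_commute: "cub_mult w x y = cub_mult w y x"
  by (cases x; cases y) (simp add: algebra_simps)

lemma cub_red_mult: "cub_red p (cub_mult w (cub_red p x) y) = cub_red p (cub_mult w x y)"
  by (cases x; cases y) (simp add: mod_linear3)

lemma cub_red_add: "cub_red p (cub_red p x + y) = cub_red p (x + y)"
  by (cases x; cases y) (simp add: mod_simps)

lemma cubic_ring_cring: "cring (cubic_ring p w)"
proof (rule reduction_ring_cring)
  show "cub_mult w (cub_mult w x y) z = cub_mult w x (cub_mult w y z)" for x y z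
    by (cases x; cases y; cases z) (simp add: algebra_simps)
  show "cub_mult w (x + y) z = cub_mult w x z + cub_mult w y z" for x y z
    by (cases x; cases y; cases z) (simp add: algebra_simps)
  show "cub_mult w (1, 0, 0) x = x" for x
    by (cases x) simp
qed (rule cub_mult_commute cub_red_mult cub_red_add)+

lemma cubic_ring_carrier: "p > 0 \<Longrightarrow> carrier (cubic_ring p w) = {0..<p} \<times> {0..<p} \<times> {0..<p}"
proof (intro equalityI subsetI)
  fix x assume "p > 0" "x \<in> carrier (cubic_ring p w)"
  then obtain a b c where "x = cub_red p (a, b, c)" by (auto simp: reduction_ring_def)
  then show "x \<in> {0..<p} \<times> {0..<p} \<times> {0..<p}" using \<open>p > 0\<close> by simp
next
  fix x assume "x \<in> {0..<p} \<times> {0..<p} \<times> {0..<p}"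
  then have "x = cub_red p x" by (cases x) simp
  then show "x \<in> carrier (cubic_ring p w)" by (simp add: reduction_ring_def)
qed

text \<open>The determinant of multiplication by a + b t + c t^2, where t^3 = w.\<close>

definition cub_norm :: "int \<Rightarrow> int \<times> int \<times> int \<Rightarrow> int" where
  "cub_norm w x = (case x of (a, b, c) \<Rightarrow> a * (a * a) + w * (b * (b * b)) + w * (w * (c * (c * c))) - 3 * (w * (a * (b * c))))"

lemma cubic_ring_field:
  assumes p: "prime p"
    and irr: "\<And>x. x \<in> {0..<p} \<times> {0..<p} \<times> {0..<p} \<Longrightarrow> p dvd cub_norm w x \<Longrightarrow> x = (0, 0, 0)"
  shows "field (cubic_ring p w)"
proof (rule reduction_ring_field[OF cubic_ring_cring])
  have p1: "p > 1" using p prime_gt_1_int by blast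
  show "cub_red p 0 \<noteq> cub_red p (1, 0, 0)" using p1 by (simp add: cub_red_0)
  show "cub_red p (cub_red p x) = cub_red p x" for x by (rule cub_red_idem)
  fix x assume x: "cub_red p x = x" "x \<noteq> cub_red p 0"
  obtain a b c where abc: "x = (a, b, c)" by (cases x)
  have "x \<in> {0..<p} \<times> {0..<p} \<times> {0..<p}"
  proof -
    have "a mod p = a" "b mod p = b" "c mod p = c" using x(1) unfolding abc by simp_all
    then show ?thesis
      unfolding abc using p1 pos_mod_sign[of p a] pos_mod_bound[of p a] pos_mod_sign[of p b] pos_mod_bound[of p b]
        pos_mod_sign[of p c] pos_mod_bound[of p c] by simp
  qed
  then have "\<not> p dvd cub_norm w x" using irr[of x] x(2) by (metis cub_red_0)
  then obtain n where n: "(cub_norm w x * n) mod p = 1" using prime_inverse_mod[OF p] by blast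
  \<comment> \<open>The first column of the adjugate of the multiplication matrix, scaled by the
    inverse n of the norm.\<close>
  let ?y = "((a * a - w * (b * c)) * n, (w * (c * c) - a * b) * n, (b * b - a * c) * n)"
  have "cub_red p (cub_mult w x (cub_red p ?y)) = cub_red p (cub_mult w ?y x)"
    unfolding cub_mult_commute[of w x] by (rule cub_red_mult)
  also have "\<dots> = cub_red p (cub_norm w x * n, 0, 0)"
    by (simp add: abc cub_norm_def algebra_simps)
  also have "\<dots> = cub_red p (1, 0, 0)" using n p1 by simp
  finally show "\<exists>y. cub_red p (cub_mult w x (cub_red p y)) = cub_red p (1, 0, 0)" by blast
qed

lemma reduction_ring_diff:
  fixes r :: "'a::ab_group_add \<Rightarrow> 'a"
  assumes "cring (reduction_ring r m e)" and r_add: "\<And>x y. r (r x + y) = r (x + y)"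
    and xy: "x \<in> carrier (reduction_ring r m e)" "y \<in> carrier (reduction_ring r m e)"
  shows "x \<ominus>\<^bsub>reduction_ring r m e\<^esub> y = r (x - y)"
proof -
  interpret cring "reduction_ring r m e" by fact
  have "r (r x) = r x" for x using r_add[of x 0] by simp
  then have x: "r x = x" using xy by (auto simp: reduction_ring_def)
  have d: "r (x - y) \<in> carrier (reduction_ring r m e)" by (simp add: reduction_ring_def)
  have "r (x - y) \<oplus>\<^bsub>reduction_ring r m e\<^esub> y = x"
    using r_add[of "x - y" y] x by (simp add: reduction_ring_def)
  then show ?thesis
    using add.inv_solve_right[OF d xy] by (simp add: minus_eq)
qed

section \<open>Irreducibility of the defining polynomials\<close>

text \<open>For p = 6 j + 5 one has 3 (4 j + 3) = 2 (p - 1) + 1, so by Fermat's theorem the power 4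
  j + 3 inverts cubing.\<close>

lemma cube_inj_mod_prime:
  fixes p :: nat and x y :: int
  assumes p: "prime p" "p mod 6 = 5" and eq: "[x ^ 3 = y ^ 3] (mod p)"
  shows "[x = y] (mod p)"
proof -
  obtain j where j: "p = 6 * j + 5" using p(2) by (metis mult.commute div_mult_mod_eq)
  have pow: "[z ^ (3 * (4 * j + 3)) = z] (mod p)" for z :: int
  proof (cases "int p dvd z")
    case True
    then have "int p dvd z ^ (3 * (4 * j + 3))" by (simp add: dvd_power_same dvd_trans[OF _ dvd_power])
    then show ?thesis using True by (simp add: cong_iff_dvd_diff)
  next
    case False
    have pi: "prime (int p)" using p(1) by simp
    have "coprime (int p) z" using prime_imp_coprime[OF pi False] .
    then have cz: "coprime z (int p)" by (simp add: coprime_commute)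
    have "residues (int p)" using prime_gt_1_nat[OF p(1)] by (simp add: residues_def)
    then have "[z ^ (p - 1) = 1] (mod p)"
      using residues.euler_theorem[OF _ cz] totient_prime[OF p(1)] by simp
    then have "[(z ^ (p - 1)) ^ 2 * z = 1 ^ 2 * z] (mod p)" by (intro cong_mult cong_pow cong_refl)
    moreover have "(z ^ (p - 1)) ^ 2 * z = z ^ (3 * (4 * j + 3))"
      unfolding j by (simp add: power_mult[symmetric] power_Suc2[symmetric] del: power_Suc) (simp add: algebra_simps)
    ultimately show ?thesis by simp
  qed
  have "[(x ^ 3) ^ (4 * j + 3) = (y ^ 3) ^ (4 * j + 3)] (mod p)" using eq by (rule cong_pow)
  then have "[x ^ (3 * (4 * j + 3)) = y ^ (3 * (4 * j + 3))] (mod p)" by (simp only: power_mult)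
  then show ?thesis using pow cong_sym cong_trans by meson
qed

text \<open>If \<open>a\<^sup>2 = -3 b\<^sup>2\<close> then \<open>(a - b)\<^sup>3 = (2 b)\<^sup>3\<close>, and cubing is injective modulo \<open>p\<close>.\<close>

lemma minus_three_not_square:
  fixes p :: nat and a b :: int
  assumes p: "prime p" "p mod 6 = 5" and d: "int p dvd a * a - (-3) * (b * b)"
  shows "int p dvd a \<and> int p dvd b"
proof -
  have pi: "prime (int p)" using p(1) by simp
  have "(a - b) ^ 3 - (2 * b) ^ 3 = (a * a - (-3) * (b * b)) * (a - 3 * b)"
    by (simp add: power3_eq_cube algebra_simps)
  then have "[(a - b) ^ 3 = (2 * b) ^ 3] (mod p)" using d by (simp add: cong_iff_dvd_diff)
  then have "[a - b = 2 * b] (mod p)" by (rule cube_inj_mod_prime[OF p])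
  then have 1: "int p dvd a - 3 * b" by (simp add: cong_iff_dvd_diff algebra_simps)
  then have "int p dvd (a - 3 * b) * (a + 3 * b)" by simp
  \<comment> \<open>Subtracting a^2 - 9 b^2 from a^2 + 3 b^2 leaves 12 b^2.\<close>
  then have "int p dvd (a * a - (-3) * (b * b)) - (a - 3 * b) * (a + 3 * b)" using d by (rule dvd_diff[rotated])
  then have "int p dvd 12 * (b * b)" by (simp add: algebra_simps)
  moreover have "\<not> int p dvd 12"
  proof
    assume "int p dvd 12"
    then have "int p dvd int 12" by simp
    then have "p dvd 12" by (simp only: int_dvd_int_iff)
    then have "p \<le> 12" by (rule dvd_imp_le) simp
    then have "p = 5 \<or> p = 11" using p(2) by presburger
    then show False using \<open>p dvd 12\<close> by auto
  qed
  ultimately have b: "int p dvd b" using pi by (metis prime_dvd_mult_iff)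
  then have "int p dvd (a - 3 * b) + 3 * b" using 1 by (intro dvd_add) auto
  then show ?thesis using b by simp
qed

text \<open>Modulo 13 the choice -3 fails, being 6^2; the non-square 2 replaces it, as an
  enumeration of all 169 pairs of residues confirms.\<close>

lemma two_not_square_mod_13:
  fixes a b :: int
  assumes d: "13 dvd a * a - 2 * (b * b)"
  shows "13 dvd a \<and> 13 dvd b"
proof -
  have "(a mod 13 * (a mod 13) - 2 * (b mod 13 * (b mod 13))) mod 13 = (a * a - 2 * (b * b)) mod 13"
    by (intro mod_diff_cong mod_mult_cong) simp_all
  then have m: "(a mod 13 * (a mod 13) - 2 * (b mod 13 * (b mod 13))) mod 13 = 0" using d by simp
  have all: "\<forall>x\<in>set [0..12]. \<forall>y\<in>set [0..12]. (x * x - 2 * (y * y)) mod 13 = (0 :: int) \<longrightarrow> x = 0 \<and> y = 0"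
    by code_simp
  have "a mod 13 \<in> set [0..12]" "b mod 13 \<in> set [0..12]" by simp_all
  then have "a mod 13 = 0 \<and> b mod 13 = 0" using m by (rule all[THEN bspec, THEN bspec, THEN mp])
  then show ?thesis by (simp add: mod_0_imp_dvd)
qed

text \<open>2 is not a cube modulo 13 either, so t^3 - 2 is irreducible and its norm form has only
  the trivial zero. This is verified on all 13^3 triples.\<close>

lemma cub_norm_13:
  assumes x: "x \<in> {0..<13} \<times> {0..<13} \<times> {0..<13}" and d: "13 dvd cub_norm 2 x"
  shows "x = (0, 0, 0)"
proof -
  have *: "\<forall>a\<in>set [0..12]. \<forall>b\<in>set [0..12]. \<forall>c\<in>set [0..12]. cub_norm 2 (a, b, c) mod 13 = 0 \<longrightarrow> a = 0 \<and> b = 0 \<and> c = 0"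
    by code_simp
  obtain a b c where abc: "x = (a, b, c)" by (cases x)
  have "a \<in> set [0..12]" "b \<in> set [0..12]" "c \<in> set [0..12]" using x unfolding abc by simp_all
  moreover have "cub_norm 2 (a, b, c) mod 13 = 0" using d unfolding abc by simp
  ultimately have "a = 0 \<and> b = 0 \<and> c = 0" by (rule *[THEN bspec, THEN bspec, THEN bspec, THEN mp])
  then show ?thesis unfolding abc by simp
qed

section \<open>Certificates for small fields\<close>

text \<open>Square-and-multiply along the binary digits, so an evaluation needs only logarithmically
  many multiplications. The multiplication is a parameter because prime fields and extensions share
  the function.\<close>

fun mpow :: "('a \<Rightarrow> 'a \<Rightarrow> 'a) \<Rightarrow> 'a \<Rightarrow> num \<Rightarrow> 'a" where
  "mpow f x num.One = x"
| "mpow f x (num.Bit0 n) = (let y = mpow f x n in f y y)"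
| "mpow f x (num.Bit1 n) = (let y = mpow f x n in f (f y y) x)"

lemma (in monoid) mpow_eq_nat_pow:
  assumes "x \<in> carrier G" "\<And>a b. a \<in> carrier G \<Longrightarrow> b \<in> carrier G \<Longrightarrow> f a b = a \<otimes> b"
  shows "mpow f x n = x [^] (numeral n :: nat)"
proof (induction n)
  case One then show ?case using assms by simp
next
  case (Bit0 n)
  have "numeral (num.Bit0 n) = (numeral n + numeral n :: nat)" by (rule numeral_Bit0)
  then show ?case using assms Bit0 by (simp only: mpow.simps Let_def nat_pow_closed nat_pow_mult)
next
  case (Bit1 n)
  have "numeral (num.Bit1 n) = Suc (numeral n + numeral n :: nat)" by (simp add: numeral_Bit1)
  then show ?case using assms Bit1 by (simp only: mpow.simps Let_def nat_pow_closed nat_pow_mult nat_pow_Suc)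
qed

text \<open>Exponents are computed as integers during a check; a positive integer in binary already
  contains its \<open>num\<close>, which the code equation below merely unwraps.\<close>

definition int_num :: "int \<Rightarrow> num" where
  "int_num i = num_of_nat (nat i)"

lemma int_num_code [code]: "int_num (Int.Pos n) = n"
  by (simp add: int_num_def num_of_nat_numeral_eq)

lemma numeral_int_num: "i > 0 \<Longrightarrow> numeral (int_num i) = nat i"
  by (simp add: int_num_def numeral_num_of_nat)

lemma numeral_exponent:
  fixes q :: nat
  assumes "q mod 6 = 1" "q > 1"
  shows "numeral (int_num ((int q - 1) div 3)) = (q - 1) div 3"
proof -
  have q: "q \<ge> 7" using assms by presburger
  then have "(int q - 1) div 3 = int ((q - 1) div 3)" by (simp add: zdiv_int of_nat_diff)
  moreover have "int ((q - 1) div 3) > 0" using q by simp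
  ultimately show ?thesis using numeral_int_num[of "int ((q - 1) div 3)"] by simp
qed

definition distinct3 :: "'a \<Rightarrow> 'a \<Rightarrow> 'a \<Rightarrow> bool" where
  "distinct3 a b c \<longleftrightarrow> a \<noteq> b \<and> b \<noteq> c \<and> a \<noteq> c"

section \<open>Checks modulo a prime with tabulated symbols\<close>

definition imul :: "int \<Rightarrow> int \<Rightarrow> int \<Rightarrow> int" where
  "imul p x y = x * y mod p"

fun look :: "int \<Rightarrow> num \<Rightarrow> (int \<times> int) list \<Rightarrow> int \<Rightarrow> int" where
  "look p e [] d = mpow (imul p) (d mod p) e"
| "look p e ((k, v) # t) d = (if d = k then v else look p e t d)"

fun pows :: "int \<Rightarrow> num \<Rightarrow> int list \<Rightarrow> (int \<times> int) list" where
  "pows p e [] = []"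
| "pows p e (d # ds) = (d, mpow (imul p) (d mod p) e) # pows p e ds"

fun muls :: "int \<Rightarrow> num \<Rightarrow> (int \<times> int) list \<Rightarrow> (int \<times> int) list \<Rightarrow> (int \<times> int) list" where
  "muls p e [] t = t"
| "muls p e ((a, b) # ms) t = muls p e ms ((a * b, imul p (look p e t a) (look p e t b)) # t)"

text \<open>Absolute differences are enough because the exponent (p - 1)/3 is even, so that d and -d
  have the same symbol and can share a table entry.\<close>

definition line_ok :: "int \<Rightarrow> num \<Rightarrow> (int \<times> int) list \<Rightarrow> int \<Rightarrow> int \<Rightarrow> int \<Rightarrow> bool" where
  "line_ok p e t x y z \<longleftrightarrow> distinct3 x y z \<and>
     distinct3 (look p e t \<bar>x - y\<bar>) (look p e t \<bar>y - z\<bar>) (look p e t \<bar>x - z\<bar>)"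

definition points_ok where
  "points_ok p e t a0 a1 a2 a3 a4 a5 a6 \<longleftrightarrow>
     line_ok p e t a0 a1 a3 \<and> line_ok p e t a1 a2 a4 \<and> line_ok p e t a2 a3 a5 \<and> line_ok p e t a3 a4 a6 \<and>
     line_ok p e t a4 a5 a0 \<and> line_ok p e t a5 a6 a1 \<and> line_ok p e t a6 a0 a2"

definition in_range :: "int \<Rightarrow> int \<Rightarrow> bool" where
  "in_range p a \<longleftrightarrow> 0 \<le> a \<and> a < p"

text \<open>
  A configuration consists of seven integers and instructions for tabulating cubic symbols: by
  exponentiation for the members of the first list, then multiplicatively for the products \<open>a * b\<close> with
  \<open>(a, b)\<close> in the second list. Since \<^const>\<open>look\<close> falls back to exponentiation, the two lists influence only
  the cost of a check, not its soundness.
\<close>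

type_synonym config = "int list \<times> (int \<times> int) list \<times> int \<times> int \<times> int \<times> int \<times> int \<times> int \<times> int"

fun config_ok :: "int \<Rightarrow> num \<Rightarrow> config \<Rightarrow> bool" where
  "config_ok p e (ds, ms, a0, a1, a2, a3, a4, a5, a6) =
     (list_all (in_range p) [a0, a1, a2, a3, a4, a5, a6] \<and>
     points_ok p e (muls p e ms (pows p e ds)) a0 a1 a2 a3 a4 a5 a6)"

lemma mpow_imul: "mpow (imul p) (x mod p) n = x ^ numeral n mod p"
proof (induction n)
  case (Bit0 n)
  have "numeral (num.Bit0 n) = (numeral n + numeral n :: nat)" by (rule numeral_Bit0)
  then show ?case unfolding mpow.simps Let_def Bit0 by (simp only: imul_def power_add mod_mult_eq)
next
  case (Bit1 n)
  have "numeral (num.Bit1 n) = (numeral n + numeral n + 1 :: nat)" by (rule numeral_Bit1)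
  then show ?case unfolding mpow.simps Let_def Bit1 by (simp only: imul_def power_add mod_mult_eq power_one_right)
qed simp

lemma look_eq:
  assumes "\<forall>(k, v)\<in>set t. v = k ^ numeral e mod p"
  shows "look p e t d = d ^ numeral e mod p"
  using assms by (induction p e t d rule: look.induct) (auto simp: mpow_imul)

lemma muls_valid:
  assumes "\<forall>(k, v)\<in>set t. v = k ^ numeral e mod p"
  shows "\<forall>(k, v)\<in>set (muls p e ms t). v = k ^ numeral e mod p"
  using assms
proof (induction p e ms t rule: muls.induct)
  case (2 p e a b ms t)
  have "imul p (look p e t a) (look p e t b) = (a * b) ^ numeral e mod p"
    unfolding look_eq[OF "2.prems"] imul_def by (simp add: mod_mult_eq power_mult_distrib)
  then show ?case using 2 by simp
qed simp

lemma pows_valid: "\<forall>(k, v)\<in>set (pows p e ds). v = k ^ numeral e mod p"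
  by (induction ds) (auto simp: mpow_imul)

lemma cubic_field_residue_ring:
  assumes "prime p" "p mod 6 = 1"
  shows "cubic_field (residue_ring (int p))" "order (residue_ring (int p)) = p"
proof -
  interpret residues_prime p "residue_ring (int p)" by unfold_locales (use assms in auto)
  show o: "order (residue_ring (int p)) = p" by (simp add: order_def res_carrier_eq)
  show "cubic_field (residue_ring (int p))"
    by unfold_locales (use o assms in auto)
qed

lemma config_ok_rainbow_fano:
  fixes p :: nat
  assumes p: "prime p" "p mod 6 = 1" and ok: "config_ok (int p) (int_num ((int p - 1) div 3)) c"
  shows "\<exists>P. rainbow_fano (residue_ring (int p)) P"
proof -
  interpret residues_prime p "residue_ring (int p)" by unfold_locales (use p in auto)
  let ?R = "residue_ring (int p)"
  define e where "e = int_num ((int p - 1) div 3)"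
  obtain ds ms a0 a1 a2 a3 a4 a5 a6 where c: "c = (ds, ms, a0, a1, a2, a3, a4, a5, a6)"
    by (metis surj_pair)
  define t where "t = muls (int p) e ms (pows (int p) e ds)"
  have range: "{a0, a1, a2, a3, a4, a5, a6} \<subseteq> carrier ?R"
    and lines: "points_ok (int p) e t a0 a1 a2 a3 a4 a5 a6"
    using ok by (auto simp: c e_def t_def res_carrier_eq in_range_def)
  have e: "numeral e = (p - 1) div 3"
    unfolding e_def by (rule numeral_exponent) (use p prime_gt_1_nat[OF p(1)] in auto)
  have ev: "even (numeral e :: nat)" unfolding e using p(2) by presburger
  have o: "order ?R = p" by (rule cubic_field_residue_ring(2)[OF p])
  have sym: "look (int p) e t \<bar>x - y\<bar> = cubic_symbol ?R (x \<ominus>\<^bsub>?R\<^esub> y)" if "x \<in> carrier ?R" "y \<in> carrier ?R" for x y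
  proof -
    have "x \<ominus>\<^bsub>?R\<^esub> y = (x - y) mod int p"
      using that by (simp add: a_minus_def res_neg_eq res_add_eq mod_simps)
    then have "cubic_symbol ?R (x \<ominus>\<^bsub>?R\<^esub> y) = (x - y) ^ numeral e mod int p"
      unfolding cubic_symbol_def o e by (simp only: pow_cong)
    also have "\<dots> = \<bar>x - y\<bar> ^ numeral e mod int p" using ev by (simp only: power_even_abs)
    also have "\<dots> = look (int p) e t \<bar>x - y\<bar>"
      unfolding t_def by (rule look_eq[symmetric], rule muls_valid, rule pows_valid)
    finally show ?thesis by simp
  qed
  have line: "rainbow_triple ?R x y z" if "line_ok (int p) e t x y z" "x \<in> carrier ?R" "y \<in> carrier ?R" "z \<in> carrier ?R" for x y z
    using that(1) unfolding line_ok_def distinct3_def sym[OF that(2,3)] sym[OF that(3,4)] sym[OF that(2,4)] rainbow_triple_def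
    by simp
  have "rainbow_fano ?R (seven_points a0 a1 a2 a3 a4 a5 a6)"
    by (rule rainbow_fano_seven_points[OF range]; rule line)
      (use lines range in \<open>simp_all add: points_ok_def\<close>)
  then show ?thesis by (rule exI[of _ "seven_points a0 a1 a2 a3 a4 a5 a6"])
qed

text \<open>The operations are parameters so that a check runs on executable functions; subtraction
  in a ring record rests on a description of the inverse and cannot be evaluated.\<close>

definition ring_line_ok :: "('a \<Rightarrow> 'a \<Rightarrow> 'a) \<Rightarrow> ('a \<Rightarrow> 'a \<Rightarrow> 'a) \<Rightarrow> num \<Rightarrow> 'a \<Rightarrow> 'a \<Rightarrow> 'a \<Rightarrow> bool" where
  "ring_line_ok mul sub e x y z \<longleftrightarrow> distinct3 x y z \<and>
     distinct3 (mpow mul (sub x y) e) (mpow mul (sub y z) e) (mpow mul (sub x z) e)"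

definition ring_points_ok where
  "ring_points_ok mul sub e a0 a1 a2 a3 a4 a5 a6 \<longleftrightarrow>
     ring_line_ok mul sub e a0 a1 a3 \<and> ring_line_ok mul sub e a1 a2 a4 \<and> ring_line_ok mul sub e a2 a3 a5 \<and>
     ring_line_ok mul sub e a3 a4 a6 \<and> ring_line_ok mul sub e a4 a5 a0 \<and> ring_line_ok mul sub e a5 a6 a1 \<and>
     ring_line_ok mul sub e a6 a0 a2"

lemma ring_points_ok_rainbow_fano:
  fixes R (structure)
  assumes "cring R"
    and mul: "\<And>x y. x \<in> carrier R \<Longrightarrow> y \<in> carrier R \<Longrightarrow> mul x y = x \<otimes> y"
    and sub: "\<And>x y. x \<in> carrier R \<Longrightarrow> y \<in> carrier R \<Longrightarrow> sub x y = x \<ominus> y"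
    and e: "numeral e = (order R - 1) div 3"
    and range: "{a0, a1, a2, a3, a4, a5, a6} \<subseteq> carrier R"
    and ok: "ring_points_ok mul sub e a0 a1 a2 a3 a4 a5 a6"
  shows "\<exists>P. rainbow_fano R P"
proof -
  interpret cring R by fact
  have sym: "mpow mul (sub x y) e = cubic_symbol R (x \<ominus> y)" if "x \<in> carrier R" "y \<in> carrier R" for x y
    unfolding sub[OF that] cubic_symbol_def e[symmetric]
    by (rule mpow_eq_nat_pow) (use that mul in auto)
  have line: "rainbow_triple R x y z" if "ring_line_ok mul sub e x y z" "x \<in> carrier R" "y \<in> carrier R" "z \<in> carrier R" for x y z
    using that(1) unfolding ring_line_ok_def distinct3_def sym[OF that(2,3)] sym[OF that(3,4)] sym[OF that(2,4)] rainbow_triple_def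
    by simp
  have "rainbow_fano R (seven_points a0 a1 a2 a3 a4 a5 a6)"
    by (rule rainbow_fano_seven_points[OF range]; rule line)
      (use ok range in \<open>simp_all add: ring_points_ok_def\<close>)
  then show ?thesis by (rule exI[of _ "seven_points a0 a1 a2 a3 a4 a5 a6"])
qed

section \<open>Covering all primes below 5476\<close>

fun composite_by :: "int \<Rightarrow> int list \<Rightarrow> bool" where
  "composite_by n [] = False"
| "composite_by n (d # ds) = (if n mod d = 0 then d < n else composite_by n ds)"

text \<open>A composite number below 5476 = 74^2 has a prime divisor of at most 73, and 2 and 3
  never divide 6 k + 1. The guard \<open>d < n\<close> in \<open>composite_by\<close> keeps a prime
  from counting as its own proper divisor.\<close>

definition has_small_divisor :: "int \<Rightarrow> bool" where
  "has_small_divisor n = composite_by n [5, 7, 11, 13, 17, 19, 23, 29, 31, 37, 41, 43, 47, 53, 59, 61, 67, 71, 73]"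

lemma has_small_divisor_not_prime:
  assumes "has_small_divisor n"
  shows "\<not> prime n"
proof -
  have "\<exists>d\<in>set ds. d dvd n \<and> d < n" if "composite_by n ds" for ds
    using that by (induction n ds rule: composite_by.induct) (auto split: if_splits)
  then obtain d where d: "d \<in> set [5, 7, 11, 13, 17, 19, 23, 29, 31, 37, 41, 43, 47, 53, 59, 61, 67, 71, 73]"
    "d dvd n" "d < n" using assms unfolding has_small_divisor_def by blast
  have "1 < d" using d(1) by auto
  then show ?thesis using d(2,3) unfolding prime_int_iff by (auto intro!: exI[of _ d])
qed

text \<open>Walks along the values of k and the certificates in step: each 6 k + 1 is either the
  next listed number, whose configuration is checked, or has a proper divisor. Hence no prime can be
  missed.\<close>

fun segment_ok :: "int list \<Rightarrow> (int \<times> config) list \<Rightarrow> bool" where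
  "segment_ok [] cs = True"
| "segment_ok (k # ks) [] = (has_small_divisor (6 * k + 1) \<and> segment_ok ks [])"
| "segment_ok (k # ks) ((p, c) # cs) = (if 6 * k + 1 = p
     then config_ok p (int_num ((p - 1) div 3)) c \<and> segment_ok ks cs
     else has_small_divisor (6 * k + 1) \<and> segment_ok ks ((p, c) # cs))"

lemma segment_ok_prime:
  assumes "segment_ok ks cs" "k \<in> set ks" "prime (6 * k + 1)"
  shows "\<exists>c. config_ok (6 * k + 1) (int_num (2 * k)) c"
  using assms
proof (induction ks cs rule: segment_ok.induct)
  case (2 k' ks)
  have "k \<noteq> k'" using 2 has_small_divisor_not_prime by auto
  then show ?case using 2 by simp
next
  case (3 k' ks p c cs)
  show ?case
  proof (cases "6 * k' + 1 = p")
    case True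
    then have ok: "config_ok p (int_num ((p - 1) div 3)) c" "segment_ok ks cs" using "3.prems"(1) by (simp_all del: config_ok.simps)
    show ?thesis
    proof (cases "k = k'")
      case k: True
      have "(p - 1) div 3 = 2 * k" using True k by simp
      then show ?thesis using ok(1) True k by (intro exI[of _ c]) simp
    next
      case False
      then show ?thesis using "3.IH"(1)[OF True ok(2)] "3.prems" by simp
    qed
  next
    case False
    then have ok: "has_small_divisor (6 * k' + 1)" "segment_ok ks ((p, c) # cs)" using "3.prems"(1) by (simp_all del: config_ok.simps)
    then have "k \<noteq> k'" using has_small_divisor_not_prime "3.prems"(3) by auto
    then show ?thesis using "3.IH"(2)[OF False ok(2)] "3.prems" by simp
  qed
qed simp

text \<open>
  The primes \<open>6 k + 1 < 5476\<close>, in segments of 57 values of \<open>k\<close>; the value \<open>k = 2\<close> of the prime 13 is left out.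
\<close>

definition cf1 :: config where
  "cf1 = ([2,3,5],[(2,2),(2,3),(2,4),(3,3),(2,5),(2,6),(3,5),(2,8),(2,9),(2,10),(2,12),(2,15),
    (2,18)],36,0,6,12,18,24,16)"
definition cf2 :: config where
  "cf2 = ([1,2,3,5],[(2,2),(2,3),(2,4),(3,3),(2,5),(2,6),(3,5),(2,8),(2,9),(2,10),(2,12)],24,
    0,6,4,8,12,9)"
definition cf3 :: config where
  "cf3 = ([2,3,5,7],[(2,2),(2,3),(3,3),(2,5),(2,6),(2,7),(3,5),(2,9),(2,10),(3,7),(2,12),(3,
    9)],27,0,3,21,12,7,9)"
definition cf4 :: config where
  "cf4 = ([2,3,5,7],[(2,2),(2,3),(2,4),(3,3),(2,6),(2,7),(2,8),(2,9),(3,7),(2,12),(5,5),(2,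
    14),(2,16)],32,0,4,7,28,25,16)"
definition cf5 :: config where
  "cf5 = ([2,3,5,7],[(2,2),(2,3),(2,4),(3,3),(2,5),(2,6),(2,7),(3,5),(2,8),(2,9),(2,10),(3,
    9),(2,15),(2,16)],32,0,2,14,5,12,20)"
definition cf6 :: config where
  "cf6 = ([2,3,5,7],[(2,2),(2,3),(2,4),(3,3),(2,5),(2,6),(2,7),(3,5),(2,8),(2,9),(2,10),(2,
    12),(2,14),(2,15),(2,16),(2,20)],40,0,8,16,20,28,10)"
definition cf7 :: config where
  "cf7 = ([2,3,5,7],[(2,2),(2,3),(2,4),(3,3),(2,6),(2,7),(2,8),(2,9),(3,7),(2,12),(5,5),(2,
    14),(2,16)],32,0,4,7,28,16,25)"
definition cf8 :: config where
  "cf8 = ([2,3,5,7],[(2,2),(2,3),(2,4),(3,3),(2,5),(2,6),(2,7),(3,5),(2,8),(2,9),(2,10),(3,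
    7),(2,12),(2,15),(2,18)],36,0,6,15,20,30,18)"
definition cf9 :: config where
  "cf9 = ([2,3,5,7],[(2,2),(2,3),(2,4),(3,3),(2,5),(2,6),(2,7),(2,8),(2,9),(3,7),(2,12),(2,
    14)],28,0,7,4,12,16,10)"
definition cf10 :: config where
  "cf10 = ([1,2,3,5,7],[(2,2),(2,3),(2,4),(3,3),(2,5),(2,6),(2,7),(3,5),(2,8),(2,10),(3,7),
    (5,5),(2,14),(2,15)],30,0,2,9,10,5,14)"
definition cf11 :: config where
  "cf11 = ([1,2,3,5,7],[(2,2),(2,3),(2,4),(3,3),(2,5),(2,6),(2,7),(3,5),(2,8),(2,9),(2,10),
    (3,7),(2,12),(5,5),(2,15),(2,18),(2,20)],40,0,4,16,24,25,10)"
definition cf12 :: config where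
  "cf12 = ([1,2,3,5,7,17],[(2,2),(2,3),(2,4),(3,3),(2,5),(2,6),(2,7),(3,5),(2,9),(2,10),(2,
    12),(5,5),(3,9),(2,14),(2,15)],30,0,2,3,20,12,27)"
definition cf13 :: config where
  "cf13 = ([2,3,5,7,11],[(2,2),(2,3),(2,4),(3,3),(2,5),(2,6),(2,7),(2,8),(2,9),(2,11),(2,12),
    (2,14),(2,16),(2,18)],36,0,4,8,18,32,22)"
definition cf14 :: config where
  "cf14 = ([1,2,3,5,11,13],[(2,2),(2,3),(2,4),(3,3),(2,5),(2,6),(3,5),(2,8),(2,9),(2,10),(2,
    12),(5,5),(3,9),(3,11),(2,18)],36,0,3,16,11,12,27)"
definition cf15 :: config where
  "cf15 = ([1,2,3,5,7,11],[(2,2),(2,4),(3,3),(2,5),(2,7),(3,5),(2,8),(2,9),(2,10),(3,7),(5,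
    5),(2,14),(2,18)],36,0,8,16,15,18,11)"
definition cf16 :: config where
  "cf16 = ([2,3,5,7,11],[(2,2),(2,3),(2,4),(3,3),(2,5),(2,7),(3,5),(2,8),(2,9),(2,10),(3,7),
    (2,11),(5,5),(3,9),(2,14),(2,15),(5,7)],35,0,5,7,25,27,21)"
definition cf17 :: config where
  "cf17 = ([2,3,5,7,11],[(2,2),(2,4),(3,3),(2,5),(2,7),(2,8),(2,9),(3,7),(2,11),(5,5),(2,16),
    (2,18)],36,0,4,11,14,22,25)"
definition cf18 :: config where
  "cf18 = ([1,2,3,5,7,11],[(2,3),(3,3),(2,5),(2,6),(2,10),(3,7),(2,11)],22,0,1,10,11,12,21)"
definition cf19 :: config where
  "cf19 = ([1,2,3,5,7,11],[(2,2),(2,3),(2,4),(3,3),(2,5),(2,6),(2,7),(3,5),(2,8),(2,9),(2,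
    10),(3,7),(2,12),(5,5),(2,16),(5,7),(2,18)],36,0,4,1,11,16,25)"
definition cf20 :: config where
  "cf20 = ([1,2,3,5,7,11],[(2,2),(2,3),(2,4),(3,3),(2,5),(2,6),(2,8),(2,10),(3,7),(2,11),(2,
    16),(3,11)],33,0,1,12,11,21,22)"
definition cf21 :: config where
  "cf21 = ([1,2,3,5,7,11],[(2,2),(2,3),(2,4),(3,3),(2,5),(2,6),(2,7),(3,5),(2,8),(2,9),(2,
    10),(3,7),(3,9),(2,16),(5,7),(2,18)],36,0,1,16,15,9,4)"
definition cf22 :: config where
  "cf22 = ([1,2,3,5,7,11],[(2,2),(2,3),(2,4),(3,3),(2,5),(2,6),(2,7),(3,5),(2,8),(2,9),(3,7),
    (2,11),(5,5),(2,15),(2,16),(3,11),(5,7),(2,18)],36,0,1,3,33,15,11)"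
definition cf23 :: config where
  "cf23 = ([2,3,5,7,11],[(2,2),(2,3),(2,4),(3,3),(2,5),(2,7),(2,8),(2,9),(2,10),(3,7),(2,11),
    (5,5),(3,9),(2,16),(2,18)],36,0,4,9,25,20,14)"
definition cf24 :: config where
  "cf24 = ([1,2,3,5,7,11],[(2,2),(2,3),(2,4),(3,3),(2,5),(2,6),(2,7),(3,5),(2,9),(3,7),(2,
    11),(2,12),(5,5)],25,0,1,22,7,4,15)"
definition cf25 :: config where
  "cf25 = ([2,3,5,7,11,13],[(2,2),(2,3),(2,4),(3,3),(2,5),(2,6),(3,5),(2,8),(2,9),(2,10),(2,
    11),(2,12),(3,9),(3,11),(5,7)],35,0,2,24,20,15,8)"
definition cf26 :: config where
  "cf26 = ([2,3,5,7,19,23],[(2,2),(2,4),(3,3),(2,5),(2,7),(2,8),(2,9),(2,14),(2,16)],32,0,4,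
    9,23,18,14)"
definition cf27 :: config where
  "cf27 = ([1,2,3,5,7,13,19],[(2,3),(2,5),(2,6),(2,7),(2,10),(2,13)],26,0,6,20,13,19,7)"
definition cf28 :: config where
  "cf28 = ([1,2,3,5,7,11],[(2,2),(2,3),(2,4),(3,3),(2,5),(2,6),(3,5),(2,8),(2,9),(2,10),(3,
    7),(2,11),(2,12),(5,5),(2,16),(3,11),(5,7),(2,18)],36,0,1,33,12,11,21)"
definition cf29 :: config where
  "cf29 = ([2,3,5,7,11],[(2,2),(2,4),(3,3),(2,7),(2,8),(2,9),(2,11),(5,5),(3,9),(2,18)],36,0,
    9,14,11,18,25)"
definition cf30 :: config where
  "cf30 = ([1,2,3,5,7,11],[(2,2),(2,3),(2,4),(3,3),(2,5),(2,6),(2,7),(3,5),(2,9),(3,7),(2,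
    11),(2,12),(2,14),(2,18)],36,0,8,15,22,14,12)"
definition cf31 :: config where
  "cf31 = ([2,3,5,7,11,13],[(2,2),(2,3),(2,4),(3,3),(2,5),(2,6),(2,7),(3,5),(2,9),(3,7),(2,
    11),(2,12),(2,13),(2,14),(2,18)],36,0,8,21,26,12,14)"
definition cf32 :: config where
  "cf32 = ([1,2,3,5,7,11,13],[(2,2),(2,3),(2,4),(3,3),(2,5),(2,6),(2,7),(3,5),(2,11),(5,5),
    (2,13),(3,9)],27,0,1,15,5,2,13)"
definition cf33 :: config where
  "cf33 = ([2,3,5,7,11,13],[(2,2),(2,3),(2,4),(3,3),(2,5),(2,7),(3,5),(2,9),(2,10),(2,13),(2,
    14),(3,11)],33,0,5,20,7,13,15)"
definition cf34 :: config where
  "cf34 = ([2,3,5,7,11,13],[(2,2),(2,3),(2,4),(3,3),(2,5),(2,7),(2,8),(2,10),(2,11),(2,13),(3,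
    9),(2,14),(3,11)],33,0,6,28,20,22,26)"
definition cf35 :: config where
  "cf35 = ([2,3,5,7,11,13],[(2,2),(2,3),(3,3),(2,5),(2,6),(3,5),(2,10),(2,11),(2,12),(2,13),
    (3,11),(5,7)],35,0,2,24,13,22,9)"
definition cf36 :: config where
  "cf36 = ([2,3,5,7,11,13],[(2,3),(3,3),(2,5),(2,6),(2,7),(3,5),(2,10),(2,11),(2,12),(2,13),
    (2,14),(3,11),(5,7)],35,0,2,13,28,26,15)"
definition cf37 :: config where
  "cf37 = ([1,2,3,5,7,11,13],[(2,2),(2,3),(2,4),(3,3),(2,6),(2,7),(3,5),(2,8),(2,9),(2,11),
    (2,12),(5,5),(3,9),(2,18)],36,0,9,22,11,25,24)"
definition cf38 :: config where
  "cf38 = ([2,3,5,7,11,13],[(2,2),(2,3),(2,4),(3,3),(2,5),(2,7),(3,5),(2,8),(2,9),(2,10),(3,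
    7),(2,11),(3,9),(2,15),(2,18)],36,0,6,9,22,16,27)"
definition cf39 :: config where
  "cf39 = ([2,3,5,7,11,13,19],[(2,2),(2,3),(2,4),(3,3),(2,5),(2,6),(2,7),(3,5),(2,8),(3,7),
    (2,12),(2,13),(2,14),(2,15)],30,0,4,28,14,9,19)"
definition cf40 :: config where
  "cf40 = ([1,2,3,5,7,11,17,23,43],[(2,2),(2,4),(3,3),(2,5),(2,7),(3,5),(2,9),(3,7),(2,11),
    (3,9),(2,14),(5,7),(2,18),(2,21),(2,22),(3,15),(2,23)],46,0,1,3,18,10,45)"
definition cf41 :: config where
  "cf41 = ([1,2,3,5],[(2,2),(2,3)],6,0,1,2,3,4,5)"
definition cf42 :: config where
  "cf42 = ([2,3,5,7],[(2,2),(2,3),(2,4),(3,3),(2,5),(2,6),(2,7),(3,5),(2,8),(2,9),(2,10),(5,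
    5),(2,14),(2,15)],30,0,2,12,5,14,10)"
definition cf43 :: config where
  "cf43 = ([1,2,3,5,7],[(2,2),(2,3),(2,4),(3,3),(2,5),(2,6),(3,5),(2,8),(2,9)],18,0,2,3,10,
    8,6)"
definition cf44 :: config where
  "cf44 = ([2,3,5,7,11],[(2,2),(2,4),(3,3),(2,5),(2,7),(2,8),(2,9),(2,10),(3,7),(5,5),(2,16),
    (2,18)],36,0,4,20,18,25,11)"
definition cf45 :: config where
  "cf45 = ([2,3,5,7,11],[(2,2),(2,3),(2,4),(3,3),(2,5),(2,6),(2,7),(2,8),(2,9),(3,7),(2,12),
    (2,14)],28,0,7,4,16,14,18)"
definition cf46 :: config where
  "cf46 = ([2,3,5,7,11],[(2,2),(2,3),(2,4),(3,3),(2,7),(3,5),(2,8),(2,9),(2,11),(5,5)],25,0,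
    3,18,11,7,9)"
definition cf47 :: config where
  "cf47 = ([2,3,5,7,11,13],[(2,2),(2,3),(2,4),(3,3),(2,6),(2,7),(3,5),(2,8),(2,9),(3,7),(2,
    11),(2,12),(2,13),(3,9),(2,14),(2,15),(3,11),(5,7)],35,0,2,30,26,14,8)"
definition cf48 :: config where
  "cf48 = ([1,2,3,5,7,11,13],[(2,2),(2,3),(3,3),(2,5),(2,7),(3,5),(2,9),(2,10),(3,7),(5,5),
    (2,13),(5,7),(2,18)],36,0,1,10,21,15,11)"
definition cf49 :: config where
  "cf49 = ([2,3,5,7,11,13],[(2,2),(2,3),(2,4),(3,3),(2,5),(2,7),(3,5),(2,9),(2,10),(2,11),(5,
    5),(2,13),(3,9),(2,14),(2,15),(3,11),(5,7)],35,0,2,10,28,30,8)"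
definition cf50 :: config where
  "cf50 = ([1,2,3,5,7,11,13],[(2,2),(2,3),(2,4),(3,3),(2,5),(2,7),(3,5),(2,8),(2,9),(2,10),
    (3,7),(2,11),(2,13),(2,15),(2,18)],36,0,6,20,21,10,14)"
definition cf51 :: config where
  "cf51 = ([2,3,5,7,11,13],[(2,2),(2,3),(3,3),(2,5),(2,6),(2,7),(3,5),(2,9),(2,10),(2,11),(2,
    12),(2,13),(2,14)],28,0,2,13,15,22,4)"
definition cf52 :: config where
  "cf52 = ([1,2,3,5,7,11,13],[(2,2),(2,3),(2,4),(2,5),(2,6),(2,7),(2,10),(3,7),(5,5),(2,13),
    (2,14),(3,11)],33,0,5,26,12,13,25)"
definition cf53 :: config where
  "cf53 = ([1,2,3,5,7,11,13],[(2,2),(2,3),(2,4),(3,3),(2,5),(2,6),(2,7),(3,5),(2,9),(2,11),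
    (2,12),(5,5),(3,9),(2,14),(2,15),(3,11)],33,0,3,28,15,25,27)"
definition cf54 :: config where
  "cf54 = ([1,2,3,5,7,11,13],[(2,2),(2,3),(3,3),(2,5),(2,6),(2,7),(3,5),(2,9),(2,10),(3,7),
    (2,12),(5,5),(2,13),(5,7),(2,18)],36,0,1,15,21,25,26)"
definition cf55 :: config where
  "cf55 = ([1,2,3,5,7,11,13],[(2,2),(2,3),(2,4),(3,3),(2,5),(2,6),(2,7),(3,5),(2,10),(3,7),
    (2,11),(2,12),(2,13),(3,11),(5,7)],35,0,2,15,26,14,22)"
definition cf56 :: config where
  "cf56 = ([1,2,3,5,7,11,13],[(2,2),(2,3),(2,4),(3,3),(2,5),(2,6),(2,7),(3,5),(2,8),(2,9),(2,
    10),(3,7),(2,11),(5,5),(2,13),(2,16),(3,11),(5,7),(2,18)],36,0,1,26,33,22,21)"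
definition cf57 :: config where
  "cf57 = ([1,2,3,5,7,11,13],[(2,2),(2,3),(2,4),(3,3),(2,5),(2,6),(2,7),(3,5),(2,9),(2,11),
    (2,12),(5,5),(2,13),(3,11)],33,0,8,7,18,22,9)"
definition cf58 :: config where
  "cf58 = ([2,3,5,7,11,13],[(2,2),(2,3),(2,6),(2,7),(3,5),(2,11),(2,12),(2,13),(2,14),(2,15)],
    30,0,2,4,15,26,28)"
definition cf59 :: config where
  "cf59 = ([2,3,5,7,11,13],[(2,3),(3,3),(2,5),(3,5),(2,9),(2,10),(2,11),(2,13),(3,11),(5,7)],
    35,0,2,9,15,22,20)"
definition cf60 :: config where
  "cf60 = ([1,2,3,5,7,11,13],[(2,2),(2,3),(3,3),(2,5),(2,6),(2,7),(3,5),(2,9),(2,11),(2,12),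
    (5,5),(2,13),(3,11),(5,7),(2,18)],36,0,1,25,10,14,3)"
definition cf61 :: config where
  "cf61 = ([2,3,5,7,11,19],[(2,2),(2,4),(2,7),(3,5),(2,11),(2,15)],30,0,8,22,19,11,15)"
definition cf62 :: config where
  "cf62 = ([2,3,5,7,11,13],[(2,2),(2,3),(2,4),(3,3),(2,5),(2,6),(2,7),(3,5),(2,8),(2,9),(2,
    10),(2,11),(2,12),(3,9),(2,16),(2,18)],36,0,4,22,16,9,24)"
definition cf63 :: config where
  "cf63 = ([2,3,5,7,11,13],[(2,2),(2,3),(2,4),(3,3),(2,5),(2,6),(2,7),(3,5),(2,8),(2,9),(2,
    10),(3,7),(2,11),(5,5),(2,14),(2,16)],32,0,4,12,25,7,10)"
definition cf64 :: config where
  "cf64 = ([2,3,5,7,11,13],[(2,2),(2,3),(2,4),(3,3),(2,5),(2,7),(3,5),(2,9),(2,10),(2,11),(5,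
    5),(2,13),(3,9),(2,14),(2,15),(3,11),(2,18)],36,0,3,10,30,8,28)"
definition cf65 :: config where
  "cf65 = ([1,2,3,5,7,11,13],[(2,2),(2,3),(2,4),(3,3),(2,5),(2,6),(2,7),(2,10),(3,7),(2,11),
    (2,12),(2,13),(3,11),(5,7)],35,0,2,13,26,22,14)"
definition cf66 :: config where
  "cf66 = ([2,3,5,7,11,13],[(2,2),(2,3),(2,4),(3,3),(2,5),(2,6),(2,7),(2,8),(2,9),(2,10),(2,
    11),(5,5),(2,14),(3,11),(2,18)],36,0,3,16,14,8,28)"
definition cf67 :: config where
  "cf67 = ([2,3,5,7,11,13],[(2,2),(2,3),(2,4),(3,3),(2,5),(2,6),(3,5),(2,8),(2,9),(2,10),(3,
    7),(2,12),(3,9),(3,11),(2,18)],36,0,3,27,12,21,16)"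
definition cf68 :: config where
  "cf68 = ([1,2,3,5,7,11,19,23],[(2,2),(3,3),(2,5),(2,7),(3,5),(2,9),(2,10),(3,7),(5,5),(2,
    14),(2,15)],30,0,2,11,20,21,25)"
definition cf69 :: config where
  "cf69 = ([2,3,5,7,13,17,23],[(2,2),(2,3),(2,4),(3,3),(2,6),(2,7),(3,5),(2,9),(3,7),(5,5),
    (2,13),(2,15)],30,0,4,13,7,25,21)"
definition cf70 :: config where
  "cf70 = ([2,3,5,7,11,13,19],[(2,2),(2,3),(2,4),(3,3),(2,5),(2,7),(2,8),(2,10),(2,11),(2,13),
    (2,14),(2,16),(3,11),(5,7),(3,13)],39,0,4,6,26,32,13)"
definition cf71 :: config where
  "cf71 = ([2,3,5,7,11,13,19],[(2,2),(2,3),(2,4),(3,3),(2,6),(2,7),(3,5),(3,7),(2,11),(2,13),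
    (2,14)],28,0,2,6,14,9,21)"
definition cf72 :: config where
  "cf72 = ([1,2,3,5,7,11,17,23],[(2,3),(2,6),(3,5),(2,11),(3,11),(2,17),(5,7),(3,15),(2,23)],
    46,0,1,35,23,34,12)"
definition cf73 :: config where
  "cf73 = ([2,3,5,7,11,13,17,19],[(2,2),(2,3),(2,4),(3,3),(2,6),(2,7),(3,5),(2,8),(2,11),(2,
    12),(2,14),(2,15)],30,0,2,8,19,24,11)"
definition cf74 :: config where
  "cf74 = ([2,3,5,7,13,19,23,37],[(2,2),(2,3),(2,4),(3,3),(2,5),(2,6),(2,7),(3,5),(2,8),(2,
    10),(3,7),(5,5),(2,14),(5,7),(2,19),(2,20)],40,0,3,38,28,15,19)"
definition cf75 :: config where
  "cf75 = ([1,2,3,5,7,11,13,17,43],[(2,2),(2,4),(3,3),(2,5),(2,8),(2,9),(3,7),(5,5),(2,13),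
    (2,16),(3,11),(5,7),(2,21),(2,25),(3,17)],0,1,8,26,33,43,51)"
definition cf76 :: config where
  "cf76 = ([1,2,3,5,7,11,13,23,43],[(3,3),(2,5),(3,5),(2,9),(2,10),(2,11),(5,5),(2,13),(3,11),
    (5,7),(2,18),(3,15),(2,23)],46,0,1,36,26,23,3)"
definition cf77 :: config where
  "cf77 = ([2,3,5,7,11,13,19,31],[(2,2),(2,3),(2,4),(3,3),(2,5),(2,6),(2,7),(2,8),(2,9),(2,
    10),(3,7),(2,11),(2,13),(2,14),(3,11),(2,19),(2,20)],40,0,2,7,9,28,18)"
definition cf78 :: config where
  "cf78 = ([2,3,5,7,11,13,19,29],[(2,2),(2,4),(3,3),(2,5),(2,7),(3,5),(2,9),(2,10),(3,7),(2,
    11),(2,13),(3,11),(2,18),(2,20)],40,0,4,19,11,26,33)"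
definition cf79 :: config where
  "cf79 = ([2,3,5,7,11,19,29,31],[(2,2),(3,3),(2,5),(2,9),(2,10),(2,11),(3,9),(3,11),(2,19),
    (2,20)],40,0,2,11,33,22,29)"
definition cf80 :: config where
  "cf80 = ([1,2,3,5,7,13,17,19,23],[(2,2),(2,4),(3,3),(2,5),(3,5),(2,9),(2,10),(3,7),(2,13),
    (3,9),(2,15)],30,0,4,3,21,13,23)"
definition cf81 :: config where
  "cf81 = ([2,3,5,7,11,17,19,23],[(2,2),(2,3),(2,4),(3,3),(2,5),(2,7),(3,5),(2,8),(3,7),(5,
    5),(2,15),(2,16)],32,0,2,17,7,23,21)"
definition cf82 :: config where
  "cf82 = ([2,3,5,7,11,13,17,19],[(2,2),(2,3),(2,4),(3,3),(2,5),(2,7),(3,5),(2,8),(2,9),(2,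
    11),(2,13),(2,14),(2,16)],32,0,4,6,22,15,13)"
definition cf83 :: config where
  "cf83 = ([1,2,3,5,7,11,17,19,23],[(2,2),(2,3),(2,4),(3,3),(2,6),(2,7),(2,8),(2,9),(2,11),
    (3,9),(2,14)],28,0,1,23,17,19,12)"
definition cf84 :: config where
  "cf84 = ([1,2,3,5,7,11,13,19,37],[(2,2),(2,3),(2,4),(3,3),(2,5),(2,6),(2,7),(2,9),(2,10),
    (2,13),(3,9),(2,14),(2,19),(3,13),(2,20)],40,0,1,2,20,39,28)"
definition cf85 :: config where
  "cf85 = ([1,2,3,5,7,19,23,29,37],[(2,2),(2,3),(2,4),(3,3),(2,6),(2,7),(3,5),(2,8),(2,9),(2,
    12),(2,14),(2,16),(2,19)],38,0,1,15,24,6,29)"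
definition cf86 :: config where
  "cf86 = ([2,3,5,7,11,13,17,19],[(2,2),(2,3),(2,4),(2,6),(3,5),(2,8),(2,12),(5,5),(2,13),(2,
    15),(2,16)],32,0,2,26,19,7,13)"
definition cf87 :: config where
  "cf87 = ([2,3,5,7,11,13,19,23],[(2,2),(2,4),(3,3),(2,5),(2,7),(3,5),(2,8),(2,9),(3,7),(2,
    13),(3,9),(2,14),(2,15),(2,16)],32,0,2,5,23,28,13)"
definition cf88 :: config where
  "cf88 = ([2,3,5,7,11,13,17,19],[(2,2),(2,3),(3,3),(2,5),(2,6),(2,10),(2,11),(2,12),(2,13)],
    26,0,4,24,13,17,7)"
definition cf89 :: config where
  "cf89 = ([1,2,3,5,7,11,17,19,29],[(2,2),(2,3),(2,4),(3,3),(2,5),(3,5),(2,10),(3,7),(2,11),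
    (5,5),(2,15)],30,0,1,22,20,11,5)"
definition cf90 :: config where
  "cf90 = ([1,2,3,5,7,11,13,19,31],[(2,2),(2,3),(2,4),(3,3),(2,5),(2,6),(2,8),(2,9),(2,10),
    (3,7),(2,16),(3,11),(2,19),(3,13),(2,20)],40,0,1,2,20,21,33)"
definition cf91 :: config where
  "cf91 = ([2,3,5,7,11,13,17,19,23],[(2,2),(2,3),(3,3),(2,5),(2,7),(3,7),(3,9),(2,14),(2,17),
    (2,19)],38,0,4,27,21,17,10)"
definition cf92 :: config where
  "cf92 = ([1,2,3,5,7,17,19,23,29,59],[(2,2),(2,4),(3,3),(2,7),(3,5),(3,7),(5,5),(3,9),(2,
    14),(2,15),(2,23),(7,7),(2,25),(3,17),(2,27),(3,19),(2,29)],0,1,2,30,59,5,51)"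
definition cf93 :: config where
  "cf93 = ([1,2,3,5,7,11,13,17,23,29],[(2,2),(2,3),(2,4),(3,3),(2,5),(2,6),(2,7),(3,5),(2,
    10),(2,11),(5,5),(2,17),(5,7),(3,13),(2,20)],40,0,1,6,35,23,15)"
definition cf94 :: config where
  "cf94 = ([1,2,3,5,7,11,13,17,23,29],[(2,3),(3,3),(2,5),(2,6),(2,7),(2,9),(2,10),(2,11),(2,
    14),(2,17),(3,13),(2,20)],40,0,1,6,23,29,11)"
definition cf95 :: config where
  "cf95 = ([1,2,3,5,7,11,13,17,23,31],[(2,2),(2,4),(3,3),(2,5),(2,7),(2,8),(2,9),(2,10),(2,
    11),(5,5),(2,13),(2,17),(5,7),(2,18),(3,13),(2,20)],40,0,1,4,26,35,17)"
definition cf96 :: config where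
  "cf96 = ([2,3,5,7,11,13,17,19,23],[(2,2),(2,3),(2,4),(3,3),(2,6),(2,7),(3,5),(2,8),(3,7),
    (2,11),(2,13),(2,14),(2,16)],32,0,4,23,15,11,26)"
definition cf97 :: config where
  "cf97 = ([2,3,5,7,11,17,23,31,37],[(2,3),(2,5),(2,7),(2,10),(2,14),(2,17),(2,20)],40,0,3,23,
    17,34,6)"
definition cf98 :: config where
  "cf98 = ([1,2,3,5,7,13,17,19,23,37],[(2,2),(2,3),(2,4),(2,5),(2,7),(2,8),(2,10),(3,7),(2,
    17),(2,20)],40,0,3,6,20,23,19)"
definition cf99 :: config where
  "cf99 = ([1,2,3,5,7,11,13,17,23,29],[(2,2),(2,3),(2,4),(3,3),(2,5),(2,6),(3,5),(2,8),(2,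
    10),(3,7),(3,9),(2,15),(3,11),(2,17),(3,13),(2,20)],40,0,1,34,30,17,13)"
definition cf100 :: config where
  "cf100 = ([2,3,5,7,11,13,17,19,29,31],[(2,3),(3,3),(2,5),(2,6),(2,7),(2,9),(3,7),(2,13),(3,
    11),(2,18),(2,19)],38,0,2,12,19,33,31)"
definition cf101 :: config where
  "cf101 = ([1,2,3,5,7,11,13,19,29,31,59],[(3,3),(2,7),(3,5),(2,13),(3,9),(2,14),(2,15),(5,
    11),(2,28),(3,19),(2,29)],0,1,2,30,31,57,59)"
definition cf102 :: config where
  "cf102 = ([1,2,3,5,7,11,13,17,19,23,29],[(2,2),(2,3),(2,4),(3,3),(2,5),(3,5),(2,8),(2,9),
    (2,10),(3,7),(2,16),(3,11),(2,17),(2,19),(3,13),(2,20)],40,0,1,19,34,2,11)"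
definition cf103 :: config where
  "cf103 = ([2,3,5,7,11,13,17,19,23,31],[(2,2),(3,3),(2,5),(2,7),(2,9),(2,10),(3,7),(3,11),(2,
    17),(2,18),(2,19),(2,20)],40,0,2,33,19,23,36)"
definition cf104 :: config where
  "cf104 = ([2,3,5,7,11,13,17,23,31,37],[(2,3),(3,3),(2,5),(2,7),(2,10),(2,13),(2,14),(2,17),
    (2,20)],40,0,3,37,20,31,14)"
definition cf105 :: config where
  "cf105 = ([1,2,3,5,7,11,13,19,31,43,47],[(2,2),(2,3),(2,4),(3,3),(2,6),(2,7),(3,5),(2,11),
    (5,5),(2,14),(2,15),(5,7),(2,19),(2,22),(2,25),(5,11),(2,28)],0,1,6,31,44,9,56)"
definition cf106 :: config where
  "cf106 = ([1,2,3,5,7,11,17,19,23,29,31,41,43],[(2,2),(2,3),(2,4),(3,3),(2,5),(2,6),(2,7),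
    (3,5),(2,8),(2,10),(2,16),(2,17),(2,19),(2,20),(3,15),(2,23)],46,0,1,41,12,3,32)"

text \<open>For p = 7 the points are the whole field in cyclic order. Every line is a translate of
  {0, 1, 3}, and its differences \<plusminus>1, \<plusminus>2, \<plusminus>3 are exactly the three
  cosets of the group {1, -1} of cubes.\<close>

lemma segment_0: "segment_ok [1..1]
    [(7, cf41)]"
  by code_simp

lemma segment_1: "segment_ok [3..59]
    [(19, cf43),(31, cf42),(37, cf1),(43, cf66),(61, cf10),(67, cf13),(73, cf6),(79, cf38),(97, cf2),(103, cf5),
     (109, cf14),(127, cf46),(139, cf1),(151, cf10),(157, cf37),(163, cf1),(181, cf1),(193, cf15),(199, cf7),
     (211, cf7),(223, cf8),(229, cf4),(241, cf1),(271, cf11),(277, cf4),(283, cf4),(307, cf17),(313, cf1),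
     (331, cf3),(337, cf1),(349, cf1)]"
  by code_simp

lemma segment_2: "segment_ok [60..116]
    [(367, cf65),(373, cf2),(379, cf1),(397, cf5),(409, cf1),(421, cf1),(433, cf49),(439, cf59),(457, cf31),
     (463, cf3),(487, cf3),(499, cf20),(523, cf15),(541, cf1),(547, cf11),(571, cf1),(577, cf15),(601, cf57),
     (607, cf1),(613, cf11),(619, cf16),(631, cf1),(643, cf103),(661, cf6),(673, cf3),(691, cf24)]"
  by code_simp

lemma segment_3: "segment_ok [117..173]
    [(709, cf2),(727, cf27),(733, cf36),(739, cf26),(751, cf1),(757, cf10),(769, cf3),(787, cf10),(811, cf8),
     (823, cf7),(829, cf3),(853, cf83),(859, cf1),(877, cf1),(883, cf2),(907, cf23),(919, cf39),(937, cf1),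
     (967, cf5),(991, cf16),(997, cf91),(1009, cf16),(1021, cf94),(1033, cf1),(1039, cf80)]"
  by code_simp

lemma segment_4: "segment_ok [174..230]
    [(1051, cf5),(1063, cf7),(1069, cf47),(1087, cf1),(1093, cf52),(1117, cf69),(1123, cf1),(1129, cf2),
     (1153, cf2),(1171, cf1),(1201, cf3),(1213, cf9),(1231, cf23),(1237, cf9),(1249, cf11),(1279, cf2),(1291, cf1),
     (1297, cf1),(1303, cf55),(1321, cf5),(1327, cf68),(1381, cf2)]"
  by code_simp

lemma segment_5: "segment_ok [231..287]
    [(1399, cf74),(1423, cf51),(1429, cf7),(1447, cf1),(1453, cf1),(1459, cf79),(1471, cf50),(1483, cf1),
     (1489, cf3),(1531, cf58),(1543, cf32),(1549, cf90),(1567, cf2),(1579, cf8),(1597, cf100),(1609, cf13),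
     (1621, cf16),(1627, cf26),(1657, cf96),(1663, cf2),(1669, cf5),(1693, cf1),(1699, cf77),(1723, cf73)]"
  by code_simp

lemma segment_6: "segment_ok [288..344]
    [(1741, cf1),(1747, cf1),(1753, cf40),(1759, cf22),(1777, cf8),(1783, cf10),(1789, cf5),(1801, cf4),
     (1831, cf85),(1861, cf22),(1867, cf18),(1873, cf25),(1879, cf5),(1933, cf76),(1951, cf2),(1987, cf38),
     (1993, cf9),(1999, cf12),(2011, cf1),(2017, cf21),(2029, cf32),(2053, cf3)]"
  by code_simp

lemma segment_7: "segment_ok [345..401]
    [(2083, cf2),(2089, cf14),(2113, cf4),(2131, cf6),(2137, cf3),(2143, cf4),(2161, cf1),(2179, cf33),
     (2203, cf101),(2221, cf13),(2239, cf1),(2251, cf33),(2269, cf10),(2281, cf28),(2287, cf70),(2293, cf2),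
     (2311, cf1),(2341, cf20),(2347, cf12),(2371, cf1),(2377, cf9),(2383, cf93),(2389, cf13)]"
  by code_simp

lemma segment_8: "segment_ok [402..458]
    [(2437, cf2),(2467, cf23),(2473, cf1),(2503, cf62),(2521, cf7),(2539, cf1),(2551, cf3),(2557, cf2),(2593, cf7),
     (2617, cf87),(2647, cf1),(2659, cf9),(2671, cf92),(2677, cf1),(2683, cf3),(2689, cf4),(2707, cf1),
     (2713, cf10),(2719, cf1),(2731, cf21),(2749, cf99)]"
  by code_simp

lemma segment_9: "segment_ok [459..515]
    [(2767, cf8),(2791, cf31),(2797, cf2),(2803, cf22),(2833, cf8),(2851, cf18),(2857, cf1),(2887, cf2),
     (2917, cf28),(2953, cf102),(2971, cf35),(3001, cf88),(3019, cf19),(3037, cf3),(3049, cf6),(3061, cf30),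
     (3067, cf19),(3079, cf18)]"
  by code_simp

lemma segment_10: "segment_ok [516..572]
    [(3109, cf6),(3121, cf2),(3163, cf12),(3169, cf1),(3181, cf17),(3187, cf6),(3217, cf6),(3229, cf30),
     (3253, cf11),(3259, cf8),(3271, cf64),(3301, cf2),(3307, cf2),(3313, cf7),(3319, cf6),(3331, cf4),
     (3343, cf17),(3361, cf1),(3373, cf35),(3391, cf4),(3433, cf1)]"
  by code_simp

lemma segment_11: "segment_ok [573..629]
    [(3457, cf36),(3463, cf95),(3469, cf2),(3499, cf61),(3511, cf1),(3517, cf10),(3529, cf29),(3541, cf71),
     (3547, cf1),(3559, cf1),(3571, cf1),(3583, cf3),(3607, cf48),(3613, cf1),(3631, cf105),(3637, cf1),
     (3643, cf2),(3673, cf2),(3691, cf9),(3697, cf34),(3709, cf3),(3727, cf1),(3733, cf84),(3739, cf11),(3769, cf2)]"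
  by code_simp

lemma segment_12: "segment_ok [630..686]
    [(3793, cf67),(3823, cf86),(3847, cf53),(3853, cf56),(3877, cf1),(3889, cf39),(3907, cf19),(3919, cf1),
     (3931, cf1),(3943, cf5),(3967, cf13),(4003, cf1),(4021, cf1),(4027, cf8),(4051, cf12),(4057, cf17),
     (4093, cf5),(4099, cf29),(4111, cf1)]"
  by code_simp

lemma segment_13: "segment_ok [687..743]
    [(4129, cf14),(4153, cf44),(4159, cf9),(4177, cf20),(4201, cf1),(4219, cf1),(4231, cf3),(4243, cf7),
     (4261, cf1),(4273, cf63),(4297, cf1),(4327, cf25),(4339, cf54),(4357, cf1),(4363, cf1),(4423, cf4),
     (4441, cf1),(4447, cf60)]"
  by code_simp

lemma segment_14: "segment_ok [744..800]
    [(4483, cf6),(4507, cf1),(4513, cf97),(4519, cf24),(4549, cf82),(4561, cf1),(4567, cf4),(4591, cf3),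
     (4597, cf21),(4603, cf1),(4621, cf2),(4639, cf81),(4651, cf14),(4657, cf40),(4663, cf24),(4723, cf7),
     (4729, cf75),(4759, cf12),(4783, cf27),(4789, cf34),(4801, cf1)]"
  by code_simp

lemma segment_15: "segment_ok [801..857]
    [(4813, cf9),(4831, cf1),(4861, cf1),(4903, cf1),(4909, cf26),(4933, cf19),(4951, cf15),(4957, cf6),
     (4969, cf6),(4987, cf1),(4993, cf5),(4999, cf1),(5011, cf11),(5023, cf1),(5059, cf106),(5077, cf18),
     (5101, cf104),(5107, cf1),(5113, cf72),(5119, cf1)]"
  by code_simp

lemma segment_16: "segment_ok [858..912]
    [(5167, cf14),(5179, cf45),(5197, cf78),(5209, cf5),(5227, cf27),(5233, cf98),(5281, cf25),(5323, cf89),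
     (5347, cf8),(5407, cf9),(5413, cf12),(5419, cf37),(5431, cf1),(5437, cf4),(5443, cf3),(5449, cf4)]"
  by code_simp

lemmas segments = segment_0 segment_1 segment_2 segment_3 segment_4 segment_5 segment_6 segment_7 segment_8 segment_9 segment_10
  segment_11 segment_12 segment_13 segment_14 segment_15 segment_16

lemma certificates_complete:
  fixes p :: nat
  assumes p: "prime p" "p mod 6 = 1" "p \<noteq> 13" "p < 5476"
  shows "\<exists>c. config_ok (int p) (int_num ((int p - 1) div 3)) c"
proof -
  define k where "k = int p div 6"
  have "int p mod 6 = 1" using p(2) by (metis of_nat_1 of_nat_numeral zmod_int)
  then have pk: "int p = 6 * k + 1" unfolding k_def by presburger
  have pr: "prime (6 * k + 1)" using p(1) pk by (metis prime_nat_int_transfer)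
  have "p > 1" using p(1) by (rule prime_gt_1_nat)
  then have k: "1 \<le> k" "k \<noteq> 2" "k \<le> 912" using pk p(3,4) by auto
  \<comment> \<open>The index of the segment containing k. Segments start at k = 3, because k = 1
    has a segment of its own and k = 2 is the prime 13.\<close>
  define j where "j = (k - 3) div 57"
  have jk: "57 * j + 3 \<le> k" "k \<le> 57 * j + 59" unfolding j_def by presburger+
  have "\<exists>c. config_ok (6 * k + 1) (int_num (2 * k)) c"
  proof (cases "k = 1")
    case True
    then show ?thesis by (intro segment_0[THEN segment_ok_prime] pr) simp
  next
    case False
    then have "j \<in> set [0..15]" using k jk unfolding set_upto atLeastAtMost_iff by linarith
    moreover have "set [0..15] = {0, 1, 2, 3, 4, 5, 6, 7, 8, 9, 10, 11, 12, 13, 14, 15 :: int}" by code_simp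
    ultimately have "j \<in> {0, 1, 2, 3, 4, 5, 6, 7, 8, 9, 10, 11, 12, 13, 14, 15}" by (simp only:)
    then show ?thesis using jk k
      by (elim insertE emptyE; hypsubst)
        (rule segments[THEN segment_ok_prime, OF _ pr], simp only: set_upto atLeastAtMost_iff, linarith)+
  qed
  moreover have "(int p - 1) div 3 = 2 * k" using pk by simp
  ultimately show ?thesis by (simp only: pk)
qed

section \<open>Existence of regular Fano Kaleidoscopes\<close>

text \<open>A multiplicative formulation: the property is closed under products, so prime powers can
  be treated one at a time and powers of an admissible factor come for free.\<close>

definition admissible_factor :: "nat \<Rightarrow> bool" where
  "admissible_factor q \<longleftrightarrow>
     (\<forall>v. ex_fano_difference_family v \<longrightarrow> ex_fano_difference_family (v * q))"

lemma admissible_factor_1: "admissible_factor 1"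
  by (simp add: admissible_factor_def)

lemma admissible_factor_mult: "admissible_factor q \<Longrightarrow> admissible_factor r \<Longrightarrow> admissible_factor (q * r)"
  unfolding admissible_factor_def by (metis mult.assoc)

lemma admissible_factor_power: "admissible_factor q \<Longrightarrow> admissible_factor (q ^ n)"
  by (induction n) (simp_all add: admissible_factor_1[simplified] admissible_factor_mult)

lemma (in cubic_field) order_ge_7: "order R \<ge> 7"
proof -
  have "card {\<zero>, \<one>} \<le> order R" unfolding order_def by (rule card_mono[OF finite_carrier]) simp
  then have "order R \<ge> 2" by simp
  then show ?thesis using order_mod_6 by presburger
qed

lemma admissible_factor_rainbow:
  assumes R: "cubic_field R" and P: "\<exists>P. rainbow_fano R P"
  shows "admissible_factor (order R)"
proof -
  interpret cubic_field R by fact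
  obtain B where B: "fano_difference_family (add_monoid R) B"
    using P rainbow_fano_difference_family by blast
  show ?thesis
    unfolding admissible_factor_def
    using ex_fano_difference_family_mult[OF _ field_axioms finite_carrier order_ge_7 B] by blast
qed

lemma admissible_factor_prime:
  assumes p: "prime p" "p mod 6 = 1" "p \<noteq> 13"
  shows "admissible_factor p"
proof -
  interpret cubic_field "residue_ring (int p)" by (rule cubic_field_residue_ring(1)[OF p(1,2)])
  have o: "order (residue_ring (int p)) = p" by (rule cubic_field_residue_ring(2)[OF p(1,2)])
  have "\<exists>P. rainbow_fano (residue_ring (int p)) P"
  proof (cases "p < 5476")
    case True
    from certificates_complete[OF p True] show ?thesis
      by (elim exE) (rule config_ok_rainbow_fano[OF p(1,2)])
  next
    case False
    then show ?thesis using rainbow_fano_large o by simp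
  qed
  then show ?thesis using admissible_factor_rainbow[OF cubic_field_axioms] o by simp
qed

section \<open>Fields of square and cube order\<close>

definition quad_mul_mod :: "int \<Rightarrow> int \<Rightarrow> int \<times> int \<Rightarrow> int \<times> int \<Rightarrow> int \<times> int" where
  "quad_mul_mod p w x y = quad_red p (quad_mult w x y)"

fun quad_sub_mod :: "int \<Rightarrow> int \<times> int \<Rightarrow> int \<times> int \<Rightarrow> int \<times> int" where
  "quad_sub_mod p (a, b) (c, d) = ((a - c) mod p, (b - d) mod p)"

fun quad_in_range :: "int \<Rightarrow> int \<times> int \<Rightarrow> bool" where
  "quad_in_range p (a, b) = (in_range p a \<and> in_range p b)"

definition quad_points_ok where
  "quad_points_ok p w a0 a1 a2 a3 a4 a5 a6 \<longleftrightarrow>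
     list_all (quad_in_range p) [a0, a1, a2, a3, a4, a5, a6] \<and>
     ring_points_ok (quad_mul_mod p w) (quad_sub_mod p) (int_num ((p * p - 1) div 3)) a0 a1 a2 a3 a4 a5 a6"

lemma quadratic_ring_order: "order (quadratic_ring (int p) w) = p * p" if "p > 0"
  using that by (simp add: order_def quadratic_ring_carrier card_cartesian_product)

lemma quadratic_ring_cubic_field:
  fixes p :: nat
  assumes p: "prime p" "p * p mod 6 = 1"
    and irr: "\<And>a b. int p dvd a * a - w * (b * b) \<Longrightarrow> int p dvd a \<and> int p dvd b"
  shows "cubic_field (quadratic_ring (int p) w)"
proof -
  have p0: "p > 0" using p(1) prime_gt_0_nat by blast
  have "field (quadratic_ring (int p) w)" 
    using p(1) irr by (intro quadratic_ring_field) (simp only: prime_nat_int_transfer, blast)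
  then show ?thesis
    using p p0 quadratic_ring_order[OF p0] quadratic_ring_carrier[of "int p" w]
    by (simp add: cubic_field_def cubic_field_axioms_def)
qed

lemma quad_points_ok_rainbow_fano:
  fixes p :: nat
  assumes p: "prime p" "p * p mod 6 = 1" and ok: "quad_points_ok (int p) w a0 a1 a2 a3 a4 a5 a6"
  shows "\<exists>P. rainbow_fano (quadratic_ring (int p) w) P"
proof (rule ring_points_ok_rainbow_fano[OF quadratic_ring_cring])
  have p1: "p > 1" using p(1) prime_gt_1_nat by blast
  show "quad_mul_mod (int p) w x y = x \<otimes>\<^bsub>quadratic_ring (int p) w\<^esub> y" for x y
    by (simp add: quad_mul_mod_def reduction_ring_def)
  show "quad_sub_mod (int p) x y = x \<ominus>\<^bsub>quadratic_ring (int p) w\<^esub> y"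
    if "x \<in> carrier (quadratic_ring (int p) w)" "y \<in> carrier (quadratic_ring (int p) w)" for x y
    unfolding reduction_ring_diff[OF quadratic_ring_cring quad_red_add that]
    by (cases x; cases y) simp
  have "p * p > 1" using p1 by (metis less_1_mult)
  then show "numeral (int_num ((int p * int p - 1) div 3)) = (order (quadratic_ring (int p) w) - 1) div 3"
    using numeral_exponent[OF p(2)] quadratic_ring_order[of p w] p1 by simp
  show "ring_points_ok (quad_mul_mod (int p) w) (quad_sub_mod (int p)) (int_num ((int p * int p - 1) div 3)) a0 a1 a2 a3 a4 a5 a6"
    using ok by (simp add: quad_points_ok_def)
  have "x \<in> carrier (quadratic_ring (int p) w)" if "quad_in_range (int p) x" for x
    using that p1 by (cases x) (simp add: quadratic_ring_carrier in_range_def)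
  then show "{a0, a1, a2, a3, a4, a5, a6} \<subseteq> carrier (quadratic_ring (int p) w)"
    using ok by (simp add: quad_points_ok_def)
qed

text \<open>Since p^2 < 5476 means p < 74, the ten primes from 5 to 71 that are 5 modulo 6 are all
  that \<open>rainbow_fano_large\<close> leaves open for p^2.\<close>

lemma quad_points_5: "quad_points_ok 5 (-3) (0, 0) (0, 1) (1, 0) (1, 2) (0, 2) (3, 3) (3, 4)" by code_simp
lemma quad_points_11: "quad_points_ok 11 (-3) (0, 0) (0, 1) (1, 0) (3, 3) (1, 2) (2, 5) (4, 2)" by code_simp
lemma quad_points_17: "quad_points_ok 17 (-3) (0, 0) (0, 1) (1, 0) (1, 3) (3, 3) (5, 2) (10, 1)" by code_simp
lemma quad_points_23: "quad_points_ok 23 (-3) (0, 0) (0, 1) (1, 0) (3, 3) (1, 2) (0, 5) (4, 3)" by code_simp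
lemma quad_points_29: "quad_points_ok 29 (-3) (0, 0) (0, 1) (1, 0) (2, 2) (1, 2) (4, 1) (17, 16)" by code_simp
lemma quad_points_41: "quad_points_ok 41 (-3) (0, 0) (0, 1) (1, 0) (2, 2) (1, 2) (3, 0) (13, 1)" by code_simp
lemma quad_points_47: "quad_points_ok 47 (-3) (0, 0) (0, 1) (1, 0) (1, 2) (0, 2) (4, 1) (7, 10)" by code_simp
lemma quad_points_53: "quad_points_ok 53 (-3) (0, 0) (0, 1) (1, 0) (4, 2) (4, 4) (2, 1) (14, 6)" by code_simp
lemma quad_points_59: "quad_points_ok 59 (-3) (0, 0) (0, 1) (1, 0) (3, 5) (1, 2) (5, 6) (14, 1)" by code_simp
lemma quad_points_71: "quad_points_ok 71 (-3) (0, 0) (0, 1) (1, 0) (2, 4) (4, 4) (8, 3) (9, 18)" by code_simp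
lemma quad_points_13: "quad_points_ok 13 2 (0, 0) (0, 1) (1, 0) (1, 2) (0, 2) (1, 7) (2, 7)" by code_simp

lemma mod_6_square: "(p::nat) mod 6 = 1 \<or> p mod 6 = 5 \<Longrightarrow> p * p mod 6 = 1"
  using mod_mult_eq[of p 6 p] by auto

lemma admissible_factor_square:
  assumes p: "prime p" "p mod 6 = 5"
  shows "admissible_factor (p * p)"
proof -
  have sq: "p * p mod 6 = 1" using mod_6_square p(2) by blast
  note sound = quad_points_ok_rainbow_fano[OF p(1) sq]
  have p0: "p > 0" using p(1) prime_gt_0_nat by blast
  interpret cubic_field "quadratic_ring (int p) (-3)"
    by (rule quadratic_ring_cubic_field[OF p(1) sq minus_three_not_square[OF p]])
  have o: "order (quadratic_ring (int p) (-3)) = p * p" using quadratic_ring_order[OF p0] .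
  have "\<exists>P. rainbow_fano (quadratic_ring (int p) (-3)) P"
  proof (cases "p < 74")
    case True
    \<comment> \<open>The only composite numbers below 74 that are 5 modulo 6.\<close>
    have "p \<noteq> 35" "p \<noteq> 65" using p(1) by (auto simp: prime_nat_iff dest: spec[of _ 5])
    then have "p = 5 \<or> p = 11 \<or> p = 17 \<or> p = 23 \<or> p = 29 \<or> p = 41 \<or> p = 47 \<or> p = 53 \<or> p = 59 \<or> p = 71"
      using True p(2) by presburger
    then show ?thesis
    proof (elim disjE)
      assume "p = 5" then show ?thesis using sound quad_points_5 by simp
    next
      assume "p = 11" then show ?thesis using sound quad_points_11 by simp
    next
      assume "p = 17" then show ?thesis using sound quad_points_17 by simp
    next
      assume "p = 23" then show ?thesis using sound quad_points_23 by simp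
    next
      assume "p = 29" then show ?thesis using sound quad_points_29 by simp
    next
      assume "p = 41" then show ?thesis using sound quad_points_41 by simp
    next
      assume "p = 47" then show ?thesis using sound quad_points_47 by simp
    next
      assume "p = 53" then show ?thesis using sound quad_points_53 by simp
    next
      assume "p = 59" then show ?thesis using sound quad_points_59 by simp
    next
      assume "p = 71" then show ?thesis using sound quad_points_71 by simp
    qed
  next
    case False
    then have "74 * 74 \<le> p * p" by (intro mult_le_mono) auto
    then show ?thesis using rainbow_fano_large o by simp
  qed
  then show ?thesis using admissible_factor_rainbow[OF cubic_field_axioms] o by simp
qed

lemma admissible_factor_169: "admissible_factor 169"
proof -
  have p: "prime (13::nat)" "13 * 13 mod 6 = (1::nat)" by simp_all
  have f: "cubic_field (quadratic_ring (int 13) 2)"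
    by (rule quadratic_ring_cubic_field[OF p]) (unfold of_nat_numeral, rule two_not_square_mod_13)
  have "\<exists>P. rainbow_fano (quadratic_ring (int 13) 2) P"
    by (rule quad_points_ok_rainbow_fano[OF p]) (simp only: of_nat_numeral, rule quad_points_13)
  then show ?thesis using admissible_factor_rainbow[OF f] quadratic_ring_order[of 13 2] by simp
qed

definition cub_mul_mod :: "int \<Rightarrow> int \<Rightarrow> int \<times> int \<times> int \<Rightarrow> int \<times> int \<times> int \<Rightarrow> int \<times> int \<times> int" where
  "cub_mul_mod p w x y = cub_red p (cub_mult w x y)"

fun cub_sub_mod :: "int \<Rightarrow> int \<times> int \<times> int \<Rightarrow> int \<times> int \<times> int \<Rightarrow> int \<times> int \<times> int" where
  "cub_sub_mod p (a, b, c) (d, e, f) = ((a - d) mod p, (b - e) mod p, (c - f) mod p)"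

text \<open>The exponent is (13^3 - 1) / 3 = 732.\<close>

lemma cub_points_13:
  "ring_points_ok (cub_mul_mod 13 2) (cub_sub_mod 13) (int_num 732)
     (0, 0, 0) (0, 0, 1) (0, 1, 0) (1, 0, 0) (1, 0, 1) (1, 2, 3) (2, 0, 0)"
  by code_simp

lemma admissible_factor_2197: "admissible_factor 2197"
proof -
  let ?R = "cubic_ring 13 2"
  have car: "carrier ?R = {0..<13} \<times> {0..<13} \<times> {0..<13}" by (rule cubic_ring_carrier) simp
  have o: "order ?R = 2197" unfolding order_def car by (simp add: card_cartesian_product)
  have "field ?R" by (rule cubic_ring_field[OF _ cub_norm_13]) simp
  then have f: "cubic_field ?R"
    using car o by (simp add: cubic_field_def cubic_field_axioms_def)
  have "\<exists>P. rainbow_fano ?R P"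
  proof (rule ring_points_ok_rainbow_fano[OF cubic_ring_cring])
    show "cub_mul_mod 13 2 x y = x \<otimes>\<^bsub>?R\<^esub> y" for x y
      by (simp add: cub_mul_mod_def reduction_ring_def)
    show "cub_sub_mod 13 x y = x \<ominus>\<^bsub>?R\<^esub> y" if "x \<in> carrier ?R" "y \<in> carrier ?R" for x y
      unfolding reduction_ring_diff[OF cubic_ring_cring cub_red_add that]
      by (cases x; cases y) simp
    show "numeral (int_num 732) = (order ?R - 1) div 3" using numeral_int_num[of 732] o by simp
    show "ring_points_ok (cub_mul_mod 13 2) (cub_sub_mod 13) (int_num 732)
      (0, 0, 0) (0, 0, 1) (0, 1, 0) (1, 0, 0) (1, 0, 1) (1, 2, 3) (2, 0, 0)" by (rule cub_points_13)
  qed (simp add: car)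
  then show ?thesis using admissible_factor_rainbow[OF f] o by simp
qed

text \<open>Every exponent a \<ge> 2 is 2 k or 3 + 2 j, so the orders 169 and 2197 suffice.\<close>

lemma admissible_factor_13_power:
  assumes "a \<ge> 2"
  shows "admissible_factor (13 ^ a)"
proof (cases "even a")
  case True
  then obtain k where "a = 2 * k" by blast
  then have "(13::nat) ^ a = 169 ^ k" by (simp add: power_mult)
  then show ?thesis using admissible_factor_power[OF admissible_factor_169] by simp
next
  case False
  then obtain k where "a = 2 * k + 1" using oddE by blast
  then obtain j where "a = 3 + 2 * j" using assms by (intro that[of "k - 1"]) simp
  then have "(13::nat) ^ a = 2197 * 169 ^ j" by (simp add: power_add power_mult)
  then show ?thesis
    using admissible_factor_mult[OF admissible_factor_2197 admissible_factor_power[OF admissible_factor_169]] by simp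
qed

text \<open>The congruence rules out 2 and 3. If p is -1 modulo 6 it forces a to be even, so p^a is
  a power of p^2.\<close>

lemma admissible_factor_prime_power:
  fixes p a :: nat
  assumes p: "prime p" "a \<ge> 1" and mod6: "[p ^ a = 1] (mod 6)" and "p ^ a \<noteq> 13"
  shows "admissible_factor (p ^ a)"
proof -
  have m1: "p ^ a mod 6 = 1" using mod6 by (simp add: cong_def)
  have "\<not> 2 dvd p"
  proof
    assume "2 dvd p"
    then have "2 dvd p ^ a" using p(2) by (meson dvd_power dvd_trans less_le_trans zero_less_one)
    then show False using m1 by presburger
  qed
  moreover have "\<not> 3 dvd p"
  proof
    assume "3 dvd p"
    then have "3 dvd p ^ a" using p(2) by (meson dvd_power dvd_trans less_le_trans zero_less_one)
    then show False using m1 by presburger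
  qed
  ultimately have "p mod 6 = 1 \<or> p mod 6 = 5" by presburger
  then show ?thesis
  proof
    assume 1: "p mod 6 = 1"
    show ?thesis
    proof (cases "p = 13")
      case True
      then have "a \<noteq> 1" using assms(4) by auto
      then show ?thesis using admissible_factor_13_power[of a] p(2) True by simp
    next
      case False
      then show ?thesis using admissible_factor_power[OF admissible_factor_prime[OF p(1) 1]] by blast
    qed
  next
    assume 5: "p mod 6 = 5"
    have sq: "p * p mod 6 = 1" using mod_6_square 5 by blast
    have pw: "(p * p) ^ k mod 6 = 1" for k
      using power_mod[of "p * p" 6 k] by (simp add: sq)
    have "even a"
    proof (rule ccontr)
      assume "odd a"
      then obtain k where "a = 2 * k + 1" using oddE by blast
      then have "p ^ a = (p * p) ^ k * p" by (simp add: power_mult power2_eq_square)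
      then have "p ^ a mod 6 = ((p * p) ^ k mod 6) * (p mod 6) mod 6" by (simp only: mod_mult_eq)
      then show False using m1 pw 5 by simp
    qed
    then obtain k where "a = 2 * k" by blast
    then have "p ^ a = (p * p) ^ k" by (simp add: power_mult power2_eq_square)
    then show ?thesis using admissible_factor_power[OF admissible_factor_square[OF p(1) 5]] by simp
  qed
qed

text \<open>The trivial group has no difference to represent, so the empty family qualifies and can
  start the product.\<close>

lemma ex_fano_difference_family_1: "ex_fano_difference_family 1"
proof -
  define G :: "nat monoid" where "G = \<lparr>carrier = {0}, monoid.mult = (\<lambda>_ _. 0), one = 0\<rparr>"
  have "comm_group G" by (rule comm_groupI) (auto simp: G_def)
  moreover have "fano_difference_family G {}" by (simp add: fano_difference_family_def G_def)
  moreover have "order G = 1" "finite (carrier G)" by (simp_all add: order_def G_def)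
  ultimately show ?thesis unfolding ex_fano_difference_family_def by blast
qed

text \<open>The induction splits off the full power of one prime. The cofactor is coprime to it, so
  its maximal prime powers are maximal in v and the hypothesis is inherited.\<close>

lemma ex_fano_difference_family_of_factors:
  fixes v :: nat
  assumes "v > 0" "\<And>p a. prime p \<Longrightarrow> a \<ge> 1 \<Longrightarrow> p ^ a dvd v \<Longrightarrow> \<not> p ^ (a + 1) dvd v \<Longrightarrow> admissible_factor (p ^ a)"
  shows "ex_fano_difference_family v"
  using assms
proof (induction v rule: less_induct)
  case (less v)
  show ?case
  proof (cases "v = 1")
    case True
    then show ?thesis using ex_fano_difference_family_1 by simp
  next
    case False
    then obtain p where p: "prime p" "p dvd v" using prime_factor_nat by blast
    have np: "\<not> is_unit p" using p(1) by auto
    have v0: "v \<noteq> 0" using less.prems by simp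
    define a where "a = multiplicity p v"
    obtain w where w: "v = p ^ a * w" "\<not> p dvd w"
      using multiplicity_decompose'[OF v0 np] unfolding a_def by metis
    have a1: "a \<ge> 1" using w p(2) by (cases a) auto
    have w0: "w > 0" using v0 w by (cases w) auto
    have pa: "p ^ a > 1" by (rule one_less_power) (use a1 prime_gt_1_nat[OF p(1)] in auto)
    have "w < v" using w(1) w0 pa by (metis mult.commute mult_1_right nat_mult_less_cancel1)
    have "\<not> p ^ (a + 1) dvd v"
      using w p(1) by (simp add: prime_gt_0_nat)
    then have adm: "admissible_factor (p ^ a)" using less.prems(2)[OF p(1) a1] w(1) by simp
    have "ex_fano_difference_family w"
    proof (rule less.IH[OF \<open>w < v\<close> w0])
      fix r b :: nat assume r: "prime r" "b \<ge> 1" "r ^ b dvd w" "\<not> r ^ (b + 1) dvd w"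
      have "r dvd w" using r(2,3) by (metis dvd_power dvd_trans less_le_trans zero_less_one)
      then have "r \<noteq> p" using w(2) by blast
      then have cop: "coprime (r ^ (b + 1)) (p ^ a)" using primes_coprime[OF r(1) p(1)] by simp
      have "r ^ b dvd v" using r(3) w(1) by simp
      moreover have "\<not> r ^ (b + 1) dvd v"
        using r(4) coprime_dvd_mult_right_iff[OF cop] w(1) by simp
      ultimately show "admissible_factor (r ^ b)" using less.prems(2)[OF r(1,2)] by simp
    qed
    then show ?thesis using adm w(1) unfolding admissible_factor_def by (simp add: mult.commute)
  qed
qed

theorem theorem16:
  fixes v :: nat
  assumes "v > 0"
    and "\<And>p a :: nat. prime p \<Longrightarrow> a \<ge> 1 \<Longrightarrow> p ^ a dvd v \<Longrightarrow> \<not> p ^ (a + 1) dvd v \<Longrightarrow>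
           [p ^ a = 1] (mod 6) \<and> p ^ a \<noteq> 13"
  shows "\<exists>(V :: nat set) F. regular_fano_kaleidoscope v V F"
proof -
  have "ex_fano_difference_family v"
    by (rule ex_fano_difference_family_of_factors[OF assms(1)])
      (use assms(2) admissible_factor_prime_power in blast)
  then obtain G :: "nat monoid" and B where G: "comm_group G" "finite (carrier G)" "order G = v" "fano_difference_family G B"
    unfolding ex_fano_difference_family_def by blast
  show ?thesis using fano_difference_family_regular[OF G(1,2,4)] G(3) by blast
qed

end
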